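(* Let $f:[a,b]\to\mathbb{R}$ be continuous and strictly increasing, let $h_1,h_2,\dots$ be i.i.d. realizations of the warping process $H$, and let $Y_{ij}=f\circ h_i^{-1}(t_{ij})$, $i=1,\dots,m$, $j=1,\dots,n$. Let $f_{ES}^{-1}=\phi\circ f^{-1}$ and, for $y\in[f(a),f(b)]$, let $$\widehat{f_{ES}^{-1}}(y)=\frac1m\sum_{i=1}^m T_i(y),\qquad T_i(y)=t_{i j_i(y)},\qquad j_i(y)\in\arg\min_{j\in\{1,\dots,n\}}|Y_{ij}-y| .$$ Then, almost surely, $$\Big\|\widehat{f_{ES}^{-1}}-f_{ES}^{-1}\Big\|_\infty\longrightarrow 0\quad\text{as } m,n\to\infty .$$ Moreover, let $n=m^{\frac12+\alpha}$ with $\alpha>0$ and assume that there exist constants $C_1,C_2>0$ such that $$\mathbf{E}\big|H(s)-\mathbf{E}H(s)-(H(t)-\mathbf{E}H(t))\big|^2\le C_1|s-t|^2\quad\text{for all }(s,t)\in[a,b]^2,$$ $$|f^{-1}(s)-f^{-1}(t)|^2\le C_2|s-t|^2\quad\text{for all }(s,t)\in[f(a),f(b)]^2 .$$ Then $\sqrt m\,\big(\widehat{f_{ES}^{-1}}-f_{ES}^{-1}\big)$ converges weakly, as $m\to\infty$, to a centered Gaussian process $G$ indexed by $[f(a),f(b)]$ with covariance $$\mathrm{cov}(G(s),G(t))=\mathrm{r}\big(f^{-1}(s),f^{-1}(t)\big),\qquad (s,t)\in[f(a),f(b)]^2 .$$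
   Context: $H$ is a stochastic process on a probability space $(\Omega,\mathcal A,\mathbf P)$ with values in the space $\mathcal C([a,b])$ of real continuous functions on $[a,b]$, equipped with the uniform norm $\|\cdot\|_\infty$ and its Borel $\sigma$-algebra, such that for almost all $w\in\Omega$ the function $H(w,\cdot)$ is (strictly) increasing with $H(w,a)=a$ and $H(w,b)=b$. Write $H(t)$ for $H(\cdot,t)$; $\phi(t)=\mathbf E H(t)$ is its expectation and $\mathrm r(s,t)=\mathrm{cov}(H(s),H(t))$ its covariance function. The observation times are equidistant in $[a,b]$: $t_{ij}=a+(j-1)\frac{b-a}{n-1}$ for all $i$, $j=1,\dots,n$. The function $f_{ES}=f\circ\phi^{-1}$ is called the structural expectation. In $\arg\min$, ties are broken by any fixed rule. Convergence $u(m,n)\to c$ as $m,n\to\infty$ means: for all $\epsilon>0$ there is $(m_0,n_0)$ such that $|u(m,n)-c|<\epsilon$ whenever $m>m_0$ and $n>n_0$. Weak convergence of processes is with respect to the uniform norm (as bounded functions on $[f(a),f(b)]$). The value $m^{1/2+\alpha}$ is understood to be rounded to an integer. *)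

theory Defs
  imports "HOL-Probability.Probability"
begin

section \<open>Borel sets and weak convergence in metric spaces of functions\<close>

definition metric_borel :: "'a metric \<Rightarrow> 'a measure" where
  "metric_borel D = sigma (mspace D) {U. openin (mtopology_of D) U}"

text \<open>Functions on an interval are represented by extensional functions, as in
  \<^const>\<open>funspace\<close>; the metric of both spaces below is the one induced by the uniform norm.\<close>

abbreviation cont_space :: "real \<Rightarrow> real \<Rightarrow> (real \<Rightarrow> real) metric" where
  "cont_space a b \<equiv> cfunspace (top_of_set {a..b}) euclidean_metric"

abbreviation bounded_space :: "real \<Rightarrow> real \<Rightarrow> (real \<Rightarrow> real) metric" where
  "bounded_space c d \<equiv> funspace {c..d} euclidean_metric"

text \<open>Intended for bounded, possibly non-measurable \<open>Z\<close>: the set of integrable majorants is then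
  nonempty and their integrals are bounded below.\<close>

definition outer_expectation :: "'v measure \<Rightarrow> ('v \<Rightarrow> real) \<Rightarrow> real" where
  "outer_expectation P Z =
     (INF U \<in> {U. integrable P U \<and> (\<forall>\<omega> \<in> space P. Z \<omega> \<le> U \<omega>)}. \<integral>\<omega>. U \<omega> \<partial>P)"

text \<open>Weak convergence in the sense of Hoffmann-Jorgensen. The estimator has jumps, so it need not be
  Borel measurable as a map into the non-separable space of bounded functions; only
  the limit \<open>G\<close> is required to be Borel measurable.\<close>

definition weakly_converges ::
  "'v measure \<Rightarrow> 'd metric \<Rightarrow> (nat \<Rightarrow> 'v \<Rightarrow> 'd) \<Rightarrow> 'x measure \<Rightarrow> ('x \<Rightarrow> 'd) \<Rightarrow> bool" where
  "weakly_converges P D X N G \<longleftrightarrow>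
     (\<forall>m. \<forall>\<omega> \<in> space P. X m \<omega> \<in> mspace D) \<and>
     G \<in> measurable N (metric_borel D) \<and>
     (\<forall>g :: 'd \<Rightarrow> real.
        continuous_map (mtopology_of D) euclideanreal g \<and> bounded (g ` mspace D) \<longrightarrow>
        (\<lambda>m. outer_expectation P (\<lambda>\<omega>. g (X m \<omega>))) \<longlonglongrightarrow> (\<integral>x. g (G x) \<partial>N))"

section \<open>Gaussian processes\<close>

definition covariance :: "'w measure \<Rightarrow> ('w \<Rightarrow> real) \<Rightarrow> ('w \<Rightarrow> real) \<Rightarrow> real" where
  "covariance M X Y = (\<integral>w. (X w - (\<integral>v. X v \<partial>M)) * (Y w - (\<integral>v. Y v \<partial>M)) \<partial>M)"

text \<open>Degenerate (constant) normal variables are included: a process with covariance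
  \<open>r(f\<inverse>(s), f\<inverse>(t))\<close> is constant at both end points of the interval.\<close>

definition gaussian_variable :: "'x measure \<Rightarrow> ('x \<Rightarrow> real) \<Rightarrow> bool" where
  "gaussian_variable N Z \<longleftrightarrow>
     (\<exists>\<mu> \<sigma>. \<sigma> > 0 \<and> distributed N lborel Z (normal_density \<mu> \<sigma>)) \<or>
     (Z \<in> borel_measurable N \<and> (\<exists>\<mu>. AE x in N. Z x = \<mu>))"

definition gaussian_process :: "'x measure \<Rightarrow> 't set \<Rightarrow> ('x \<Rightarrow> 't \<Rightarrow> real) \<Rightarrow> bool" where
  "gaussian_process N T G \<longleftrightarrow>
     (\<forall>F c. finite F \<and> F \<subseteq> T \<longrightarrow> gaussian_variable N (\<lambda>x. \<Sum>t\<in>F. c t * G x t))"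

section \<open>Warping processes and the structural expectation\<close>

definition warping_process ::
  "'w measure \<Rightarrow> real \<Rightarrow> real \<Rightarrow> ('w \<Rightarrow> real \<Rightarrow> real) \<Rightarrow> bool" where
  "warping_process M a b H \<longleftrightarrow>
     H \<in> measurable M (metric_borel (cont_space a b)) \<and>
     (AE w in M. strict_mono_on {a..b} (H w) \<and> H w a = a \<and> H w b = b)"

definition mean_fun :: "'w measure \<Rightarrow> ('w \<Rightarrow> real \<Rightarrow> real) \<Rightarrow> real \<Rightarrow> real" where
  "mean_fun M H t = (\<integral>w. H w t \<partial>M)"

definition cov_fun :: "'w measure \<Rightarrow> ('w \<Rightarrow> real \<Rightarrow> real) \<Rightarrow> real \<Rightarrow> real \<Rightarrow> real" where
  "cov_fun M H s t = covariance M (\<lambda>w. H w s) (\<lambda>w. H w t)"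

definition iid_realizations ::
  "'v measure \<Rightarrow> real \<Rightarrow> real \<Rightarrow> (nat \<Rightarrow> 'v \<Rightarrow> real \<Rightarrow> real) \<Rightarrow>
   'w measure \<Rightarrow> ('w \<Rightarrow> real \<Rightarrow> real) \<Rightarrow> bool" where
  "iid_realizations P a b h M H \<longleftrightarrow>
     prob_space.indep_vars P (\<lambda>_. metric_borel (cont_space a b)) h {1..} \<and>
     (\<forall>i\<ge>1. distr P (metric_borel (cont_space a b)) (h i) =
             distr M (metric_borel (cont_space a b)) H)"

definition obs_time :: "real \<Rightarrow> real \<Rightarrow> nat \<Rightarrow> nat \<Rightarrow> real" where
  "obs_time a b n j = a + (real j - 1) * ((b - a) / (real n - 1))"

definition observation ::
  "real \<Rightarrow> real \<Rightarrow> (real \<Rightarrow> real) \<Rightarrow> (nat \<Rightarrow> 'v \<Rightarrow> real \<Rightarrow> real) \<Rightarrow> nat \<Rightarrow> nat \<Rightarrow> nat \<Rightarrow> 'v \<Rightarrow> real" where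
  "observation a b f h n i j \<omega> = f (inv_into {a..b} (h i \<omega>) (obs_time a b n j))"

text \<open>A selection \<open>J\<close> chooses a nearest observation; as it may depend on everything that
  determines the data, every tie-breaking rule is covered.\<close>

definition nearest_selection ::
  "'v measure \<Rightarrow> real \<Rightarrow> real \<Rightarrow> (real \<Rightarrow> real) \<Rightarrow> (nat \<Rightarrow> 'v \<Rightarrow> real \<Rightarrow> real) \<Rightarrow>
   (nat \<Rightarrow> nat \<Rightarrow> real \<Rightarrow> 'v \<Rightarrow> nat) \<Rightarrow> bool" where
  "nearest_selection P a b f h J \<longleftrightarrow>
     (\<forall>n\<ge>1. \<forall>i\<ge>1. \<forall>y \<in> {f a..f b}. \<forall>\<omega> \<in> space P.
        is_arg_min (\<lambda>j. \<bar>observation a b f h n i j \<omega> - y\<bar>) (\<lambda>j. j \<in> {1..n}) (J n i y \<omega>))"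

definition estimator ::
  "real \<Rightarrow> real \<Rightarrow> (nat \<Rightarrow> nat \<Rightarrow> real \<Rightarrow> 'v \<Rightarrow> nat) \<Rightarrow> nat \<Rightarrow> nat \<Rightarrow> 'v \<Rightarrow> real \<Rightarrow> real" where
  "estimator a b J m n \<omega> y = (1 / real m) * (\<Sum>i = 1..m. obs_time a b n (J n i y \<omega>))"

definition struct_exp_inv ::
  "'w measure \<Rightarrow> ('w \<Rightarrow> real \<Rightarrow> real) \<Rightarrow> real \<Rightarrow> real \<Rightarrow> (real \<Rightarrow> real) \<Rightarrow> real \<Rightarrow> real" where
  "struct_exp_inv M H a b f = mean_fun M H \<circ> inv_into {a..b} f"

end

theory Submission
  imports Defs "HOL-Real_Asymp.Real_Asymp"
begin

text \<open>
  The nearest observation determines \<open>h\<^sub>i (f\<inverse> y)\<close> up to the mesh of the time grid, uniformly in \<open>y\<close>, so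
  the estimator may be replaced by the empirical mean of the warpings at \<open>f\<inverse> y\<close>. Consistency is then
  the strong law at countably many points (Hoeffding and Borel-Cantelli), made uniform by
  monotonicity. For the second part the mesh is \<open>o(1/\<surd>m)\<close>, and a functional central limit theorem for
  the normalized sums remains. The second moment condition bounds all dyadic increments (chaining):
  with high probability the normalized sums, restricted to the dyadic points, lie in a fixed set of
  Hoelder type that is compact for pointwise convergence and on which pointwise and uniform
  convergence agree. By Stone-Weierstrass a bounded continuous functional is close on
  this set to a bounded combination of cosines of linear functionals, whose expectations
  converge by the one-dimensional central limit theorem. The limit process is built from independent
  normal variables by factoring the covariance with Gram-Schmidt in \<open>L\<^sup>2\<close>.
\<close>

section \<open>Trigonometric polynomials in countably many variables\<close>

text \<open>The estimator takes values in a nonseparable space and need not be Borel there, so its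
  law cannot be handled directly. Measure theory is therefore done on the countable family of dyadic
  coordinates, and \<open>outer_expectation\<close> enters only through a measurable sandwich. The
  price is that passing from coordinates back to functions is continuous for the uniform metric only
  on paths with a fixed increment constant. Approximants are thus needed that are close to the
  functional on such a set and, off it, bounded independently of the set. Cosines of linear
  functionals span an algebra of bounded functions whose expectations are real parts of
  characteristic functions, so finite-dimensional convergence reduces to one real variable. The
  limit law is built directly from its covariance instead of being extracted from tightness. The
  dyadic points are taken in time, not in y: there the second moment condition governs the
  increments, and y enters only through the fixed map \<open>finv\<close>.\<close>

inductive trig_polynomial :: "(('i \<Rightarrow> real) \<Rightarrow> real) \<Rightarrow> bool" where
  wave: "finite F \<Longrightarrow> trig_polynomial (\<lambda>v. c * cos (\<theta> + (\<Sum>i\<in>F. u i * v i)))"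
| add: "trig_polynomial p \<Longrightarrow> trig_polynomial q \<Longrightarrow> trig_polynomial (\<lambda>v. p v + q v)"

lemma trig_polynomial_const: "trig_polynomial (\<lambda>_. c)"
  using wave[of "{}" c 0] by simp

text \<open>Product-to-sum formula: a product of two cosines is half the sum of the cosines of the
  difference and of the sum of the phases. The supports \<open>F\<close> and \<open>F'\<close> may
  overlap, so \<open>w s\<close> extends both frequency vectors by zero to the union before
  combining them with sign \<open>s\<close>.\<close>

lemma trig_polynomial_wave_mult:
  assumes "finite F" "trig_polynomial q"
  shows "trig_polynomial (\<lambda>v. c * cos (\<theta> + (\<Sum>i\<in>F. u i * v i)) * q v)"
  using assms(2)
proof induction
  case (wave F' c' \<theta>' u')
  define w where "w s i = (if i \<in> F then u i else 0) + s * (if i \<in> F' then u' i else 0)" for s i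
  have sums: "(\<Sum>i\<in>F. u i * v i) + s * (\<Sum>i\<in>F'. u' i * v i) = (\<Sum>i\<in>F\<union>F'. w s i * v i)" for s v
  proof -
    have "(\<Sum>i\<in>F. u i * v i) = (\<Sum>i\<in>F\<union>F'. (if i \<in> F then u i else 0) * v i)"
      by (rule sum.mono_neutral_cong_left) (use assms(1) wave in auto)
    moreover have "(\<Sum>i\<in>F'. u' i * v i) = (\<Sum>i\<in>F\<union>F'. (if i \<in> F' then u' i else 0) * v i)"
      by (rule sum.mono_neutral_cong_left) (use assms(1) wave in auto)
    ultimately show ?thesis
      by (simp add: w_def sum_distrib_left sum.distrib algebra_simps)
  qed
  have "trig_polynomial (\<lambda>v. (c * c' / 2) * cos ((\<theta> - \<theta>') + (\<Sum>i\<in>F\<union>F'. w (-1) i * v i))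
      + (c * c' / 2) * cos ((\<theta> + \<theta>') + (\<Sum>i\<in>F\<union>F'. w 1 i * v i)))"
    using assms(1) wave by (intro trig_polynomial.intros) auto
  moreover have "(\<lambda>v. c * cos (\<theta> + (\<Sum>i\<in>F. u i * v i)) * (c' * cos (\<theta>' + (\<Sum>i\<in>F'. u' i * v i)))) =
    (\<lambda>v. (c * c' / 2) * cos ((\<theta> - \<theta>') + (\<Sum>i\<in>F\<union>F'. w (-1) i * v i))
      + (c * c' / 2) * cos ((\<theta> + \<theta>') + (\<Sum>i\<in>F\<union>F'. w 1 i * v i)))"
  proof
    fix v
    let ?A = "\<theta> + (\<Sum>i\<in>F. u i * v i)" and ?B = "\<theta>' + (\<Sum>i\<in>F'. u' i * v i)"
    have "(\<theta> - \<theta>') + (\<Sum>i\<in>F\<union>F'. w (-1) i * v i) = ?A - ?B"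
      "(\<theta> + \<theta>') + (\<Sum>i\<in>F\<union>F'. w 1 i * v i) = ?A + ?B"
      using sums[of v "-1"] sums[of v 1] by auto
    moreover have "c * cos A * (c' * cos B) = (c * c' / 2) * cos (A - B) + (c * c' / 2) * cos (A + B)" for A B
      by (simp add: cos_add cos_diff field_simps)
    ultimately show "c * cos ?A * (c' * cos ?B) =
      (c * c' / 2) * cos ((\<theta> - \<theta>') + (\<Sum>i\<in>F\<union>F'. w (-1) i * v i))
      + (c * c' / 2) * cos ((\<theta> + \<theta>') + (\<Sum>i\<in>F\<union>F'. w 1 i * v i))" by metis
  qed
  ultimately show ?case by simp
next
  case (add p q)
  then show ?case
    using trig_polynomial.add[OF add.IH] by (simp add: algebra_simps)
qed

lemma trig_polynomial_mult:
  "trig_polynomial p \<Longrightarrow> trig_polynomial q \<Longrightarrow> trig_polynomial (\<lambda>v. p v * q v)"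
proof (induction rule: trig_polynomial.induct)
  case (wave F c \<theta> u)
  then show ?case using trig_polynomial_wave_mult by blast
next
  case (add p p')
  then show ?case
    using trig_polynomial.add[of "\<lambda>v. p v * q v" "\<lambda>v. p' v * q v"] by (simp add: algebra_simps)
qed

lemma trig_polynomial_compose:
  assumes "real_polynomial_function q" "trig_polynomial p"
  shows "trig_polynomial (\<lambda>v. q (p v))"
  using assms(1)
proof induction
  case (linear f)
  then interpret bounded_linear f .
  have "(\<lambda>v. f (p v)) = (\<lambda>v. f 1 * p v)"
  proof
    fix v show "f (p v) = f 1 * p v" using scaleR[of "p v" 1] by simp
  qed
  then show ?case
    using trig_polynomial_mult[OF trig_polynomial_const assms(2), of "f 1"] by (simp only:)
qed (simp_all add: trig_polynomial_const trig_polynomial_mult trig_polynomial.add)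

lemma trig_polynomial_bounded:
  "trig_polynomial p \<Longrightarrow> \<exists>B. \<forall>v. \<bar>p v\<bar> \<le> B"
proof (induction rule: trig_polynomial.induct)
  case (wave F c \<theta> u)
  have "\<bar>c * cos x\<bar> \<le> \<bar>c\<bar>" for x
    using abs_cos_le_one[of x] by (simp add: abs_mult mult_left_le)
  then show ?case by blast
next
  case (add p q)
  then obtain B B' where "\<And>v. \<bar>p v\<bar> \<le> B" "\<And>v. \<bar>q v\<bar> \<le> B'" by auto
  then have "\<bar>p v + q v\<bar> \<le> B + B'" for v
    by (meson abs_triangle_ineq add_mono order_trans)
  then show ?case by blast
qed

lemma trig_polynomial_continuous:
  "trig_polynomial p \<Longrightarrow> continuous_on S p"
proof (induction rule: trig_polynomial.induct)
  case (wave F c \<theta> u)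
  have "continuous_on S (\<lambda>v. v i)" for i :: 'a
    by (rule continuous_on_product_then_coordinatewise) (rule continuous_on_id)
  then have "continuous_on S (\<lambda>v. \<theta> + (\<Sum>i\<in>F. u i * v i))" by (intro continuous_intros)
  then show ?case
    by (intro continuous_on_mult_left continuous_on_compose2[OF continuous_on_cos[OF continuous_on_id]]) auto
qed (rule continuous_on_add)

lemma trig_polynomial_borel [measurable_dest]:
  "trig_polynomial (p :: ('i::countable \<Rightarrow> real) \<Rightarrow> real) \<Longrightarrow> p \<in> borel_measurable borel"
  by (rule borel_measurable_continuous_onI) (rule trig_polynomial_continuous)

text \<open>A coordinate in which the points differ is scaled by \<open>s\<close> into the interval
  from -pi/2 to pi/2, where sine is injective. The phase -pi/2 turns the cosine into a sine, as a
  bare cosine would not separate opposite values.\<close>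

lemma trig_polynomial_separates:
  assumes "v \<noteq> w" shows "\<exists>p. trig_polynomial p \<and> p v \<noteq> p w"
proof -
  obtain i where i: "v i \<noteq> w i" using assms by auto
  define s where "s = pi / 2 / (\<bar>v i\<bar> + \<bar>w i\<bar>)"
  have pos: "\<bar>v i\<bar> + \<bar>w i\<bar> > 0" using i by linarith
  have s: "s > 0" using pos by (simp add: s_def)
  have b: "- (pi/2) \<le> s * x \<and> s * x \<le> pi / 2" if "\<bar>x\<bar> \<le> \<bar>v i\<bar> + \<bar>w i\<bar>" for x
  proof -
    have "\<bar>s * x\<bar> \<le> s * (\<bar>v i\<bar> + \<bar>w i\<bar>)" using that s by (simp add: abs_mult)
    also have "\<dots> = pi / 2" using pos unfolding s_def by (metis less_irrefl nonzero_eq_divide_eq)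
    finally show ?thesis by linarith
  qed
  have "sin (s * v i) \<noteq> sin (s * w i)"
    using sin_inj_pi[of "s * v i" "s * w i"] b[of "v i"] b[of "w i"] i s by auto
  moreover have "cos (- pi / 2 + s * x i) = sin (s * x i)" for x :: "'a \<Rightarrow> real"
    by (simp add: cos_diff)
  moreover have "trig_polynomial (\<lambda>x. cos (- pi / 2 + s * x i))"
    using trig_polynomial.wave[of "{i}" 1 "- pi/2" "\<lambda>_. s"] by simp
  ultimately show ?thesis
    by (intro exI[of _ "\<lambda>x. cos (- pi / 2 + s * x i)"]) simp
qed

text \<open>The global bound is obtained by composing with a polynomial close to a truncation on the range
  of an unrestricted approximant.\<close>

lemma trig_polynomial_approximation:
  fixes g :: "('i::countable \<Rightarrow> real) \<Rightarrow> real"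
  assumes K: "compact K" and g: "continuous_on K g" and B: "\<And>v. v \<in> K \<Longrightarrow> \<bar>g v\<bar> \<le> B" "0 \<le> B"
    and "0 < \<epsilon>"
  obtains p where "trig_polynomial p" "\<And>v. v \<in> K \<Longrightarrow> \<bar>g v - p v\<bar> < \<epsilon>" "\<And>v. \<bar>p v\<bar> \<le> B + \<epsilon>"
proof -
  have "\<exists>p. trig_polynomial p \<and> (\<forall>v\<in>K. \<bar>g v - p v\<bar> < \<epsilon>/2)"
  proof (rule Stone_Weierstrass_HOL[where P = trig_polynomial, OF K])
    show "\<exists>f. trig_polynomial f \<and> f x \<noteq> f y" if "x \<in> K \<and> y \<in> K \<and> x \<noteq> y" for x y
      using trig_polynomial_separates that by blast
    show "0 < \<epsilon> / 2" using \<open>0 < \<epsilon>\<close> by simp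
  qed (blast intro: g trig_polynomial_continuous trig_polynomial_const trig_polynomial_mult
       trig_polynomial.add)+
  then obtain p where p: "trig_polynomial p" "\<And>v. v \<in> K \<Longrightarrow> \<bar>g v - p v\<bar> < \<epsilon>/2" by blast
  obtain R where R: "\<And>v. \<bar>p v\<bar> \<le> R" using trig_polynomial_bounded[OF p(1)] by blast
  \<comment> \<open>Truncation is a contraction and fixes the values of \<open>g\<close> on
    \<open>K\<close>, so \<open>clamp (p v)\<close> stays within \<epsilon>/2 of \<open>g v\<close>
    there and is bounded by \<open>B\<close> everywhere. The polynomial \<open>q\<close> replaces it
    at the cost of another \<epsilon>/2.\<close>
  define clamp where "clamp x = max (-B) (min B x)" for x :: real
  have "continuous_on {-R..R} clamp" unfolding clamp_def by (intro continuous_intros)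
  then obtain q where q: "real_polynomial_function q" "\<And>x. x \<in> {-R..R} \<Longrightarrow> \<bar>clamp x - q x\<bar> < \<epsilon>/2"
    using Stone_Weierstrass_real_polynomial_function[of "{-R..R}" clamp "\<epsilon>/2"] \<open>0 < \<epsilon>\<close> by auto
  have q': "\<bar>clamp (p v) - q (p v)\<bar> < \<epsilon>/2" for v
    using q(2)[of "p v"] R[of v] by (auto simp: abs_le_iff)
  show thesis
  proof
    show "trig_polynomial (\<lambda>v. q (p v))" by (rule trig_polynomial_compose[OF q(1) p(1)])
    show "\<bar>g v - q (p v)\<bar> < \<epsilon>" if "v \<in> K" for v
      using q'[of v] p(2)[OF that] B(1)[OF that] unfolding clamp_def max_def min_def
      by (smt (verit) field_sum_of_halves)
    show "\<bar>q (p v)\<bar> \<le> B + \<epsilon>" for v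
      using q'[of v] B(2) \<open>0 < \<epsilon>\<close> unfolding clamp_def max_def min_def by (smt (verit) field_sum_of_halves)
  qed
qed

section \<open>Paths on the dyadic rationals\<close>

text \<open>The coordinate \<open>(n, k)\<close> is the value at \<open>k/2\<^sup>n\<close> for \<open>k \<le> 2\<^sup>n\<close>, and \<open>0\<close> otherwise. The ratio \<open>3/4\<close> may be
  any number strictly between \<open>1/\<surd>2\<close> (for tightness) and \<open>1\<close> (for convergence along the levels).\<close>

definition lattice_paths :: "real \<Rightarrow> (nat \<times> nat \<Rightarrow> real) set" where
  "lattice_paths c =
     {v. (\<forall>n k. v (n, k) = v (Suc n, 2 * k)) \<and> v (0, 0) = 0 \<and> (\<forall>n k. 2 ^ n < k \<longrightarrow> v (n, k) = 0) \<and>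
         (\<forall>n. \<forall>k<2 ^ n. \<bar>v (n, Suc k) - v (n, k)\<bar> \<le> c * (3/4) ^ n)}"

definition lattice_index :: "nat \<Rightarrow> real \<Rightarrow> nat" where
  "lattice_index n u = nat \<lfloor>2 ^ n * u\<rfloor>"

text \<open>The value at \<open>u\<close> is read off along the left dyadic neighbours of
  \<open>u\<close>, so it depends on countably many coordinates only. No continuity is presupposed;
  the increment bounds of \<open>lattice_paths\<close> make the sequence Cauchy.\<close>

definition lattice_limit :: "(nat \<times> nat \<Rightarrow> real) \<Rightarrow> real \<Rightarrow> real" where
  "lattice_limit v u = lim (\<lambda>n. v (n, lattice_index n u))"

section \<open>Chaining along the dyadic neighbours of a point\<close>

lemma lattice_index_bounds:
  assumes "u \<in> {0..1}"
  shows "real (lattice_index n u) \<le> 2 ^ n * u" "2 ^ n * u < real (lattice_index n u) + 1"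
    "lattice_index n u \<le> 2 ^ n"
proof -
  have "0 \<le> 2 ^ n * u" "2 ^ n * u \<le> 2 ^ n" using assms by (auto simp: mult_left_le)
  then show *: "real (lattice_index n u) \<le> 2 ^ n * u" "2 ^ n * u < real (lattice_index n u) + 1"
    by (auto simp: lattice_index_def)
  have "real (lattice_index n u) \<le> 2 ^ n" using * \<open>2 ^ n * u \<le> 2 ^ n\<close> by linarith
  then have "real (lattice_index n u) \<le> real (2 ^ n)" by simp
  then show "lattice_index n u \<le> 2 ^ n" by (simp only: of_nat_le_iff)
qed

text \<open>Refining the grid once either keeps the left neighbour or moves it by one cell of the
  finer grid. A chain towards \<open>u\<close> thus uses at most one increment per level.\<close>

lemma lattice_index_Suc:
  assumes "u \<in> {0..1}"
  shows "lattice_index (Suc n) u = 2 * lattice_index n u \<or>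
    lattice_index (Suc n) u = Suc (2 * lattice_index n u)"
proof -
  note b = lattice_index_bounds[OF assms]
  have "real (lattice_index (Suc n) u) < real (2 * lattice_index n u + 2)"
    using b(1)[of "Suc n"] b(2)[of n] by simp
  moreover have "real (2 * lattice_index n u) < real (lattice_index (Suc n) u + 1)"
    using b(2)[of "Suc n"] b(1)[of n] by simp
  ultimately show ?thesis unfolding of_nat_less_iff by linarith
qed

lemma lattice_index_exact: "k \<le> 2 ^ n \<Longrightarrow> lattice_index n (real k / 2 ^ n) = k"
  by (simp add: lattice_index_def)

lemma lattice_pathsD:
  assumes "v \<in> lattice_paths c"
  shows "v (Suc n, 2 * k) = v (n, k)" "v (0, 0) = 0" "2 ^ n < k \<Longrightarrow> v (n, k) = 0"
    "k < 2 ^ n \<Longrightarrow> \<bar>v (n, Suc k) - v (n, k)\<bar> \<le> c * (3/4) ^ n" "0 \<le> c"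
proof -
  show "v (Suc n, 2 * k) = v (n, k)" "v (0, 0) = 0" "2 ^ n < k \<Longrightarrow> v (n, k) = 0"
    "k < 2 ^ n \<Longrightarrow> \<bar>v (n, Suc k) - v (n, k)\<bar> \<le> c * (3/4) ^ n"
    using assms unfolding lattice_paths_def by (auto simp del: mult_Suc_right)
  have "\<bar>v (0, Suc 0) - v (0, 0)\<bar> \<le> c * (3/4) ^ 0"
    using assms unfolding lattice_paths_def mem_Collect_eq by (metis power_0 zero_less_one)
  then show "0 \<le> c" by simp
qed

lemma lattice_paths_mono: "c \<le> d \<Longrightarrow> lattice_paths c \<subseteq> lattice_paths d"
proof
  fix v assume "c \<le> d" and v: "v \<in> lattice_paths c"
  then have "c * (3/4) ^ n \<le> d * (3/4) ^ n" for n by (intro mult_right_mono) auto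
  with v show "v \<in> lattice_paths d"
    unfolding lattice_paths_def mem_Collect_eq by (meson order_trans)
qed

text \<open>The increments at levels n+1, ..., n+m sum to at most c (3/4)^(n+1) (1 + 3/4 + ...),
  whence the factor 3 = (3/4) / (1 - 3/4). The exact finite geometric sum is kept so that the
  induction closes.\<close>

lemma lattice_path_refine:
  assumes v: "v \<in> lattice_paths c" and u: "u \<in> {0..1}"
  shows "\<bar>v (n + m, lattice_index (n + m) u) - v (n, lattice_index n u)\<bar>
    \<le> 3 * c * (3/4) ^ n * (1 - (3/4) ^ m)"
proof (induction m)
  case (Suc m)
  let ?N = "n + m"
  note D = lattice_pathsD[OF v]
  have "\<bar>v (Suc ?N, lattice_index (Suc ?N) u) - v (?N, lattice_index ?N u)\<bar> \<le> c * (3/4) ^ Suc ?N"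
    using lattice_index_Suc[OF u, of ?N]
  proof
    assume "lattice_index (Suc ?N) u = 2 * lattice_index ?N u"
    then show ?thesis using D(1)[of ?N] D(5) by simp
  next
    assume *: "lattice_index (Suc ?N) u = Suc (2 * lattice_index ?N u)"
    then have "2 * lattice_index ?N u < 2 ^ Suc ?N"
      using lattice_index_bounds(3)[OF u, of "Suc ?N"] by linarith
    then show ?thesis using D(4)[of "2 * lattice_index ?N u" "Suc ?N"] * D(1)[of ?N] by simp
  qed
  with Suc have "\<bar>v (Suc ?N, lattice_index (Suc ?N) u) - v (n, lattice_index n u)\<bar>
      \<le> 3 * c * (3/4) ^ n * (1 - (3/4) ^ m) + c * (3/4) ^ Suc ?N" by linarith
  also have "\<dots> = 3 * c * (3/4) ^ n * (1 - (3/4) ^ Suc m)"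
    by (simp add: power_add algebra_simps)
  finally show ?case by simp
qed simp

lemma lattice_path_refine':
  assumes v: "v \<in> lattice_paths c" and u: "u \<in> {0..1}" and "n \<le> N"
  shows "\<bar>v (N, lattice_index N u) - v (n, lattice_index n u)\<bar> \<le> 3 * c * (3/4) ^ n"
proof -
  have "3 * c * (3/4) ^ n * (1 - (3/4) ^ (N - n)) \<le> 3 * c * (3/4::real) ^ n * 1"
    using lattice_pathsD(5)[OF v] by (intro mult_left_mono) auto
  with lattice_path_refine[OF v u, of n "N - n"] \<open>n \<le> N\<close> show ?thesis by simp
qed

lemma lattice_limit_tendsto:
  assumes v: "v \<in> lattice_paths c" and u: "u \<in> {0..1}"
  shows "(\<lambda>n. v (n, lattice_index n u)) \<longlonglongrightarrow> lattice_limit v u"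
proof -
  have "Cauchy (\<lambda>n. v (n, lattice_index n u))"
  proof (rule metric_CauchyI)
    fix e :: real assume "0 < e"
    have "(\<lambda>n. 6 * c * (3/4) ^ n) \<longlonglongrightarrow> 6 * c * 0"
      by (intro tendsto_mult_left LIMSEQ_power_zero) auto
    then have "eventually (\<lambda>n. 6 * c * (3/4) ^ n < e) sequentially"
      using \<open>0 < e\<close> by (auto dest: order_tendstoD)
    then obtain n where n: "6 * c * (3/4) ^ n < e" by (auto simp: eventually_sequentially)
    have "dist (v (k, lattice_index k u)) (v (l, lattice_index l u)) < e" if "k \<ge> n" "l \<ge> n" for k l
      using lattice_path_refine'[OF v u that(1)] lattice_path_refine'[OF v u that(2)] n
      unfolding dist_real_def by linarith
    then show "\<exists>M. \<forall>m\<ge>M. \<forall>n\<ge>M. dist (v (m, lattice_index m u)) (v (n, lattice_index n u)) < e"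
      by blast
  qed
  then show ?thesis unfolding lattice_limit_def
    using Cauchy_convergent convergent_LIMSEQ_iff by blast
qed

lemma lattice_limit_approx:
  assumes v: "v \<in> lattice_paths c" and u: "u \<in> {0..1}"
  shows "\<bar>lattice_limit v u - v (n, lattice_index n u)\<bar> \<le> 3 * c * (3/4) ^ n"
proof -
  have "(\<lambda>N. \<bar>v (N, lattice_index N u) - v (n, lattice_index n u)\<bar>)
      \<longlonglongrightarrow> \<bar>lattice_limit v u - v (n, lattice_index n u)\<bar>"
    by (intro tendsto_intros lattice_limit_tendsto[OF v u])
  then show ?thesis
    by (rule LIMSEQ_le_const2) (use lattice_path_refine'[OF v u] in blast)
qed

text \<open>The constant is c for level 0, where the path starts at 0 and has one increment, plus 3c
  for the chain from there to \<open>(n, k)\<close>.\<close>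

lemma lattice_path_bounded:
  assumes v: "v \<in> lattice_paths c"
  shows "\<bar>v (n, k)\<bar> \<le> 4 * c"
proof (cases "k \<le> 2 ^ n")
  case True
  let ?u = "real k / 2 ^ n"
  have "real k \<le> 2 ^ n" using True by (metis of_nat_le_iff of_nat_numeral of_nat_power)
  then have u: "?u \<in> {0..1}" by simp
  have "\<bar>v (0, 1)\<bar> \<le> c"
    using lattice_pathsD(4)[OF v, of 0 0] lattice_pathsD(2)[OF v] by simp
  moreover have "lattice_index 0 ?u \<le> 1" using lattice_index_bounds(3)[OF u, of 0] by simp
  ultimately have "\<bar>v (0, lattice_index 0 ?u)\<bar> \<le> c"
    using lattice_pathsD(2,5)[OF v] le_eq_less_or_eq by (cases "lattice_index 0 ?u") auto
  then show ?thesis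
    using lattice_path_refine'[OF v u, of 0 n] lattice_index_exact[OF True] by simp
next
  case False
  then show ?thesis using lattice_pathsD(3,5)[OF v] by simp
qed

lemma lattice_limit_bounded:
  assumes v: "v \<in> lattice_paths c" and u: "u \<in> {0..1}"
  shows "\<bar>lattice_limit v u\<bar> \<le> 7 * c"
  using lattice_limit_approx[OF assms, of 0] lattice_path_bounded[OF v, of 0 "lattice_index 0 u"] by simp

text \<open>Both chains have tails of at most 3c (3/4)^n, so the values on one finite level
  determine the functions up to 6c (3/4)^n, uniformly in \<open>u\<close>.\<close>

lemma lattice_limit_near:
  assumes v: "v \<in> lattice_paths c" "v' \<in> lattice_paths c" and u: "u \<in> {0..1}"
    and near: "\<And>k. k \<le> 2 ^ n \<Longrightarrow> \<bar>v (n, k) - v' (n, k)\<bar> \<le> \<delta>"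
  shows "\<bar>lattice_limit v u - lattice_limit v' u\<bar> \<le> 6 * c * (3/4) ^ n + \<delta>"
  using lattice_limit_approx[OF v(1) u, of n] lattice_limit_approx[OF v(2) u, of n]
    near[OF lattice_index_bounds(3)[OF u]] by linarith

lemma lattice_index_tendsto:
  assumes u: "u \<in> {0..1}"
  shows "(\<lambda>n. real (lattice_index n u) / 2 ^ n) \<longlonglongrightarrow> u"
    and "real (lattice_index n u) / 2 ^ n \<in> {0..1}"
proof -
  let ?x = "\<lambda>n. real (lattice_index n u) / 2 ^ n"
  note b = lattice_index_bounds[OF u]
  have up: "?x n \<le> u" for n using b(1)[of n] by (simp add: divide_le_eq mult.commute)
  have lo: "u - (1/2) ^ n \<le> ?x n" for n
  proof -
    have "(u - (1/2) ^ n) * 2 ^ n = 2 ^ n * u - 1"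
      by (simp add: power_one_over left_diff_distrib)
    then show ?thesis using b(2)[of n] by (simp add: le_divide_eq)
  qed
  have "(\<lambda>n. u - (1/2::real) ^ n) \<longlonglongrightarrow> u - 0"
    by (intro tendsto_intros LIMSEQ_power_zero) auto
  then have "(\<lambda>n. u - (1/2::real) ^ n) \<longlonglongrightarrow> u" by simp
  then show "?x \<longlonglongrightarrow> u"
    by (rule tendsto_sandwich[rotated 2]) (use up lo in auto)
  have "?x n \<le> 1" using up[of n] u by (meson atLeastAtMost_iff order_trans)
  then show "?x n \<in> {0..1}" by simp
qed

text \<open>The dyadic samples of a continuous function converge to it at every point. No increment
  bound on \<open>v\<close> is involved, so this applies to every realization, whether or not it
  lies in a set \<open>lattice_paths c\<close>.\<close>

lemma lattice_limit_continuous_function: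
  assumes z: "continuous_on {0..1} z" and v: "\<And>n k. k \<le> 2 ^ n \<Longrightarrow> v (n, k) = z (real k / 2 ^ n)"
    and u: "u \<in> {0..1}"
  shows "lattice_limit v u = z u"
proof -
  have "(\<lambda>n. z (real (lattice_index n u) / 2 ^ n)) \<longlonglongrightarrow> z u"
    by (rule continuous_on_tendsto_compose[OF z lattice_index_tendsto(1)[OF u] u])
       (use lattice_index_tendsto(2)[OF u] in simp)
  then have "(\<lambda>n. v (n, lattice_index n u)) \<longlonglongrightarrow> z u"
    using v[OF lattice_index_bounds(3)[OF u]] by simp
  then show ?thesis unfolding lattice_limit_def by (rule limI)
qed

lemma closed_lattice_paths: "closed (lattice_paths c)"
proof -
  have c: "continuous_on UNIV (\<lambda>v::nat \<times> nat \<Rightarrow> real. v i)" for i by simp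
  have "lattice_paths c = (\<Inter>n. \<Inter>k. {v. v (n, k) = v (Suc n, 2 * k)}) \<inter> {v. v (0, 0) = 0} \<inter>
    (\<Inter>n. \<Inter>k\<in>{k. 2 ^ n < k}. {v. v (n, k) = 0}) \<inter>
    (\<Inter>n. \<Inter>k\<in>{..<2 ^ n}. {v. \<bar>v (n, Suc k) - v (n, k)\<bar> \<le> c * (3/4) ^ n})"
    unfolding lattice_paths_def by auto
  also have "closed \<dots>"
    by (intro closed_Int closed_INT ballI closed_Collect_eq closed_Collect_le continuous_intros c)
  finally show ?thesis .
qed

text \<open>Tychonoff: the bound 4c puts the set into a product of compact intervals, and each
  defining condition is a closed condition on finitely many coordinates.\<close>

lemma compact_lattice_paths: "compact (lattice_paths c)"
proof -
  have "compactin (product_topology (\<lambda>_. euclidean) UNIV) (PiE UNIV (\<lambda>_::nat \<times> nat. {-4 * c..4 * c}))"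
    unfolding compactin_PiE by simp
  then have "compact (PiE UNIV (\<lambda>_::nat \<times> nat. {-4 * c..4 * c}))"
    unfolding euclidean_product_topology by simp
  then have "compact (lattice_paths c \<inter> PiE UNIV (\<lambda>_. {-4 * c..4 * c}))"
    by (rule closed_Int_compact[OF closed_lattice_paths])
  moreover have "lattice_paths c \<subseteq> PiE UNIV (\<lambda>_. {-4 * c..4 * c})"
  proof
    fix v assume v: "v \<in> lattice_paths c"
    show "v \<in> PiE UNIV (\<lambda>_. {-4 * c..4 * c})"
    proof (rule PiE_I)
      fix i :: "nat \<times> nat"
      show "v i \<in> {-4 * c..4 * c}"
        using lattice_path_bounded[OF v, of "fst i" "snd i"] by (auto simp: abs_le_iff)
    qed simp
  qed
  ultimately show ?thesis by (simp add: Int_absorb2)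
qed

lemma lattice_paths_borel [measurable]: "lattice_paths c \<in> sets borel"
  by (rule borel_closed[OF closed_lattice_paths])

section \<open>Dyadic paths as elements of the space of bounded functions\<close>

lemma mspace_bounded_functions:
  "x \<in> mspace (funspace S euclidean_metric) \<longleftrightarrow> x \<in> extensional S \<and> bounded (x ` S)" for x :: "'a \<Rightarrow> real"
  by (auto simp: Met_TC.fspace_def)

lemma mdist_bounded_functions_le:
  fixes x y :: "'a \<Rightarrow> real"
  assumes "x \<in> mspace (funspace S euclidean_metric)" "y \<in> mspace (funspace S euclidean_metric)"
    "S \<noteq> {}" "\<And>s. s \<in> S \<Longrightarrow> \<bar>x s - y s\<bar> \<le> e"
  shows "mdist (funspace S euclidean_metric) x y \<le> e"
  using assms funspace_mdist_le[of x S euclidean_metric y e] by (simp add: dist_real_def)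

lemma lattice_limit_in_mspace:
  assumes "v \<in> lattice_paths c" "\<And>s. s \<in> S \<Longrightarrow> \<rho> s \<in> {0..1}"
  shows "(\<lambda>s\<in>S. lattice_limit v (\<rho> s)) \<in> mspace (funspace S euclidean_metric)"
proof -
  have "bounded ((\<lambda>s\<in>S. lattice_limit v (\<rho> s)) ` S)"
    using lattice_limit_bounded[OF assms(1) assms(2)] by (intro boundedI[of _ "7 * c"]) auto
  then show ?thesis unfolding mspace_bounded_functions by simp
qed

text \<open>A neighbourhood that restricts only the coordinates of one level suffices: the tails
  contribute less than \<epsilon>/4 and the coordinates at most \<epsilon>/4. The fixed
  \<open>c\<close> is essential, since narrowing peaks of height 1 around a point that is not dyadic
  tend to 0 in every coordinate but not uniformly.\<close>

lemma lattice_limit_continuous_map: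
  assumes \<rho>: "\<And>s. s \<in> S \<Longrightarrow> \<rho> s \<in> {0..1}" and "S \<noteq> {}"
  shows "continuous_map (top_of_set (lattice_paths c)) (mtopology_of (funspace S euclidean_metric))
    (\<lambda>v. \<lambda>s\<in>S. lattice_limit v (\<rho> s))" (is "continuous_map ?X (mtopology_of ?D) ?E")
proof -
  interpret D: Metric_space "mspace ?D" "mdist ?D" by (rule Metric_space_mspace_mdist)
  show ?thesis
    unfolding mtopology_of_def D.continuous_map_to_metric
  proof (intro ballI allI impI)
    fix v and \<epsilon> :: real assume "v \<in> topspace ?X" and "0 < \<epsilon>"
    then have v: "v \<in> lattice_paths c" by simp
    have "(\<lambda>n. 6 * c * (3/4) ^ n) \<longlonglongrightarrow> 6 * c * 0"
      by (intro tendsto_mult_left LIMSEQ_power_zero) auto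
    then have "eventually (\<lambda>n. 6 * c * (3/4) ^ n < \<epsilon>/4) sequentially"
      using \<open>0 < \<epsilon>\<close> by (intro order_tendstoD(2)[where y = "6 * c * 0"]) auto
    then obtain n where n: "6 * c * (3/4) ^ n < \<epsilon>/4" by (auto simp: eventually_sequentially)
    define U where "U = {v'. \<forall>k\<in>{..2 ^ n::nat}. v' (n, k) \<in> ball (v (n, k)) (\<epsilon>/4)}"
    have "open U"
      unfolding U_def by (rule product_topology_basis') auto
    show "\<exists>U. openin ?X U \<and> v \<in> U \<and> (\<forall>y\<in>U. ?E y \<in> D.mball (?E v) \<epsilon>)"
    proof (intro exI conjI ballI)
      show "openin ?X (lattice_paths c \<inter> U)" using \<open>open U\<close> by (rule openin_open_Int)
      show "v \<in> lattice_paths c \<inter> U" using v \<open>0 < \<epsilon>\<close> by (simp add: U_def)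
      fix v' assume v': "v' \<in> lattice_paths c \<inter> U"
      have "\<bar>?E v s - ?E v' s\<bar> \<le> \<epsilon>/2" if "s \<in> S" for s
      proof -
        have "\<bar>lattice_limit v (\<rho> s) - lattice_limit v' (\<rho> s)\<bar> \<le> 6 * c * (3/4) ^ n + \<epsilon>/4"
          using v' by (intro lattice_limit_near[OF v _ \<rho>[OF that]]) (auto simp: U_def dist_real_def less_imp_le)
        then show ?thesis using n that by simp
      qed
      then have "mdist ?D (?E v) (?E v') \<le> \<epsilon>/2"
        using lattice_limit_in_mspace[OF v \<rho>, of S] lattice_limit_in_mspace[OF _ \<rho>, of v' c S] v' \<open>S \<noteq> {}\<close>
        by (intro mdist_bounded_functions_le) auto
      then show "?E v' \<in> D.mball (?E v) \<epsilon>"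
        using lattice_limit_in_mspace[OF v \<rho>, of S] lattice_limit_in_mspace[OF _ \<rho>, of v' c S] v' \<open>0 < \<epsilon>\<close>
        unfolding D.in_mball by auto
    qed
  qed
qed

text \<open>Level n has 2^n increments with second moment at most C/4^n. Chebyshev's inequality with
  threshold c (3/4)^n bounds the probability that one of them is too large by (C/c^2) (2/4 * 16/9)^n
  = (C/c^2) (8/9)^n, and summing over the levels yields the factor 9. The structural relations are
  required almost surely, which is the form in which they are available for the Gaussian
  law.\<close>

lemma (in prob_space) lattice_paths_tight:
  assumes meas [measurable]: "\<And>i. (\<lambda>\<omega>. V \<omega> i) \<in> borel_measurable M"
    and refine: "AE \<omega> in M. \<forall>n k. V \<omega> (n, k) = V \<omega> (Suc n, 2 * k)"
    and zero: "AE \<omega> in M. V \<omega> (0, 0) = 0"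
    and outside: "AE \<omega> in M. \<forall>n k. 2 ^ n < k \<longrightarrow> V \<omega> (n, k) = 0"
    and int: "\<And>n k. k < 2 ^ n \<Longrightarrow> integrable M (\<lambda>\<omega>. (V \<omega> (n, Suc k) - V \<omega> (n, k))\<^sup>2)"
    and incr: "\<And>n k. k < 2 ^ n \<Longrightarrow> (\<integral>\<omega>. (V \<omega> (n, Suc k) - V \<omega> (n, k))\<^sup>2 \<partial>M) \<le> C * (1/4) ^ n"
    and "0 \<le> C" "0 < c"
  shows "prob {\<omega> \<in> space M. V \<omega> \<notin> lattice_paths c} \<le> 9 * C / c\<^sup>2"
proof -
  define A where "A n k = {\<omega> \<in> space M. (V \<omega> (n, Suc k) - V \<omega> (n, k))\<^sup>2 \<ge> (c * (3/4) ^ n)\<^sup>2}" for n k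
  define B where "B n = (\<Union>k<2 ^ n. A n k)" for n
  have A [measurable]: "A n k \<in> sets M" for n k unfolding A_def by measurable
  have B [measurable]: "B n \<in> sets M" for n unfolding B_def by measurable
  have probA: "prob (A n k) \<le> C / c\<^sup>2 * (4/9) ^ n" if "k < 2 ^ n" for n k
  proof -
    have "prob (A n k) \<le> (\<integral>\<omega>. (V \<omega> (n, Suc k) - V \<omega> (n, k))\<^sup>2 \<partial>M) / (c * (3/4) ^ n)\<^sup>2"
      unfolding A_def using \<open>0 < c\<close> by (intro integral_Markov_inequality_measure[OF int[OF that], of "{}"]) auto
    also have "\<dots> \<le> C * (1/4) ^ n / (c * (3/4) ^ n)\<^sup>2"
      by (intro divide_right_mono incr that) simp
    also have "\<dots> = C / c\<^sup>2 * ((1/4) ^ n / ((3/4)\<^sup>2) ^ n)"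
      by (simp add: power_mult_distrib power_mult [symmetric] mult.commute)
    also have "(1/4) ^ n / ((3/4)\<^sup>2) ^ n = (4/9::real) ^ n"
      by (simp add: power_divide [symmetric] power2_eq_square)
    finally show ?thesis .
  qed
  have probB: "prob (B n) \<le> C / c\<^sup>2 * (8/9) ^ n" for n
  proof -
    have "prob (B n) \<le> (\<Sum>k<2 ^ n. prob (A n k))"
      unfolding B_def by (rule finite_measure_subadditive_finite) auto
    also have "\<dots> \<le> (\<Sum>k<(2::nat) ^ n. C / c\<^sup>2 * (4/9) ^ n)" by (intro sum_mono probA) auto
    also have "\<dots> = C / c\<^sup>2 * (2 ^ n * (4/9) ^ n)" by simp
    also have "2 ^ n * (4/9) ^ n = (8/9::real) ^ n" by (simp add: power_mult_distrib [symmetric])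
    finally show ?thesis .
  qed
  have geo: "summable (\<lambda>n. C / c\<^sup>2 * (8/9::real) ^ n)"
    by (intro summable_mult summable_geometric) simp
  have sumB: "summable (\<lambda>n. prob (B n))"
    by (rule summable_comparison_test'[OF geo, of 0]) (use probB in simp)
  have "prob {\<omega> \<in> space M. V \<omega> \<notin> lattice_paths c} \<le> prob (\<Union>n. B n)"
  proof (rule finite_measure_mono_AE)
    show "AE \<omega> in M. \<omega> \<in> {\<omega> \<in> space M. V \<omega> \<notin> lattice_paths c} \<longrightarrow> \<omega> \<in> (\<Union>n. B n)"
      using refine zero outside
    proof eventually_elim
      case (elim \<omega>)
      show ?case
      proof
        assume \<omega>: "\<omega> \<in> {\<omega> \<in> space M. V \<omega> \<notin> lattice_paths c}"
        then obtain n k where "k < 2 ^ n" "\<bar>V \<omega> (n, Suc k) - V \<omega> (n, k)\<bar> > c * (3/4) ^ n"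
          using elim unfolding lattice_paths_def mem_Collect_eq by (meson not_less)
        moreover from this(2) have "(c * (3/4) ^ n)\<^sup>2 \<le> (V \<omega> (n, Suc k) - V \<omega> (n, k))\<^sup>2"
          using \<open>0 < c\<close> by (simp add: abs_le_square_iff [symmetric] abs_mult)
        ultimately show "\<omega> \<in> (\<Union>n. B n)" using \<omega> unfolding B_def A_def by auto
      qed
    qed
  qed measurable
  also have "\<dots> \<le> (\<Sum>n. prob (B n))"
    by (rule finite_measure_subadditive_countably[OF _ sumB]) auto
  also have "\<dots> \<le> (\<Sum>n. C / c\<^sup>2 * (8/9) ^ n)" by (intro suminf_le probB sumB geo)
  also have "\<dots> = 9 * C / c\<^sup>2" by (subst suminf_mult) (auto simp: suminf_geometric)
  finally show ?thesis .
qed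

section \<open>Gaussian families with a given covariance\<close>

lemma char_normal: "char (distr std_normal_distribution borel (\<lambda>x. s * x)) t = exp (- (s * t)\<^sup>2 / 2)"
proof -
  have "char (distr std_normal_distribution borel (\<lambda>x. s * x)) t = char std_normal_distribution (s * t)"
    unfolding char_def by (subst integral_distr) (auto simp: mult_ac)
  then show ?thesis by (simp add: char_std_normal_distribution)
qed

text \<open>Levy's uniqueness theorem identifies the law of \<open>Z\<close> with that of
  \<open>s\<close> times a standard normal variable, and the moments are read off there. For
  \<open>s = 0\<close> there is no density; the vanishing second moment then puts \<open>Z\<close>
  into the constant case of \<open>gaussian_variable\<close>.\<close>

lemma gaussian_variable_char:
  fixes Z :: "'a \<Rightarrow> real"
  assumes "prob_space N" and Z [measurable]: "Z \<in> borel_measurable N" and "0 \<le> s"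
    and char: "\<And>t. char (distr N borel Z) t = exp (- (s * t)\<^sup>2 / 2)"
  shows "gaussian_variable N Z" "integrable N (\<lambda>x. (Z x)\<^sup>2)" "(\<integral>x. Z x \<partial>N) = 0"
    "(\<integral>x. (Z x)\<^sup>2 \<partial>N) = s\<^sup>2"
proof -
  interpret N: prob_space N by fact
  interpret S: real_distribution std_normal_distribution by (rule real_dist_normal_dist)
  have distr: "distr N borel Z = distr std_normal_distribution borel (\<lambda>x. s * x)"
    by (rule Levy_uniqueness)
       (auto simp: char char_normal intro!: N.real_distribution_distr S.real_distribution_distr)
  have m1: "integrable std_normal_distribution (\<lambda>x. x)" "(\<integral>x. x \<partial>std_normal_distribution) = 0"
    using integrable_std_normal_distribution_moment[of 1] integral_std_normal_distribution_moment_odd[of 1]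
    by auto
  have m2: "integrable std_normal_distribution (\<lambda>x. x\<^sup>2)" "(\<integral>x. x\<^sup>2 \<partial>std_normal_distribution) = 1"
    using integrable_std_normal_distribution_moment[of 2] std_normal_distribution_even_moments(1)[of 1]
    by (auto simp: fact_numeral)
  have "integrable (distr N borel Z) (\<lambda>x. x\<^sup>2)"
    unfolding distr by (subst integrable_distr_eq) (auto simp: power_mult_distrib m2)
  then show int: "integrable N (\<lambda>x. (Z x)\<^sup>2)" by (subst (asm) integrable_distr_eq) auto
  have "(\<integral>x. Z x \<partial>N) = (\<integral>x. x \<partial>distr N borel Z)" by (subst integral_distr) auto
  then show "(\<integral>x. Z x \<partial>N) = 0" unfolding distr by (subst (asm) integral_distr) (auto simp: m1)
  have "(\<integral>x. (Z x)\<^sup>2 \<partial>N) = (\<integral>x. x\<^sup>2 \<partial>distr N borel Z)" by (subst integral_distr) auto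
  then show sq: "(\<integral>x. (Z x)\<^sup>2 \<partial>N) = s\<^sup>2"
    unfolding distr by (subst (asm) integral_distr) (auto simp: power_mult_distrib m2)
  show "gaussian_variable N Z"
  proof (cases "s = 0")
    case True
    then have "AE x in N. (Z x)\<^sup>2 = 0" using integral_nonneg_eq_0_iff_AE[OF int] sq by simp
    then show ?thesis unfolding gaussian_variable_def by auto
  next
    case False
    have "distributed std_normal_distribution lborel (\<lambda>x. x) std_normal_density"
      unfolding distributed_def by (auto simp: distr_id2)
    then have "distributed std_normal_distribution lborel (\<lambda>x. 0 + s * x) (normal_density (0 + s * 0) (\<bar>s\<bar> * 1))"
      using False by (intro S.normal_density_affine) auto
    then have "distr std_normal_distribution lborel (\<lambda>x. s * x) = density lborel (normal_density 0 s)"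
      using \<open>0 \<le> s\<close> unfolding distributed_def by simp
    moreover have "distr N lborel Z = distr std_normal_distribution lborel (\<lambda>x. s * x)"
      using distr by (metis (no_types, lifting) distr_cong sets_lborel)
    ultimately have "distributed N lborel Z (normal_density 0 s)"
      unfolding distributed_def by simp
    then show ?thesis unfolding gaussian_variable_def using False \<open>0 \<le> s\<close> by fastforce
  qed
qed

section \<open>Products and sums of square integrable functions\<close>

lemma integrable_mult_square:
  fixes f g :: "'a \<Rightarrow> real"
  assumes [measurable]: "f \<in> borel_measurable M" "g \<in> borel_measurable M"
    and f: "integrable M (\<lambda>x. (f x)\<^sup>2)" and g: "integrable M (\<lambda>x. (g x)\<^sup>2)"
  shows "integrable M (\<lambda>x. f x * g x)"
proof (rule Bochner_Integration.integrable_bound[OF Bochner_Integration.integrable_add[OF f g]])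
  have "\<bar>a * b\<bar> \<le> a\<^sup>2 + b\<^sup>2" for a b :: real
    using sum_squares_bound[of "\<bar>a\<bar>" "\<bar>b\<bar>"] abs_ge_zero[of "a * b"]
    unfolding abs_mult power2_abs by linarith
  then show "AE x in M. norm (f x * g x) \<le> norm ((f x)\<^sup>2 + (g x)\<^sup>2)" by simp
qed measurable

definition square_integrable :: "'a measure \<Rightarrow> ('a \<Rightarrow> real) set" where
  "square_integrable M = {f \<in> borel_measurable M. integrable M (\<lambda>x. (f x)\<^sup>2)}"

lemma square_integrable_measurable [measurable_dest]:
  "f \<in> square_integrable M \<Longrightarrow> f \<in> borel_measurable M"
  by (simp add: square_integrable_def)

lemma square_integrable_mult:
  "f \<in> square_integrable M \<Longrightarrow> g \<in> square_integrable M \<Longrightarrow> integrable M (\<lambda>x. f x * g x)"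
  unfolding square_integrable_def by (auto intro: integrable_mult_square)

lemma square_integrable_add:
  assumes "f \<in> square_integrable M" "g \<in> square_integrable M"
  shows "(\<lambda>x. f x + g x) \<in> square_integrable M"
proof -
  note [measurable] = square_integrable_measurable[OF assms(1)] square_integrable_measurable[OF assms(2)]
  have "integrable M (\<lambda>x. (f x)\<^sup>2 + (g x)\<^sup>2 + 2 * (f x * g x))"
    using assms square_integrable_mult[OF assms] unfolding square_integrable_def by auto
  then show ?thesis unfolding square_integrable_def by (simp add: power2_sum mult.assoc)
qed

lemma square_integrable_cmult:
  "f \<in> square_integrable M \<Longrightarrow> (\<lambda>x. c * f x) \<in> square_integrable M"
  unfolding square_integrable_def by (auto simp: power_mult_distrib)

lemma square_integrable_sum:
  "(\<And>i. i \<in> I \<Longrightarrow> f i \<in> square_integrable M) \<Longrightarrow> (\<lambda>x. \<Sum>i\<in>I. f i x) \<in> square_integrable M"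
proof (induction I rule: infinite_finite_induct)
  case (insert i I)
  then show ?case by (simp add: square_integrable_add)
qed (simp_all add: square_integrable_def)

lemma square_integrable_diff:
  assumes "f \<in> square_integrable M" "g \<in> square_integrable M"
  shows "(\<lambda>x. f x - g x) \<in> square_integrable M"
  using square_integrable_add[OF assms(1) square_integrable_cmult[OF assms(2), of "-1"]] by simp

text \<open>If the residual vanishes almost everywhere, then the division by zero yields the zero function.\<close>

fun gram_schmidt :: "'w measure \<Rightarrow> (nat \<Rightarrow> 'w \<Rightarrow> real) \<Rightarrow> nat \<Rightarrow> 'w \<Rightarrow> real" where
  "gram_schmidt M X n =
    (let r = (\<lambda>w. X n w - (\<Sum>k<n. (\<integral>v. X n v * gram_schmidt M X k v \<partial>M) * gram_schmidt M X k w))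
     in (\<lambda>w. r w / sqrt (\<integral>v. (r v)\<^sup>2 \<partial>M)))"

declare gram_schmidt.simps [simp del]

section \<open>Orthonormalization of a possibly dependent sequence\<close>

context
  fixes M :: "'w measure" and X :: "nat \<Rightarrow> 'w \<Rightarrow> real"
  assumes X: "\<And>i. X i \<in> square_integrable M"
begin

private abbreviation (input) "e \<equiv> gram_schmidt M X"

private abbreviation (input) "inner_M f g \<equiv> \<integral>w. f w * g w \<partial>M"

definition gram_schmidt_residual :: "nat \<Rightarrow> 'w \<Rightarrow> real" where
  "gram_schmidt_residual n w = X n w - (\<Sum>k<n. inner_M (X n) (e k) * e k w)"

lemma gram_schmidt_eq: "e n w = gram_schmidt_residual n w / sqrt (\<integral>v. (gram_schmidt_residual n v)\<^sup>2 \<partial>M)"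
  by (subst gram_schmidt.simps) (simp add: gram_schmidt_residual_def Let_def)

lemma gram_schmidt_square_integrable: "e n \<in> square_integrable M" "gram_schmidt_residual n \<in> square_integrable M"
proof -
  have "e n \<in> square_integrable M \<and> gram_schmidt_residual n \<in> square_integrable M"
  proof (induction n rule: less_induct)
    case (less n)
    have "(\<lambda>w. \<Sum>k<n. inner_M (X n) (e k) * e k w) \<in> square_integrable M"
      using less by (intro square_integrable_sum square_integrable_cmult) auto
    then have r: "gram_schmidt_residual n \<in> square_integrable M"
      unfolding gram_schmidt_residual_def [abs_def] by (intro square_integrable_diff X)
    define c where "c = 1 / sqrt (\<integral>v. (gram_schmidt_residual n v)\<^sup>2 \<partial>M)"
    have "e n = (\<lambda>w. c * gram_schmidt_residual n w)"
      by (rule ext) (simp add: gram_schmidt_eq c_def)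
    then show ?case using r square_integrable_cmult[OF r, of c] by simp
  qed
  then show "e n \<in> square_integrable M" "gram_schmidt_residual n \<in> square_integrable M" by auto
qed

lemma inner_sum_left:
  assumes "\<And>i. i \<in> I \<Longrightarrow> f i \<in> square_integrable M" "g \<in> square_integrable M"
  shows "inner_M (\<lambda>w. \<Sum>i\<in>I. c i * f i w) g = (\<Sum>i\<in>I. c i * inner_M (f i) g)"
proof -
  have "inner_M (\<lambda>w. \<Sum>i\<in>I. c i * f i w) g = (\<integral>w. (\<Sum>i\<in>I. c i * (f i w * g w)) \<partial>M)"
    by (simp add: sum_distrib_right mult.assoc)
  also have "\<dots> = (\<Sum>i\<in>I. \<integral>w. c i * (f i w * g w) \<partial>M)"
    using assms by (intro Bochner_Integration.integral_sum integrable_mult_right square_integrable_mult)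
  finally show ?thesis by simp
qed

text \<open>The two cases replace an assumption of linear independence: at a degenerate index the
  function is zero at every point, not merely almost everywhere, so all coefficients taken against
  it vanish too.\<close>

lemma gram_schmidt_unit: "inner_M (e n) (e n) = 1 \<or> (\<forall>w. e n w = 0)"
proof (cases "(\<integral>v. (gram_schmidt_residual n v)\<^sup>2 \<partial>M) = 0")
  case False
  then have pos: "(\<integral>v. (gram_schmidt_residual n v)\<^sup>2 \<partial>M) > 0"
    by (metis integral_nonneg_AE AE_I2 zero_le_power2 less_eq_real_def)
  have "inner_M (e n) (e n) = (\<integral>v. (gram_schmidt_residual n v)\<^sup>2 / (\<integral>v. (gram_schmidt_residual n v)\<^sup>2 \<partial>M) \<partial>M)"
    using pos by (simp add: gram_schmidt_eq power2_eq_square)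
  then show ?thesis using pos by simp
qed (simp add: gram_schmidt_eq)

lemma gram_schmidt_orthogonal: "k < n \<Longrightarrow> inner_M (e n) (e k) = 0"
proof (induction n arbitrary: k rule: less_induct)
  case (less n)
  note S = gram_schmidt_square_integrable
  have orth: "inner_M (e j) (e k) = 0" if "j < n" "j \<noteq> k" for j
  proof (cases "k < j")
    case True then show ?thesis using less that by blast
  next
    case False
    then have "inner_M (e k) (e j) = 0" using less that by auto
    then show ?thesis by (simp add: mult.commute)
  qed
  have "inner_M (gram_schmidt_residual n) (e k) =
      inner_M (X n) (e k) - inner_M (\<lambda>w. \<Sum>j<n. inner_M (X n) (e j) * e j w) (e k)"
    unfolding gram_schmidt_residual_def left_diff_distrib
    by (intro Bochner_Integration.integral_diff square_integrable_mult X S square_integrable_sum square_integrable_cmult)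
  also have "inner_M (\<lambda>w. \<Sum>j<n. inner_M (X n) (e j) * e j w) (e k) =
      (\<Sum>j<n. inner_M (X n) (e j) * inner_M (e j) (e k))"
    by (intro inner_sum_left S)
  also have "\<dots> = (\<Sum>j<n. if j = k then inner_M (X n) (e k) * inner_M (e k) (e k) else 0)"
    by (intro sum.cong) (auto simp: orth)
  also have "\<dots> = inner_M (X n) (e k) * inner_M (e k) (e k)" using less by simp
  \<comment> \<open>If \<open>e k\<close> has norm 1 this is immediate; otherwise \<open>e k\<close>
    is the zero function and both sides vanish.\<close>
  also have "\<dots> = inner_M (X n) (e k)" using gram_schmidt_unit[of k] by auto
  finally have "inner_M (gram_schmidt_residual n) (e k) = 0" by simp
  moreover have "inner_M (e n) (e k) = inner_M (gram_schmidt_residual n) (e k) / sqrt (\<integral>v. (gram_schmidt_residual n v)\<^sup>2 \<partial>M)"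
    by (simp add: gram_schmidt_eq[of n])
  ultimately show ?case by simp
qed

lemma gram_schmidt_inner: "j \<noteq> k \<Longrightarrow> inner_M (e j) (e k) = 0"
proof (induction j k rule: linorder_wlog)
  case (le j k)
  then show ?case using gram_schmidt_orthogonal[of j k] by (simp add: mult.commute)
next
  case (sym j k)
  then show ?case by (simp add: mult.commute)
qed

text \<open>The residual is \<open>s\<close> times \<open>e n\<close>, and pairing
  \<open>X n\<close> with \<open>e n\<close> leaves exactly \<open>s\<close>, because the lower
  terms are orthogonal to \<open>e n\<close>. For \<open>s = 0\<close> the residual is known to
  vanish only almost everywhere, hence the quantifier.\<close>

lemma gram_schmidt_expansion: "AE w in M. X n w = (\<Sum>k\<le>n. inner_M (X n) (e k) * e k w)"
proof -
  note S = gram_schmidt_square_integrable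
  define s where "s = sqrt (\<integral>v. (gram_schmidt_residual n v)\<^sup>2 \<partial>M)"
  have int: "integrable M (\<lambda>v. (gram_schmidt_residual n v)\<^sup>2)"
    using S(2)[of n] unfolding square_integrable_def by simp
  have res: "AE w in M. gram_schmidt_residual n w = s * e n w"
  proof (cases "s = 0")
    case True
    then have "AE w in M. (gram_schmidt_residual n w)\<^sup>2 = 0"
      using integral_nonneg_eq_0_iff_AE[OF int] by (simp add: s_def)
    then show ?thesis using True by auto
  next
    case False
    then show ?thesis by (simp add: gram_schmidt_eq s_def)
  qed
  have X_eq: "X n w = gram_schmidt_residual n w + (\<Sum>k<n. inner_M (X n) (e k) * e k w)" for w
    unfolding gram_schmidt_residual_def by simp
  have "inner_M (X n) (e n) =
      inner_M (gram_schmidt_residual n) (e n) + inner_M (\<lambda>w. \<Sum>k<n. inner_M (X n) (e k) * e k w) (e n)"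
    by (subst X_eq, unfold distrib_right,
        intro Bochner_Integration.integral_add square_integrable_mult S square_integrable_sum square_integrable_cmult)
  also have "inner_M (\<lambda>w. \<Sum>k<n. inner_M (X n) (e k) * e k w) (e n) =
      (\<Sum>k<n. inner_M (X n) (e k) * inner_M (e k) (e n))"
    by (intro inner_sum_left S)
  also have "\<dots> = 0" by (intro sum.neutral) (auto simp: gram_schmidt_inner)
  also have "inner_M (gram_schmidt_residual n) (e n) = (\<integral>v. (gram_schmidt_residual n v)\<^sup>2 \<partial>M) / s"
    by (simp add: gram_schmidt_eq s_def power2_eq_square)
  also have "\<dots> = s" unfolding s_def by (simp add: real_div_sqrt)
  finally have Xe: "inner_M (X n) (e n) = s" by simp
  from res show ?thesis
  proof eventually_elim
    case (elim w)
    then show ?case by (simp add: X_eq[of w] Xe lessThan_Suc_atMost [symmetric])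
  qed
qed

text \<open>A Cholesky factorization of the Gram matrix of \<open>X\<close>, which may be singular:
  row \<open>i\<close> of \<open>a\<close> holds the coefficients of \<open>X i\<close> in the
  orthonormal system, and the identity is Parseval's. Triangularity keeps every row finite, so that
  the Gaussian variables built from it are finite sums.\<close>

lemma covariance_factorization:
  obtains a :: "nat \<Rightarrow> nat \<Rightarrow> real" where
    "\<And>F u N. finite F \<Longrightarrow> F \<subseteq> {..N} \<Longrightarrow>
      (\<integral>w. (\<Sum>i\<in>F. u i * X i w)\<^sup>2 \<partial>M) = (\<Sum>k\<le>N. (\<Sum>i\<in>F. u i * a i k)\<^sup>2)"
    "\<And>i k. i < k \<Longrightarrow> a i k = 0"
proof
  note S = gram_schmidt_square_integrable
  define a where "a i k = (if k \<le> i then inner_M (X i) (e k) else 0)" for i k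
  show "a i k = 0" if "i < k" for i k using that by (simp add: a_def)
  fix F :: "nat set" and u :: "nat \<Rightarrow> real" and N assume F: "finite F" "F \<subseteq> {..N}"
  define b where "b k = (\<Sum>i\<in>F. u i * a i k)" for k
  \<comment> \<open>Parseval's identity asks for unit vectors; where \<open>e k\<close> is the zero
    function, column \<open>k\<close> of \<open>a\<close> is zero as well and nothing is
    lost.\<close>
  have b0: "b k * inner_M (e k) (e k) = b k" for k
  proof (cases "inner_M (e k) (e k) = 1")
    case False
    then have "e k w = 0" for w using gram_schmidt_unit by blast
    then have "a i k = 0" for i by (simp add: a_def)
    then show ?thesis by (simp add: b_def)
  qed simp
  have "AE w in M. X i w = (\<Sum>k\<le>N. a i k * e k w)" if "i \<in> F" for i
    using gram_schmidt_expansion[of i]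
  proof eventually_elim
    case (elim w)
    moreover have "(\<Sum>k\<le>N. a i k * e k w) = (\<Sum>k\<le>i. inner_M (X i) (e k) * e k w)"
      using F that by (intro sum.mono_neutral_cong_right) (auto simp: a_def)
    ultimately show ?case by simp
  qed
  then have "AE w in M. \<forall>i\<in>F. X i w = (\<Sum>k\<le>N. a i k * e k w)"
    using F(1) by (simp add: AE_finite_all)
  then have "AE w in M. (\<Sum>i\<in>F. u i * X i w) = (\<Sum>k\<le>N. b k * e k w)"
  proof eventually_elim
    case (elim w)
    then have "(\<Sum>i\<in>F. u i * X i w) = (\<Sum>i\<in>F. \<Sum>k\<le>N. u i * a i k * e k w)"
      by (simp add: sum_distrib_left mult.assoc)
    also have "\<dots> = (\<Sum>k\<le>N. b k * e k w)"
      unfolding b_def sum_distrib_right by (rule sum.swap)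
    finally show ?case .
  qed
  moreover have [measurable]: "X i \<in> borel_measurable M" "e i \<in> borel_measurable M" for i
    using X S by (auto simp: square_integrable_def)
  ultimately have "(\<integral>w. (\<Sum>i\<in>F. u i * X i w)\<^sup>2 \<partial>M) =
      inner_M (\<lambda>w. \<Sum>k\<le>N. b k * e k w) (\<lambda>w. \<Sum>k\<le>N. b k * e k w)"
    by (intro integral_cong_AE) (auto simp: power2_eq_square)
  also have "\<dots> = (\<Sum>k\<le>N. b k * inner_M (e k) (\<lambda>w. \<Sum>k\<le>N. b k * e k w))"
    by (intro inner_sum_left S square_integrable_sum square_integrable_cmult)
  also have "\<dots> = (\<Sum>k\<le>N. b k * (\<Sum>j\<le>N. b j * inner_M (e j) (e k)))"
  proof (intro sum.cong refl arg_cong2[where f = "(*)"])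
    fix k
    have "inner_M (e k) (\<lambda>w. \<Sum>k\<le>N. b k * e k w) = inner_M (\<lambda>w. \<Sum>k\<le>N. b k * e k w) (e k)"
      by (simp add: mult.commute)
    also have "\<dots> = (\<Sum>j\<le>N. b j * inner_M (e j) (e k))" by (intro inner_sum_left S)
    finally show "inner_M (e k) (\<lambda>w. \<Sum>k\<le>N. b k * e k w) = (\<Sum>j\<le>N. b j * inner_M (e j) (e k))" .
  qed
  also have "\<dots> = (\<Sum>k\<le>N. (b k)\<^sup>2)"
  proof (intro sum.cong refl)
    fix k assume k: "k \<in> {..N}"
    have "(\<Sum>j\<le>N. b j * inner_M (e j) (e k)) = (\<Sum>j\<le>N. if j = k then b k * inner_M (e k) (e k) else 0)"
      by (intro sum.cong) (auto simp: gram_schmidt_inner)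
    also have "\<dots> = b k" using k b0 by simp
    finally show "b k * (\<Sum>j\<le>N. b j * inner_M (e j) (e k)) = (b k)\<^sup>2" by (simp add: power2_eq_square)
  qed
  finally show "(\<integral>w. (\<Sum>i\<in>F. u i * X i w)\<^sup>2 \<partial>M) = (\<Sum>k\<le>N. (\<Sum>i\<in>F. u i * a i k)\<^sup>2)"
    unfolding b_def .
qed

end

section \<open>Gaussian families from independent normal variables\<close>

lemma indep_vars_PiM_coordinates:
  assumes "\<And>i. i \<in> I \<Longrightarrow> prob_space (M i)" "I \<noteq> {}"
  shows "prob_space.indep_vars (PiM I M) M (\<lambda>i \<omega>. \<omega> i) I"
proof -
  interpret prob_space "PiM I M" by (rule prob_space_PiM) fact
  have "distr (PiM I M) (PiM I M) (\<lambda>x. \<lambda>i\<in>I. x i) = distr (PiM I M) (PiM I M) (\<lambda>x. x)"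
    by (intro distr_cong) (auto simp: space_PiM)
  also have "\<dots> = PiM I M" by (simp add: distr_id2)
  also have "\<dots> = PiM I (\<lambda>i. distr (PiM I M) (M i) (\<lambda>x. x i))"
    by (intro PiM_cong refl distr_PiM_component[symmetric] assms) auto
  finally show ?thesis
    by (subst indep_vars_iff_distr_eq_PiM') (use assms in auto)
qed

lemma char_gaussian_series:
  fixes b :: "nat \<Rightarrow> real" and t :: real
  defines "\<Xi> \<equiv> PiM UNIV (\<lambda>_::nat. std_normal_distribution)"
  shows "char (distr \<Xi> borel (\<lambda>\<omega>. \<Sum>k\<le>N. b k * \<omega> k)) t = exp (- (t\<^sup>2 * (\<Sum>k\<le>N. (b k)\<^sup>2)) / 2)"
proof -
  interpret S: real_distribution std_normal_distribution by (rule real_dist_normal_dist)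
  interpret \<Xi>: prob_space \<Xi> unfolding \<Xi>_def by (rule prob_space_PiM) (rule S.prob_space_axioms)
  have "\<Xi>.indep_vars (\<lambda>_. std_normal_distribution) (\<lambda>i \<omega>. \<omega> i) UNIV"
    unfolding \<Xi>_def by (rule indep_vars_PiM_coordinates) (auto intro: S.prob_space_axioms)
  then have indep: "\<Xi>.indep_vars (\<lambda>_. borel) (\<lambda>k \<omega>. b k * \<omega> k) UNIV"
    by (rule \<Xi>.indep_vars_compose2) simp
  have m [measurable]: "(\<lambda>\<omega>. \<omega> k) \<in> borel_measurable \<Xi>" for k
  proof -
    have "(\<lambda>\<omega>. \<omega> k) \<in> measurable \<Xi> std_normal_distribution"
      unfolding \<Xi>_def by (rule measurable_component_singleton) simp
    then show ?thesis by (simp cong: measurable_cong_sets)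
  qed
  have one: "char (distr \<Xi> borel (\<lambda>\<omega>. b k * \<omega> k)) t = exp (- (b k * t)\<^sup>2 / 2)" for k
  proof -
    have "distr \<Xi> borel (\<lambda>\<omega>. b k * \<omega> k) = distr (distr \<Xi> borel (\<lambda>\<omega>. \<omega> k)) borel (\<lambda>x. b k * x)"
      by (subst distr_distr) (auto simp: o_def)
    also have "distr \<Xi> borel (\<lambda>\<omega>. \<omega> k) = distr \<Xi> std_normal_distribution (\<lambda>\<omega>. \<omega> k)"
      by (intro distr_cong) auto
    also have "\<dots> = std_normal_distribution"
      unfolding \<Xi>_def by (intro distr_PiM_component S.prob_space_axioms) auto
    finally show ?thesis by (simp add: char_normal)
  qed
  have "char (distr \<Xi> borel (\<lambda>\<omega>. \<Sum>k\<le>N. b k * \<omega> k)) t = (\<Prod>k\<le>N. char (distr \<Xi> borel (\<lambda>\<omega>. b k * \<omega> k)) t)"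
    by (intro \<Xi>.char_distr_sum \<Xi>.indep_vars_subset[OF indep]) auto
  also have "\<dots> = complex_of_real (exp (\<Sum>k\<le>N. - (b k * t)\<^sup>2 / 2))"
    unfolding one exp_sum[OF finite_atMost] of_real_prod ..
  also have "(\<Sum>k\<le>N. - (b k * t)\<^sup>2 / 2) = - (t\<^sup>2 * (\<Sum>k\<le>N. (b k)\<^sup>2)) / 2"
    by (simp add: sum_distrib_left sum_negf sum_divide_distrib power_mult_distrib mult.commute)
  finally show ?thesis .
qed

text \<open>\<open>Q\<close> is the image of an infinite product of standard normal laws under the
  triangular matrix of \<open>covariance_factorization\<close>. A finite combination of coordinates
  involves finitely many independent variables, and the quadratic form in its characteristic
  function is the prescribed second moment.\<close>

lemma gaussian_family_exists:
  fixes X :: "'i::countable \<Rightarrow> 'w \<Rightarrow> real"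
  assumes X: "\<And>i. X i \<in> square_integrable M"
  obtains Q :: "('i \<Rightarrow> real) measure" where "prob_space Q" "sets Q = sets borel"
    "\<And>F u t. finite F \<Longrightarrow> char (distr Q borel (\<lambda>v. \<Sum>i\<in>F. u i * v i)) t =
       exp (- (t\<^sup>2 * (\<integral>w. (\<Sum>i\<in>F. u i * X i w)\<^sup>2 \<partial>M)) / 2)"
proof -
  define \<Xi> where "\<Xi> = PiM UNIV (\<lambda>_::nat. std_normal_distribution)"
  interpret S: real_distribution std_normal_distribution by (rule real_dist_normal_dist)
  interpret \<Xi>: prob_space \<Xi> unfolding \<Xi>_def by (rule prob_space_PiM) (rule S.prob_space_axioms)
  obtain a where a: "\<And>F u N. finite F \<Longrightarrow> F \<subseteq> {..N} \<Longrightarrow>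
      (\<integral>w. (\<Sum>i\<in>F. u i * X (from_nat i) w)\<^sup>2 \<partial>M) = (\<Sum>k\<le>N. (\<Sum>i\<in>F. u i * a i k)\<^sup>2)"
    "\<And>i k. i < k \<Longrightarrow> a i k = 0"
    using covariance_factorization[of "\<lambda>n. X (from_nat n)" M] X by blast
  define V where "V \<omega> i = (\<Sum>k\<le>to_nat i. a (to_nat i) k * \<omega> k)" for \<omega> :: "nat \<Rightarrow> real" and i :: 'i
  have m [measurable]: "(\<lambda>\<omega>. \<omega> k) \<in> borel_measurable \<Xi>" for k
  proof -
    have "(\<lambda>\<omega>. \<omega> k) \<in> measurable \<Xi> std_normal_distribution"
      unfolding \<Xi>_def by (rule measurable_component_singleton) simp
    then show ?thesis by (simp cong: measurable_cong_sets)
  qed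
  have V [measurable]: "V \<in> borel_measurable \<Xi>"
    by (rule measurable_coordinatewise_then_product) (simp add: V_def)
  show thesis
  proof
    show "prob_space (distr \<Xi> borel V)" by (rule \<Xi>.prob_space_distr) simp
    show "sets (distr \<Xi> borel V) = sets borel" by simp
    fix F :: "'i set" and u :: "'i \<Rightarrow> real" and t :: real assume F: "finite F"
    define F' where "F' = to_nat ` F"
    \<comment> \<open>Inserting 0 keeps the maximum meaningful for empty \<open>F\<close>.\<close>
    define N where "N = Max (insert 0 F')"
    have F': "finite F'" "F' \<subseteq> {..N}" using F by (auto simp: F'_def N_def)
    define b where "b k = (\<Sum>i\<in>F'. u (from_nat i) * a i k)" for k
    have reindex: "(\<Sum>i\<in>F'. u (from_nat i) * g i) = (\<Sum>i\<in>F. u i * g (to_nat i))" for g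
      unfolding F'_def by (subst sum.reindex) (auto simp: inj_on_def)
    have "(\<Sum>i\<in>F. u i * V \<omega> i) = (\<Sum>k\<le>N. b k * \<omega> k)" for \<omega>
    proof -
      have "V \<omega> i = (\<Sum>k\<le>N. a (to_nat i) k * \<omega> k)" if "i \<in> F" for i
        unfolding V_def using F'(2) that a(2) by (intro sum.mono_neutral_left) (auto simp: F'_def)
      then have "(\<Sum>i\<in>F. u i * V \<omega> i) = (\<Sum>i\<in>F. \<Sum>k\<le>N. u i * a (to_nat i) k * \<omega> k)"
        by (simp add: sum_distrib_left mult.assoc)
      also have "\<dots> = (\<Sum>k\<le>N. \<Sum>i\<in>F. u i * a (to_nat i) k * \<omega> k)" by (rule sum.swap)
      also have "\<dots> = (\<Sum>k\<le>N. b k * \<omega> k)" by (simp add: b_def reindex sum_distrib_right)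
      finally show ?thesis .
    qed
    moreover have "(\<integral>w. (\<Sum>i\<in>F. u i * X i w)\<^sup>2 \<partial>M) = (\<Sum>k\<le>N. (b k)\<^sup>2)"
      using a(1)[OF F', of "\<lambda>i. u (from_nat i)"] reindex[of "\<lambda>i. X (from_nat i) _"] by (simp add: b_def)
    moreover have "distr (distr \<Xi> borel V) borel (\<lambda>v. \<Sum>i\<in>F. u i * v i) = distr \<Xi> borel (\<lambda>\<omega>. \<Sum>i\<in>F. u i * V \<omega> i)"
      by (subst distr_distr) (auto simp: o_def)
    ultimately show "char (distr (distr \<Xi> borel V) borel (\<lambda>v. \<Sum>i\<in>F. u i * v i)) t =
       exp (- (t\<^sup>2 * (\<integral>w. (\<Sum>i\<in>F. u i * X i w)\<^sup>2 \<partial>M)) / 2)"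
      using char_gaussian_series[where b = b and N = N and t = t] by (simp add: \<Xi>_def)
  qed
qed

section \<open>Weak convergence of dyadic paths\<close>

text \<open>Characteristic functions cover the degenerate case as well: for \<sigma> = 0 all
  \<open>Y n\<close> vanish almost surely and both sides are 1. For \<sigma> > 0 the limit theorem
  for the sums divided by \<sigma> is evaluated at \<open>\<sigma> * t\<close>.\<close>

lemma central_limit_char:
  fixes Y :: "nat \<Rightarrow> 'v \<Rightarrow> real" and Y0 :: "'w \<Rightarrow> real"
  assumes "prob_space P"
    and indep: "prob_space.indep_vars P (\<lambda>_. borel) Y UNIV"
    and distr: "\<And>n. distr P borel (Y n) = distr M borel Y0"
    and Y0 [measurable]: "Y0 \<in> borel_measurable M" and mean: "(\<integral>w. Y0 w \<partial>M) = 0"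
    and sq: "integrable M (\<lambda>w. (Y0 w)\<^sup>2)"
  shows "(\<lambda>m. char (distr P borel (\<lambda>\<omega>. (\<Sum>i<m. Y i \<omega>) / sqrt (real m))) t)
    \<longlonglongrightarrow> exp (- (t\<^sup>2 * (\<integral>w. (Y0 w)\<^sup>2 \<partial>M)) / 2)"
proof -
  interpret P: prob_space P by fact
  define \<sigma> where "\<sigma> = sqrt (\<integral>w. (Y0 w)\<^sup>2 \<partial>M)"
  have \<sigma>: "0 \<le> \<sigma>" "\<sigma>\<^sup>2 = (\<integral>w. (Y0 w)\<^sup>2 \<partial>M)" by (simp_all add: \<sigma>_def)
  have Y [measurable]: "Y n \<in> borel_measurable P" for n
    using indep unfolding P.indep_vars_def by simp
  have meanY: "P.expectation (Y n) = 0" for n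
  proof -
    have "P.expectation (Y n) = (\<integral>x. x \<partial>distr P borel (Y n))" by (subst integral_distr) auto
    also have "\<dots> = (\<integral>w. Y0 w \<partial>M)" unfolding distr by (subst integral_distr) auto
    finally show ?thesis using mean by simp
  qed
  have sqY: "integrable P (\<lambda>\<omega>. (Y n \<omega>)\<^sup>2)" for n
  proof -
    have "integrable (distr P borel (Y n)) (\<lambda>x. x\<^sup>2)"
      unfolding distr by (subst integrable_distr_eq) (auto simp: sq)
    then show ?thesis by (subst (asm) integrable_distr_eq) auto
  qed
  have varY: "P.expectation (\<lambda>\<omega>. (Y n \<omega>)\<^sup>2) = \<sigma>\<^sup>2" for n
  proof -
    have "P.expectation (\<lambda>\<omega>. (Y n \<omega>)\<^sup>2) = (\<integral>x. x\<^sup>2 \<partial>distr P borel (Y n))" by (subst integral_distr) auto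
    also have "\<dots> = (\<integral>w. (Y0 w)\<^sup>2 \<partial>M)" unfolding distr by (subst integral_distr) auto
    finally show ?thesis using \<sigma> by simp
  qed
  show ?thesis
  proof (cases "\<sigma> = 0")
    case True
    have "AE \<omega> in P. (Y n \<omega>)\<^sup>2 = 0" for n
      using integral_nonneg_eq_0_iff_AE[OF sqY[of n]] varY[of n] True by simp
    then have "AE \<omega> in P. \<forall>n. Y n \<omega> = 0" by (subst AE_all_countable) simp
    then have "AE \<omega> in P. (\<Sum>i<m. Y i \<omega>) / sqrt (real m) = 0" for m
      by eventually_elim simp
    then have "distr P borel (\<lambda>\<omega>. (\<Sum>i<m. Y i \<omega>) / sqrt (real m)) = distr P borel (\<lambda>_. 0)" for m
      by (intro distr_cong_AE) auto
    then have "char (distr P borel (\<lambda>\<omega>. (\<Sum>i<m. Y i \<omega>) / sqrt (real m))) t = 1" for m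
      by (simp add: char_def integral_distr P.prob_space del: P.distr_const)
    then show ?thesis using True \<sigma>(2) by simp
  next
    case False
    then have pos: "\<sigma> > 0" using \<sigma> by simp
    have "weak_conv_m (\<lambda>n. distr P borel (\<lambda>\<omega>. (\<Sum>i<n. Y i \<omega>) / sqrt (real n * \<sigma>\<^sup>2))) std_normal_distribution"
      by (rule P.central_limit_theorem_zero_mean[OF indep meanY pos sqY _ distr]) (simp add: meanY varY)
    then have "(\<lambda>n. char (distr P borel (\<lambda>\<omega>. (\<Sum>i<n. Y i \<omega>) / sqrt (real n * \<sigma>\<^sup>2))) (\<sigma> * t))
        \<longlonglongrightarrow> char std_normal_distribution (\<sigma> * t)"
      by (intro levy_continuity1 P.real_distribution_distr real_dist_normal_dist) auto
    moreover have "char (distr P borel (\<lambda>\<omega>. (\<Sum>i<n. Y i \<omega>) / sqrt (real n * \<sigma>\<^sup>2))) (\<sigma> * t)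
        = char (distr P borel (\<lambda>\<omega>. (\<Sum>i<n. Y i \<omega>) / sqrt (real n))) t" for n
      unfolding char_def using pos
      by (subst (1 2) integral_distr) (auto simp: real_sqrt_mult mult_ac)
    ultimately show ?thesis
      by (simp add: char_std_normal_distribution power_mult_distrib \<sigma>(2) mult.commute)
  qed
qed

lemma trig_polynomial_integrable:
  fixes W :: "'v \<Rightarrow> 'i::countable \<Rightarrow> real"
  assumes "prob_space P" "trig_polynomial p" "W \<in> borel_measurable P"
  shows "integrable P (\<lambda>\<omega>. p (W \<omega>))"
proof -
  interpret prob_space P by fact
  note [measurable] = assms(3) trig_polynomial_borel[OF assms(2)]
  obtain B where "\<And>v. \<bar>p v\<bar> \<le> B" using trig_polynomial_bounded[OF assms(2)] by blast
  then show ?thesis by (intro integrable_const_bound[of _ B]) auto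
qed

text \<open>The mean of a cosine wave is the real part of a rotated characteristic function of a
  linear functional. Since the frequencies absorb its argument, the value at 1 suffices. As in the
  Cramer-Wold device, convergence for all finite combinations is all that is asked of
  \<open>W\<close>.\<close>

lemma trig_polynomial_convergence:
  fixes W :: "nat \<Rightarrow> 'v \<Rightarrow> 'i::countable \<Rightarrow> real"
  assumes P: "prob_space P" and Q: "prob_space Q" "sets Q = sets borel"
    and W [measurable]: "\<And>m. W m \<in> borel_measurable P"
    and char: "\<And>F u. finite F \<Longrightarrow>
      (\<lambda>m. char (distr P borel (\<lambda>\<omega>. \<Sum>i\<in>F. u i * W m \<omega> i)) 1)
        \<longlonglongrightarrow> char (distr Q borel (\<lambda>v. \<Sum>i\<in>F. u i * v i)) 1"
    and "trig_polynomial p"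
  shows "(\<lambda>m. \<integral>\<omega>. p (W m \<omega>) \<partial>P) \<longlonglongrightarrow> (\<integral>v. p v \<partial>Q)"
  using \<open>trig_polynomial p\<close>
proof induction
  case (wave F c \<theta> u)
  have *: "(\<integral>\<omega>. c * cos (\<theta> + X \<omega>) \<partial>R) = c * Re (iexp \<theta> * char (distr R borel X) 1)"
    if "prob_space R" and [measurable]: "X \<in> borel_measurable R" for R :: "'z measure" and X
  proof -
    interpret R: prob_space R by fact
    have int: "integrable R (\<lambda>\<omega>. iexp (\<theta> + X \<omega>))" by (intro R.integrable_iexp) auto
    have "(\<integral>\<omega>. cos (\<theta> + X \<omega>) \<partial>R) = (\<integral>\<omega>. Re (iexp (\<theta> + X \<omega>)) \<partial>R)"
      by (simp add: Re_exp)
    also have "\<dots> = Re (\<integral>\<omega>. iexp (\<theta> + X \<omega>) \<partial>R)" by (rule integral_Re[OF int])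
    also have "(\<integral>\<omega>. iexp (\<theta> + X \<omega>) \<partial>R) = iexp \<theta> * char (distr R borel X) 1"
      unfolding char_def by (subst integral_distr) (auto simp: distrib_left exp_add)
    finally show ?thesis by simp
  qed
  have "(\<lambda>m. c * Re (iexp \<theta> * char (distr P borel (\<lambda>\<omega>. \<Sum>i\<in>F. u i * W m \<omega> i)) 1))
      \<longlonglongrightarrow> c * Re (iexp \<theta> * char (distr Q borel (\<lambda>v. \<Sum>i\<in>F. u i * v i)) 1)"
    by (intro tendsto_intros char wave)
  moreover have "(\<lambda>v. \<Sum>i\<in>F. u i * v i) \<in> borel_measurable Q"
    by (simp add: Q cong: measurable_cong_sets)
  moreover have "(\<lambda>\<omega>. \<Sum>i\<in>F. u i * W m \<omega> i) \<in> borel_measurable P" for m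
    using measurable_product_then_coordinatewise[OF W] by measurable
  ultimately show ?case by (simp only: *[OF P] *[OF Q(1)])
next
  case (add p q)
  have Qid: "(\<lambda>v. v) \<in> borel_measurable Q" by (simp add: Q cong: measurable_cong_sets)
  from add have "(\<lambda>m. (\<integral>\<omega>. p (W m \<omega>) \<partial>P) + (\<integral>\<omega>. q (W m \<omega>) \<partial>P)) \<longlonglongrightarrow> (\<integral>v. p v \<partial>Q) + (\<integral>v. q v \<partial>Q)"
    by (intro tendsto_add)
  then show ?case
    using trig_polynomial_integrable[OF P _ W] trig_polynomial_integrable[OF Q(1) _ Qid] add.hyps
    by simp
qed

text \<open>\<open>q + \<Delta>\<close> is an integrable majorant of \<open>Z\<close>, and every
  integrable majorant lies above \<open>q - \<Delta>\<close>. Both bounds make sense for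
  nonmeasurable \<open>Z\<close>; off the set \<open>S\<close> the crude bound B + B' is paid,
  weighted with the probability of the complement.\<close>

lemma outer_expectation_sandwich:
  assumes "prob_space P" and q: "integrable P q" and S [measurable]: "S \<in> sets P"
    and Z: "\<And>\<omega>. \<omega> \<in> space P \<Longrightarrow> \<bar>Z \<omega>\<bar> \<le> B" and qB: "\<And>\<omega>. \<omega> \<in> space P \<Longrightarrow> \<bar>q \<omega>\<bar> \<le> B'"
    and near: "\<And>\<omega>. \<omega> \<in> S \<Longrightarrow> \<bar>Z \<omega> - q \<omega>\<bar> \<le> \<delta>" and "0 \<le> \<delta>"
  shows "\<bar>outer_expectation P Z - (\<integral>\<omega>. q \<omega> \<partial>P)\<bar> \<le> \<delta> + (B + B') * measure P (space P - S)"
proof -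
  interpret P: prob_space P by fact
  let ?T = "space P - S"
  define \<Delta> where "\<Delta> \<omega> = \<delta> + (B + B') * indicator ?T \<omega>" for \<omega>
  have int\<Delta>: "integrable P \<Delta>" and int\<Delta>': "(\<integral>\<omega>. \<Delta> \<omega> \<partial>P) = \<delta> + (B + B') * measure P ?T"
    unfolding \<Delta>_def by (auto simp: P.prob_space P.emeasure_eq_measure)
  have bound: "\<bar>Z \<omega> - q \<omega>\<bar> \<le> \<Delta> \<omega>" if "\<omega> \<in> space P" for \<omega>
  proof (cases "\<omega> \<in> S")
    case False
    then show ?thesis using Z[OF that] qB[OF that] \<open>0 \<le> \<delta>\<close> that by (simp add: \<Delta>_def)
  qed (use near in \<open>simp add: \<Delta>_def\<close>)
  let ?U = "{U. integrable P U \<and> (\<forall>\<omega>\<in>space P. Z \<omega> \<le> U \<omega>)}"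
  have lower: "(\<integral>\<omega>. q \<omega> \<partial>P) - (\<integral>\<omega>. \<Delta> \<omega> \<partial>P) \<le> (\<integral>\<omega>. U \<omega> \<partial>P)" if "U \<in> ?U" for U
  proof -
    have "(\<integral>\<omega>. q \<omega> - \<Delta> \<omega> \<partial>P) \<le> (\<integral>\<omega>. U \<omega> \<partial>P)"
    proof (rule integral_mono)
      fix \<omega> assume "\<omega> \<in> space P"
      with that bound[OF this] show "q \<omega> - \<Delta> \<omega> \<le> U \<omega>" by (auto simp: abs_le_iff intro: order_trans[rotated])
    qed (use that q int\<Delta> in auto)
    then show ?thesis using q int\<Delta> by simp
  qed
  have majorant: "(\<lambda>\<omega>. q \<omega> + \<Delta> \<omega>) \<in> ?U"
  proof -
    have "Z \<omega> \<le> q \<omega> + \<Delta> \<omega>" if "\<omega> \<in> space P" for \<omega> using bound[OF that] by linarith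
    then show ?thesis using q int\<Delta> by simp
  qed
  have "(\<integral>\<omega>. q \<omega> \<partial>P) - (\<integral>\<omega>. \<Delta> \<omega> \<partial>P) \<le> outer_expectation P Z"
    unfolding outer_expectation_def using majorant lower by (intro cINF_greatest) blast+
  moreover have "outer_expectation P Z \<le> (\<integral>\<omega>. q \<omega> + \<Delta> \<omega> \<partial>P)"
    unfolding outer_expectation_def
    by (rule cINF_lower[OF _ majorant]) (use lower in \<open>auto intro!: bdd_belowI2\<close>)
  ultimately show ?thesis using q int\<Delta> int\<Delta>' by (simp add: abs_le_iff)
qed

text \<open>Only \<open>x\<close> has to lie in the compact set: in the application \<open>y\<close>
  is the rescaled estimator, which may lie outside it, while \<open>g\<close> is merely continuous.
  A Lebesgue number of the cover by preimages of balls of radius \<epsilon>/2 serves as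
  \<delta>.\<close>

lemma compact_uniform_continuity:
  fixes g :: "'d \<Rightarrow> real"
  assumes g: "continuous_map (mtopology_of D) euclideanreal g"
    and K: "compactin (mtopology_of D) K" and "0 < \<epsilon>"
  obtains \<delta> where "0 < \<delta>"
    "\<And>x y. x \<in> K \<Longrightarrow> y \<in> mspace D \<Longrightarrow> mdist D x y < \<delta> \<Longrightarrow> \<bar>g x - g y\<bar> < \<epsilon>"
proof -
  interpret D: Metric_space "mspace D" "mdist D" by (rule Metric_space_mspace_mdist)
  have KD: "K \<subseteq> mspace D" using compactin_subset_topspace[OF K] by simp
  define \<U> where "\<U> = range (\<lambda>r. {x \<in> mspace D. g x \<in> ball r (\<epsilon>/2)})"
  have "\<exists>\<delta>>0. \<forall>x\<in>K. \<exists>U\<in>\<U>. D.mball x \<delta> \<subseteq> U"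
  proof (rule D.lebesgue_number[of K \<U>])
    show "compactin D.mtopology K" using K by (simp add: mtopology_of_def)
    show "K \<subseteq> \<Union>\<U>"
    proof
      fix x assume "x \<in> K"
      then have "x \<in> {x' \<in> mspace D. g x' \<in> ball (g x) (\<epsilon>/2)}" using KD \<open>0 < \<epsilon>\<close> by auto
      then show "x \<in> \<Union>\<U>" unfolding \<U>_def by blast
    qed
    fix U assume "U \<in> \<U>"
    then obtain r where "U = {x \<in> mspace D. g x \<in> ball r (\<epsilon>/2)}" unfolding \<U>_def by blast
    then show "openin D.mtopology U"
      using openin_continuous_map_preimage[OF g, of "ball r (\<epsilon>/2)"] by (simp add: mtopology_of_def)
  qed
  then obtain \<delta> where \<delta>: "0 < \<delta>" "\<And>x. x \<in> K \<Longrightarrow> \<exists>U\<in>\<U>. D.mball x \<delta> \<subseteq> U" by blast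
  show thesis
  proof (rule that[OF \<delta>(1)])
    fix x y assume x: "x \<in> K" and y: "y \<in> mspace D" "mdist D x y < \<delta>"
    from \<delta>(2)[OF x] obtain r where "D.mball x \<delta> \<subseteq> {x \<in> mspace D. g x \<in> ball r (\<epsilon>/2)}"
      unfolding \<U>_def by auto
    moreover have "x \<in> D.mball x \<delta>" "y \<in> D.mball x \<delta>" using x y KD \<delta>(1) by auto
    ultimately have "g x \<in> ball r (\<epsilon>/2)" "g y \<in> ball r (\<epsilon>/2)" by blast+
    then have "dist r (g x) < \<epsilon>/2" "dist r (g y) < \<epsilon>/2" unfolding mem_ball .
    then show "\<bar>g x - g y\<bar> < \<epsilon>" unfolding dist_real_def by linarith
  qed
qed

section \<open>Borel maps into spaces of functions\<close>

lemma space_metric_borel [simp]: "space (metric_borel D) = mspace D"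
  and sets_metric_borel_openin: "openin (mtopology_of D) U \<Longrightarrow> U \<in> sets (metric_borel D)"
proof -
  have sub: "{U. openin (mtopology_of D) U} \<subseteq> Pow (mspace D)"
    using openin_subset[of "mtopology_of D"] by auto
  show "space (metric_borel D) = mspace D"
    unfolding metric_borel_def by (simp add: space_measure_of sub)
  show "openin (mtopology_of D) U \<Longrightarrow> U \<in> sets (metric_borel D)"
    unfolding metric_borel_def using sub by (simp add: in_measure_of)
qed

lemma measurable_metric_borelI:
  assumes "\<And>x. x \<in> space N \<Longrightarrow> F x \<in> mspace D"
    and "\<And>U. openin (mtopology_of D) U \<Longrightarrow> F -` U \<inter> space N \<in> sets N"
  shows "F \<in> measurable N (metric_borel D)"
  unfolding metric_borel_def
  by (rule measurable_measure_of) (use assms openin_subset[of "mtopology_of D"] in auto)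

lemma continuous_map_metric_borel:
  fixes g :: "'d \<Rightarrow> real"
  assumes g: "continuous_map (mtopology_of D) euclideanreal g"
  shows "g \<in> borel_measurable (metric_borel D)"
proof (rule borel_measurableI)
  fix S :: "real set" assume "open S"
  then have "openin (mtopology_of D) {x \<in> topspace (mtopology_of D). g x \<in> S}"
    by (intro openin_continuous_map_preimage[OF g]) simp
  then show "g -` S \<inter> space (metric_borel D) \<in> sets (metric_borel D)"
    by (intro sets_metric_borel_openin) (simp add: vimage_def Int_def conj_commute)
qed

text \<open>Made total so that every \<open>v\<close> yields a bounded function: outside all sets
  \<open>lattice_paths\<close>, where \<open>lattice_limit\<close> may be meaningless, the zero path
  is used. Integer constants make the union countable, hence Borel, and by monotonicity they exhaust
  all constants.\<close>

definition lattice_realization :: "'s set \<Rightarrow> ('s \<Rightarrow> real) \<Rightarrow> (nat \<times> nat \<Rightarrow> real) \<Rightarrow> 's \<Rightarrow> real" where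
  "lattice_realization S \<rho> v =
     (if v \<in> (\<Union>n. lattice_paths (real n)) then (\<lambda>s\<in>S. lattice_limit v (\<rho> s)) else (\<lambda>s\<in>S. 0))"

lemma lattice_paths_in_union: "v \<in> lattice_paths c \<Longrightarrow> v \<in> (\<Union>n. lattice_paths (real n))"
  using lattice_paths_mono[of c "real (nat \<lceil>c\<rceil>)"] by (auto simp: real_nat_ceiling_ge)

lemma lattice_realization_eq:
  "v \<in> lattice_paths c \<Longrightarrow> lattice_realization S \<rho> v = (\<lambda>s\<in>S. lattice_limit v (\<rho> s))"
  using lattice_paths_in_union unfolding lattice_realization_def by auto

lemma lattice_realization_in_mspace:
  assumes "\<And>s. s \<in> S \<Longrightarrow> \<rho> s \<in> {0..1}"
  shows "lattice_realization S \<rho> v \<in> mspace (funspace S euclidean_metric)"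
proof (cases "v \<in> (\<Union>n. lattice_paths (real n))")
  case True
  then show ?thesis
    using lattice_limit_in_mspace[OF _ assms] unfolding lattice_realization_def by auto
next
  case False
  have "bounded ((\<lambda>s\<in>S. 0 :: real) ` S)" by (intro boundedI[of _ 0]) auto
  with False show ?thesis unfolding lattice_realization_def mspace_bounded_functions by simp
qed

text \<open>Measurability of evaluations would not settle the Borel sets of the uniform metric, so
  preimages of open sets are computed piecewise: on each closed set
  \<open>lattice_paths (real n)\<close> the map is continuous and the preimage relatively open, and
  countably many pieces together with the remaining set exhaust the space.\<close>

lemma lattice_realization_measurable:
  assumes \<rho>: "\<And>s. s \<in> S \<Longrightarrow> \<rho> s \<in> {0..1}" and "S \<noteq> {}"
  shows "lattice_realization S \<rho> \<in> measurable borel (metric_borel (funspace S euclidean_metric))"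
proof (rule measurable_metric_borelI)
  fix U :: "('a \<Rightarrow> real) set" assume U: "openin (mtopology_of (funspace S euclidean_metric)) U"
  let ?E = "\<lambda>v. \<lambda>s\<in>S. lattice_limit v (\<rho> s)" and ?L = "\<Union>n. lattice_paths (real n)"
  have "{v \<in> lattice_paths c. ?E v \<in> U} \<in> sets borel" for c
  proof -
    have "openin (top_of_set (lattice_paths c)) {v \<in> lattice_paths c. ?E v \<in> U}"
      using openin_continuous_map_preimage[OF lattice_limit_continuous_map[OF \<rho> \<open>S \<noteq> {}\<close>] U] by simp
    then obtain T where "open T" "{v \<in> lattice_paths c. ?E v \<in> U} = lattice_paths c \<inter> T"
      unfolding openin_open by blast
    then show ?thesis by simp
  qed
  then have "(\<Union>n. {v \<in> lattice_paths (real n). ?E v \<in> U}) \<union>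
      (if (\<lambda>s\<in>S. 0) \<in> U then UNIV - ?L else {}) \<in> sets borel"
    by auto
  also have "(\<Union>n. {v \<in> lattice_paths (real n). ?E v \<in> U}) \<union> (if (\<lambda>s\<in>S. 0) \<in> U then UNIV - ?L else {}) =
      lattice_realization S \<rho> -` U \<inter> space borel"
    unfolding lattice_realization_def by (auto split: if_splits)
  finally show "lattice_realization S \<rho> -` U \<inter> space borel \<in> sets borel" .
qed (rule lattice_realization_in_mspace[OF \<rho>])

text \<open>A continuous mapping theorem for a map known to be continuous only on compact sets: up
  to small probability, tightness confines \<open>W m\<close> and \<open>Q\<close> to one such set,
  where a trigonometric polynomial replaces the functional. \<open>X m\<close> is not assumed
  measurable; it enters through its uniform distance from the path of \<open>W m\<close>.\<close>

lemma weak_convergence_from_lattice: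
  fixes W :: "nat \<Rightarrow> 'v \<Rightarrow> nat \<times> nat \<Rightarrow> real" and S :: "'s set"
  defines "D \<equiv> funspace S euclidean_metric"
  assumes P: "prob_space P" and Q: "prob_space Q" "sets Q = sets borel"
    and \<rho>: "\<And>s. s \<in> S \<Longrightarrow> \<rho> s \<in> {0..1}" and "S \<noteq> {}"
    and W [measurable]: "\<And>m. W m \<in> borel_measurable P"
    and conv: "\<And>p. trig_polynomial p \<Longrightarrow> (\<lambda>m. \<integral>\<omega>. p (W m \<omega>) \<partial>P) \<longlonglongrightarrow> (\<integral>v. p v \<partial>Q)"
    and tight: "\<And>\<epsilon>. 0 < \<epsilon> \<Longrightarrow> \<exists>c. (\<forall>m\<ge>1. measure P {\<omega> \<in> space P. W m \<omega> \<notin> lattice_paths c} \<le> \<epsilon>) \<and>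
        measure Q {v \<in> space Q. v \<notin> lattice_paths c} \<le> \<epsilon>"
    and X: "\<And>m \<omega>. \<omega> \<in> space P \<Longrightarrow> X m \<omega> \<in> mspace D"
    and near: "AE \<omega> in P. \<forall>m\<ge>m1. \<forall>s\<in>S. \<bar>X m \<omega> s - lattice_limit (W m \<omega>) (\<rho> s)\<bar> \<le> \<delta> m"
    and \<delta>: "\<delta> \<longlonglongrightarrow> 0"
  shows "weakly_converges P D X (distr Q (metric_borel D) (lattice_realization S \<rho>)) (\<lambda>x. x)"
  unfolding weakly_converges_def
proof (intro conjI allI ballI impI)
  let ?\<Phi> = "lattice_realization S \<rho>"
  let ?N = "distr Q (metric_borel D) ?\<Phi>"
  interpret P: prob_space P by fact
  interpret Q: prob_space Q by fact
  show "X m \<omega> \<in> mspace D" if "\<omega> \<in> space P" for m \<omega> by (rule X[OF that])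
  show "(\<lambda>x. x) \<in> measurable ?N (metric_borel D)" by simp
  fix g :: "('s \<Rightarrow> real) \<Rightarrow> real"
  assume "continuous_map (mtopology_of D) euclideanreal g \<and> bounded (g ` mspace D)"
  then have g: "continuous_map (mtopology_of D) euclideanreal g" and "bounded (g ` mspace D)" by auto
  then obtain B where B: "0 < B" "\<And>x. x \<in> mspace D \<Longrightarrow> \<bar>g x\<bar> \<le> B"
    unfolding bounded_pos by auto
  have \<Phi> [measurable]: "?\<Phi> \<in> measurable Q (metric_borel D)"
    using lattice_realization_measurable[OF \<rho> \<open>S \<noteq> {}\<close>] Q(2) unfolding D_def
    by (simp cong: measurable_cong_sets)
  have \<Phi>_in: "?\<Phi> v \<in> mspace D" for v unfolding D_def by (rule lattice_realization_in_mspace[OF \<rho>])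
  note g_meas [measurable] = continuous_map_metric_borel[OF g]
  have spQ: "space Q = UNIV" using sets_eq_imp_space_eq[OF Q(2)] by simp
  have lim: "(\<integral>x. g x \<partial>?N) = (\<integral>v. g (?\<Phi> v) \<partial>Q)" by (subst integral_distr) auto
  \<comment> \<open>The set described by \<open>near\<close> need not be measurable; a measurable
    subset of probability 1 is fixed, the same for all \<open>m\<close>.\<close>
  obtain \<Omega> where \<Omega>: "\<Omega> \<in> sets P" "P.prob \<Omega> = 1"
    "\<And>\<omega> m s. \<omega> \<in> \<Omega> \<Longrightarrow> m \<ge> m1 \<Longrightarrow> s \<in> S \<Longrightarrow> \<bar>X m \<omega> s - lattice_limit (W m \<omega>) (\<rho> s)\<bar> \<le> \<delta> m"
  proof -
    from P.AE_E_prob[OF near] obtain S' where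
      "S' \<subseteq> {\<omega> \<in> space P. \<forall>m\<ge>m1. \<forall>s\<in>S. \<bar>X m \<omega> s - lattice_limit (W m \<omega>) (\<rho> s)\<bar> \<le> \<delta> m}"
      "S' \<in> sets P" "P.prob S' = 1" by blast
    then show thesis by (intro that[of S']) auto
  qed
  \<comment> \<open>The factor collects 2e + (2B+1)e for replacing \<open>g (X m)\<close> by
    \<open>p (W m)\<close>, e for the convergence of the expectations of \<open>p\<close>, and e +
    (2B+1)e for returning to the functional under \<open>Q\<close>.\<close>
  have main: "eventually (\<lambda>m. \<bar>outer_expectation P (\<lambda>\<omega>. g (X m \<omega>)) - (\<integral>v. g (?\<Phi> v) \<partial>Q)\<bar> < (6 + 4 * B) * e) sequentially"
    if e: "0 < e" "e < 1" for e
  proof -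
    \<comment> \<open>One \<open>c\<close> serves all m \<ge> 1 and \<open>Q\<close>, so
      \<open>p\<close> and \<open>d\<close> below do not depend on \<open>m\<close>.\<close>
    obtain c where c: "\<And>m. m \<ge> 1 \<Longrightarrow> P.prob {\<omega> \<in> space P. W m \<omega> \<notin> lattice_paths c} \<le> e"
      "Q.prob {v \<in> space Q. v \<notin> lattice_paths c} \<le> e" using tight[OF e(1)] by blast
    let ?A = "lattice_paths c" and ?E = "\<lambda>v. \<lambda>s\<in>S. lattice_limit v (\<rho> s)"
    have E: "continuous_map (top_of_set ?A) (mtopology_of D) ?E"
      unfolding D_def by (rule lattice_limit_continuous_map[OF \<rho> \<open>S \<noteq> {}\<close>])
    have E_in: "?E v \<in> mspace D" if "v \<in> ?A" for v
      unfolding D_def by (rule lattice_limit_in_mspace[OF that \<rho>])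
    have "continuous_map (top_of_set ?A) euclideanreal (g \<circ> ?E)" by (rule continuous_map_compose[OF E g])
    then have contA: "continuous_on ?A (g \<circ> ?E)" by simp
    obtain p where p: "trig_polynomial p" "\<And>v. v \<in> ?A \<Longrightarrow> \<bar>(g \<circ> ?E) v - p v\<bar> < e" "\<And>v. \<bar>p v\<bar> \<le> B + e"
      using trig_polynomial_approximation[OF compact_lattice_paths contA, of B e] B E_in e by auto
    have "compactin (top_of_set ?A) ?A" by (simp add: compactin_subtopology compact_lattice_paths)
    then have K: "compactin (mtopology_of D) (?E ` ?A)" by (rule image_compactin[OF _ E])
    obtain d where d: "0 < d"
      "\<And>x y. x \<in> ?E ` ?A \<Longrightarrow> y \<in> mspace D \<Longrightarrow> mdist D x y < d \<Longrightarrow> \<bar>g x - g y\<bar> < e"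
      using compact_uniform_continuity[OF g K e(1)] by blast
    have intp: "integrable Q p"
      using trig_polynomial_integrable[OF Q(1) p(1), of "\<lambda>v. v"] Q(2) by (simp cong: measurable_cong_sets)
    have Aq [measurable]: "?A \<in> sets Q" using Q(2) by simp
    have limQ: "\<bar>(\<integral>v. g (?\<Phi> v) \<partial>Q) - (\<integral>v. p v \<partial>Q)\<bar> \<le> e + (2 * B + 1) * e"
    proof -
      have intg: "integrable Q (\<lambda>v. g (?\<Phi> v))"
        using B \<Phi>_in by (intro Q.integrable_const_bound[of _ B]) auto
      define \<Delta> where "\<Delta> v = e + (2 * B + 1) * indicator (space Q - ?A) v" for v
      have int\<Delta>: "integrable Q \<Delta>" "(\<integral>v. \<Delta> v \<partial>Q) = e + (2 * B + 1) * Q.prob (space Q - ?A)"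
        unfolding \<Delta>_def by (auto simp: Q.prob_space Q.emeasure_eq_measure)
      have "\<bar>g (?\<Phi> v) - p v\<bar> \<le> \<Delta> v" for v
      proof (cases "v \<in> ?A")
        case True
        then show ?thesis using p(2)[OF True] e lattice_realization_eq[OF True, of S \<rho>]
          by (simp add: \<Delta>_def)
      next
        case False
        then show ?thesis using p(3)[of v] B(2)[OF \<Phi>_in, of v] e by (simp add: \<Delta>_def spQ)
      qed
      then have "(\<integral>v. \<bar>g (?\<Phi> v) - p v\<bar> \<partial>Q) \<le> (\<integral>v. \<Delta> v \<partial>Q)"
        using intg intp int\<Delta> by (intro integral_mono) auto
      moreover have "\<bar>(\<integral>v. g (?\<Phi> v) \<partial>Q) - (\<integral>v. p v \<partial>Q)\<bar> \<le> (\<integral>v. \<bar>g (?\<Phi> v) - p v\<bar> \<partial>Q)"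
        using integral_abs_bound[of Q "\<lambda>v. g (?\<Phi> v) - p v"] intg intp by simp
      moreover have "(2 * B + 1) * Q.prob (space Q - ?A) \<le> (2 * B + 1) * e"
        using c(2) B(1) by (intro mult_left_mono) (auto simp: set_diff_eq)
      ultimately show ?thesis using int\<Delta> by linarith
    qed
    have "eventually (\<lambda>m. \<delta> m < d) sequentially" using \<delta> d(1) by (rule order_tendstoD)
    moreover have "eventually (\<lambda>m. \<bar>(\<integral>\<omega>. p (W m \<omega>) \<partial>P) - (\<integral>v. p v \<partial>Q)\<bar> < e) sequentially"
      using tendstoD[OF conv[OF p(1)] e(1)] by (simp add: dist_real_def)
    moreover have "eventually (\<lambda>m. m \<ge> max 1 m1) sequentially" by (rule eventually_ge_at_top)
    ultimately show ?thesis
    proof eventually_elim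
      case (elim m)
      have [measurable]: "\<Omega> \<in> sets P" by (rule \<Omega>)
      define T where "T = {\<omega> \<in> \<Omega>. W m \<omega> \<in> ?A}"
      have T_eq: "T = \<Omega> \<inter> {\<omega> \<in> space P. W m \<omega> \<in> ?A}"
        using sets.sets_into_space[OF \<Omega>(1)] unfolding T_def by auto
      have T: "T \<in> sets P" unfolding T_eq by measurable
      have "P.prob (space P - T) \<le> P.prob ((space P - \<Omega>) \<union> {\<omega> \<in> space P. W m \<omega> \<notin> ?A})"
        by (rule P.finite_measure_mono) (auto simp: T_def)
      also have "\<dots> \<le> P.prob (space P - \<Omega>) + P.prob {\<omega> \<in> space P. W m \<omega> \<notin> ?A}"
        by (rule measure_Un_le) measurable
      also have "\<dots> \<le> 0 + e" using c(1)[of m] elim \<Omega> by (intro add_mono) (auto simp: P.prob_compl)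
      finally have probT: "P.prob (space P - T) \<le> e" by simp
      have "\<bar>outer_expectation P (\<lambda>\<omega>. g (X m \<omega>)) - (\<integral>\<omega>. p (W m \<omega>) \<partial>P)\<bar>
          \<le> 2 * e + (B + (B + e)) * P.prob (space P - T)"
      proof (rule outer_expectation_sandwich[OF P trig_polynomial_integrable[OF P p(1) W] T])
        fix \<omega> assume "\<omega> \<in> T"
        then have \<omega>: "\<omega> \<in> \<Omega>" "W m \<omega> \<in> ?A" "\<omega> \<in> space P"
          using sets.sets_into_space[OF \<Omega>(1)] unfolding T_def by auto
        have "mdist D (?E (W m \<omega>)) (X m \<omega>) \<le> \<delta> m"
          unfolding D_def
        proof (rule mdist_bounded_functions_le)
          fix s assume "s \<in> S"
          then show "\<bar>?E (W m \<omega>) s - X m \<omega> s\<bar> \<le> \<delta> m"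
            using \<Omega>(3)[OF \<omega>(1) _ \<open>s \<in> S\<close>, of m] elim by (simp add: abs_minus_commute)
        qed (use X[OF \<omega>(3)] E_in[OF \<omega>(2)] \<open>S \<noteq> {}\<close> in \<open>auto simp: D_def simp del: mspace_funspace\<close>)
        then have "\<bar>g (?E (W m \<omega>)) - g (X m \<omega>)\<bar> < e"
          using elim \<omega> X by (intro d(2)) auto
        with p(2)[OF \<omega>(2)] show "\<bar>g (X m \<omega>) - p (W m \<omega>)\<bar> \<le> 2 * e" by simp
      qed (use B X p(3) e in auto)
      moreover have "(B + (B + e)) * P.prob (space P - T) \<le> (B + (B + 1)) * e"
        using probT B(1) e by (intro mult_mono) auto
      moreover have "(B + (B + 1)) * e = (2 * B + 1) * e" by simp
      moreover have "2 * e + (2 * B + 1) * e + e + (e + (2 * B + 1) * e) = (6 + 4 * B) * e"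
        by (simp add: algebra_simps)
      ultimately show ?case using limQ elim by linarith
    qed
  qed
  show "(\<lambda>m. outer_expectation P (\<lambda>\<omega>. g (X m \<omega>))) \<longlonglongrightarrow> (\<integral>x. g x \<partial>?N)"
    unfolding lim
  proof (rule tendstoI)
    fix \<epsilon> :: real assume "0 < \<epsilon>"
    define e where "e = min (1/2) (\<epsilon> / (6 + 4 * B))"
    have e: "0 < e" "e < 1" using \<open>0 < \<epsilon>\<close> B(1) by (auto simp: e_def)
    have "(6 + 4 * B) * e \<le> (6 + 4 * B) * (\<epsilon> / (6 + 4 * B))"
      using B(1) by (intro mult_left_mono) (auto simp: e_def)
    also have "\<dots> = \<epsilon>" using B(1) by simp
    finally have "(6 + 4 * B) * e \<le> \<epsilon>" .
    with main[OF e] show "eventually (\<lambda>m. dist (outer_expectation P (\<lambda>\<omega>. g (X m \<omega>)))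
        (\<integral>v. g (?\<Phi> v) \<partial>Q) < \<epsilon>) sequentially"
      by (auto simp: dist_real_def elim: eventually_mono)
  qed
qed

section \<open>Laws of large numbers and nearest observations\<close>

lemma (in prob_space) indep_vars_reindex_inj:
  assumes f: "inj_on f J" and indep: "indep_vars N X (f ` J)"
  shows "indep_vars (\<lambda>j. N (f j)) (\<lambda>j. X (f j)) J"
  unfolding indep_vars_def2 indep_sets_def
proof (intro conjI ballI allI impI)
  have rv: "random_variable (N (f j)) (X (f j))" if "j \<in> J" for j
    using indep that unfolding indep_vars_def2 by auto
  then show "random_variable (N (f j)) (X (f j))" if "j \<in> J" for j using that .
  show "{X (f j) -` A \<inter> space M |A. A \<in> sets (N (f j))} \<subseteq> events" if "j \<in> J" for j
    using rv[OF that] by (auto intro: measurable_sets)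
  fix K A
  assume K: "K \<subseteq> J" "K \<noteq> {}" "finite K"
    and A: "A \<in> (\<Pi> j\<in>K. {X (f j) -` A \<inter> space M |A. A \<in> sets (N (f j))})"
  have fK: "inj_on f K" using f K(1) by (rule inj_on_subset)
  define A' where "A' k = A (inv_into K f k)" for k
  have A'f: "A' (f j) = A j" if "j \<in> K" for j using fK that by (simp add: A'_def)
  have "indep_sets (\<lambda>i. {X i -` A \<inter> space M |A. A \<in> sets (N i)}) (f ` J)"
    using indep unfolding indep_vars_def2 by simp
  moreover have "A' \<in> (\<Pi> k\<in>f ` K. {X k -` A \<inter> space M |A. A \<in> sets (N k)})"
    using A by (auto simp: A'f Pi_iff)
  ultimately have "prob (\<Inter>k\<in>f ` K. A' k) = (\<Prod>k\<in>f ` K. prob (A' k))"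
    using K unfolding indep_sets_def by (meson finite_imageI image_is_empty image_mono)
  then show "prob (\<Inter>j\<in>K. A j) = (\<Prod>j\<in>K. prob (A j))"
    by (simp add: prod.reindex[OF fK] A'f)
qed

text \<open>Boundedness makes the deviation probabilities decay like 2 r^m with r < 1, so they are
  summable for each fixed tolerance without truncation or subsequences. The tolerances 1/(k+1) keep
  the number of exceptional sets countable.\<close>

lemma (in prob_space) bounded_strong_law:
  assumes indep: "indep_vars (\<lambda>_. borel) Y UNIV"
    and distr: "\<And>n::nat. distr M borel (Y n) = distr M borel (Y 0)"
    and bound: "AE x in M. Y 0 x \<in> {a..b}" and "a < b"
  shows "AE x in M. (\<lambda>m. (\<Sum>i<m. Y i x) / real m) \<longlonglongrightarrow> expectation (Y 0)"
proof -
  have Y [measurable]: "random_variable borel (Y n)" for n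
    using indep unfolding indep_vars_def2 by simp
  let ?\<mu> = "expectation (Y 0)"
  have "AE x in M. eventually (\<lambda>m. \<bar>(\<Sum>i<m. Y i x) / real m - ?\<mu>\<bar> < \<epsilon>) sequentially" if "0 < \<epsilon>" for \<epsilon>
  proof -
    define A where "A m = {x \<in> space M. \<bar>(\<Sum>i<m. Y i x) / real m - ?\<mu>\<bar> \<ge> \<epsilon>}" for m
    have A [measurable]: "A m \<in> events" for m unfolding A_def by measurable
    define r where "r = exp (- 2 * \<epsilon>\<^sup>2 / (b - a)\<^sup>2)"
    have r: "0 \<le> r" "r < 1" using that \<open>a < b\<close> by (auto simp: r_def)
    have "prob (A m) \<le> 2 * r ^ m" for m
    proof (cases "m = 0")
      case True
      then show ?thesis using order_trans[OF prob_le_1[of "A m"], of 2] by simp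
    next
      case False
      interpret H: Hoeffding_ineq_iid M "{..<m}" Y "Y 0" a b ?\<mu>
        by unfold_locales (use bound distr indep_vars_subset[OF indep] in auto)
      have ne: "{..<m} \<noteq> {}" using False by (simp add: lessThan_empty_iff)
      have "prob (A m) \<le> 2 * exp (- 2 * real m * \<epsilon>\<^sup>2 / (b - a)\<^sup>2)"
        using H.Hoeffding_ineq_abs_ge'[OF less_imp_le[OF that] \<open>a < b\<close> ne] by (simp only: A_def card_lessThan)
      also have "exp (- 2 * real m * \<epsilon>\<^sup>2 / (b - a)\<^sup>2) = r ^ m"
        unfolding r_def exp_of_nat_mult [symmetric] by (simp add: mult_ac)
      finally show ?thesis .
    qed
    then have le: "norm (prob (A m)) \<le> 2 * r ^ m" for m by simp
    have "summable (\<lambda>m. 2 * r ^ m)" using r by (intro summable_mult summable_geometric) simp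
    then have "summable (\<lambda>m. prob (A m))" by (rule summable_comparison_test') (rule le)
    then have "AE x in M. eventually (\<lambda>m. x \<in> space M - A m) sequentially"
      by (intro borel_cantelli_AE1) (auto simp: emeasure_eq_measure)
    then show ?thesis
    proof eventually_elim
      case (elim x)
      then show ?case by eventually_elim (auto simp: A_def not_le)
    qed
  qed
  then have "AE x in M. \<forall>k. eventually (\<lambda>m. \<bar>(\<Sum>i<m. Y i x) / real m - ?\<mu>\<bar> < inverse (real (Suc k))) sequentially"
    by (subst AE_all_countable) simp
  then show ?thesis
  proof eventually_elim
    case (elim x)
    show ?case
    proof (rule tendstoI)
      fix e :: real assume "0 < e"
      then obtain k where "inverse (real (Suc k)) < e" using reals_Archimedean by blast
      with elim[rule_format, of k]
      show "eventually (\<lambda>m. dist ((\<Sum>i<m. Y i x) / real m) ?\<mu> < e) sequentially"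
        by (auto simp: dist_real_def elim: eventually_mono)
    qed
  qed
qed

text \<open>Polya's argument: between neighbouring grid points monotonicity traps \<open>F m\<close>
  between its values there, and the mesh is chosen so that the limit moves by less than \<epsilon>/2
  over one cell. Continuity is asked of the limit only.\<close>

lemma monotone_uniform_convergence:
  fixes F :: "nat \<Rightarrow> real \<Rightarrow> real"
  assumes "a < b" and mono: "\<And>m. mono_on {a..b} (F m)" and \<phi>: "continuous_on {a..b} \<phi>"
    and conv: "\<And>K k. k \<le> K \<Longrightarrow> (\<lambda>m. F m (a + (b - a) * real k / real K)) \<longlonglongrightarrow> \<phi> (a + (b - a) * real k / real K)"
    and "0 < \<epsilon>"
  shows "\<exists>m0. \<forall>m\<ge>m0. \<forall>x\<in>{a..b}. \<bar>F m x - \<phi> x\<bar> < \<epsilon>"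
proof -
  have "uniformly_continuous_on {a..b} \<phi>" by (rule compact_uniformly_continuous[OF \<phi>]) simp
  then obtain d where d: "0 < d" "\<And>x y. x \<in> {a..b} \<Longrightarrow> y \<in> {a..b} \<Longrightarrow> \<bar>x - y\<bar> < d \<Longrightarrow> \<bar>\<phi> x - \<phi> y\<bar> < \<epsilon>/2"
    using \<open>0 < \<epsilon>\<close> unfolding uniformly_continuous_on_def dist_real_def by (metis half_gt_zero abs_minus_commute)
  obtain K :: nat where K: "(b - a) / d < real K" using reals_Archimedean2 by blast
  have "0 < (b - a) / d" using \<open>a < b\<close> d(1) by simp
  then have Kpos: "0 < real K" using K by linarith
  have mesh: "(b - a) / real K < d" using K d(1) Kpos by (simp add: field_simps)
  define p where "p k = a + (b - a) * real k / real K" for k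
  have p_in: "p k \<in> {a..b}" if "k \<le> K" for k
  proof -
    have "(b - a) * (real k / real K) \<le> (b - a) * 1"
      using that Kpos \<open>a < b\<close> by (intro mult_left_mono) auto
    then show ?thesis using \<open>a < b\<close> by (simp add: p_def)
  qed
  have p_Suc: "p (Suc k) = p k + (b - a) / real K" for k by (simp add: p_def add_divide_distrib distrib_left)
  have "eventually (\<lambda>m. \<forall>k\<in>{..K}. \<bar>F m (p k) - \<phi> (p k)\<bar> < \<epsilon>/2) sequentially"
  proof (rule eventually_ball_finite)
    show "\<forall>k\<in>{..K}. eventually (\<lambda>m. \<bar>F m (p k) - \<phi> (p k)\<bar> < \<epsilon>/2) sequentially"
      using tendstoD[OF conv, of _ K "\<epsilon>/2"] \<open>0 < \<epsilon>\<close> by (simp add: p_def dist_real_def)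
  qed simp
  then obtain m0 where m0: "\<And>m k. m \<ge> m0 \<Longrightarrow> k \<le> K \<Longrightarrow> \<bar>F m (p k) - \<phi> (p k)\<bar> < \<epsilon>/2"
    unfolding eventually_sequentially by auto
  have "\<bar>F m x - \<phi> x\<bar> < \<epsilon>" if m: "m \<ge> m0" and x: "x \<in> {a..b}" for m x
  proof -
    define k where "k = nat \<lfloor>real K * (x - a) / (b - a)\<rfloor>"
    have q0: "0 \<le> real K * (x - a) / (b - a)" using x \<open>a < b\<close> by simp
    then have k: "real k \<le> real K * (x - a) / (b - a)" "real K * (x - a) / (b - a) < real k + 1"
      by (auto simp: k_def)
    have pk: "p k \<le> x" using k(1) \<open>a < b\<close> Kpos by (simp add: p_def field_simps)
    have pSk: "x < p (Suc k)" using k(2) \<open>a < b\<close> Kpos by (simp add: p_def field_simps)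
    have "real K * ((x - a) / (b - a)) \<le> real K * 1" using x \<open>a < b\<close> by (intro mult_left_mono) auto
    then have kK: "k \<le> K" using k(1) by simp
    have lo: "F m (p k) \<le> F m x" using mono p_in[OF kK] x pk by (auto simp: mono_on_def)
    have "\<bar>\<phi> (p k) - \<phi> x\<bar> < \<epsilon>/2" using d(2)[OF p_in[OF kK] x] pk pSk p_Suc mesh by auto
    then have lower: "\<phi> x - \<epsilon> < F m x" using m0[OF m kK] lo by linarith
    have "F m x < \<phi> x + \<epsilon>"
    \<comment> \<open>Only x = b falls into the last index, which has no right neighbour.\<close>
    proof (cases "k = K")
      case True
      then have "x = p k" using pk x Kpos by (simp add: p_def)
      then show ?thesis using m0[OF m kK] \<open>0 < \<epsilon>\<close> unfolding \<open>x = p k\<close> by linarith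
    next
      case False
      then have SkK: "Suc k \<le> K" using kK by simp
      have "F m x \<le> F m (p (Suc k))" using mono p_in[OF SkK] x pSk by (auto simp: mono_on_def)
      moreover have "\<bar>\<phi> (p (Suc k)) - \<phi> x\<bar> < \<epsilon>/2" using d(2)[OF p_in[OF SkK] x] pk pSk p_Suc mesh by auto
      ultimately show ?thesis using m0[OF m SkK] by linarith
    qed
    with lower show ?thesis by linarith
  qed
  then show ?thesis by blast
qed

text \<open>If the chosen time were more than one mesh width from \<open>g x\<close>, the
  neighbouring time towards \<open>g x\<close> would lie strictly between the two. As f composed
  with the inverse of \<open>g\<close> is strictly increasing, the observation there would be
  strictly closer to \<open>f x\<close>. The bound thus involves neither a modulus of continuity nor
  the tie-breaking rule.\<close>

lemma nearest_observation:
  fixes f g :: "real \<Rightarrow> real"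
  assumes "a < b" and g: "continuous_on {a..b} g" "strict_mono_on {a..b} g" "g a = a" "g b = b"
    and f: "strict_mono_on {a..b} f" and x: "x \<in> {a..b}" and n: "1 < n"
    and j: "is_arg_min (\<lambda>j. \<bar>f (inv_into {a..b} g (obs_time a b n j)) - f x\<bar>) (\<lambda>j. j \<in> {1..n}) j"
  shows "\<bar>obs_time a b n j - g x\<bar> \<le> (b - a) / (real n - 1)"
proof (rule ccontr)
  let ?t = "obs_time a b n" and ?h = "inv_into {a..b} g" and ?\<delta> = "(b - a) / (real n - 1)"
  assume far: "\<not> \<bar>?t j - g x\<bar> \<le> ?\<delta>"
  have \<delta>: "0 < ?\<delta>" using \<open>a < b\<close> n by simp
  have j1: "j \<in> {1..n}" and jmin: "\<And>i. i \<in> {1..n} \<Longrightarrow> \<not> \<bar>f (?h (?t i)) - f x\<bar> < \<bar>f (?h (?t j)) - f x\<bar>"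
    using j unfolding is_arg_min_def by auto
  have tS: "?t (Suc i) = ?t i + ?\<delta>" for i
    unfolding obs_time_def of_nat_Suc by (simp only: left_diff_distrib distrib_right mult_1)
  have t1: "?t 1 = a" and tn: "?t n = b" using n by (auto simp: obs_time_def)
  have t_mono: "?t i \<le> ?t k" if "i \<le> k" for i k
    unfolding obs_time_def using that \<delta> by (intro add_left_mono mult_right_mono) auto
  have t_in: "?t i \<in> {a..b}" if "i \<in> {1..n}" for i
    using t_mono[of 1 i] t_mono[of i n] that t1 tn by auto
  have surj: "z \<in> g ` {a..b}" if "z \<in> {a..b}" for z
    using IVT'[of g a z b] that g \<open>a < b\<close> by auto
  have h: "?h z \<in> {a..b}" "g (?h z) = z" if "z \<in> {a..b}" for z
    by (rule inv_into_into[OF surj[OF that]], rule f_inv_into_f[OF surj[OF that]])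
  have g_less: "g y < g z \<longleftrightarrow> y < z" if "y \<in> {a..b}" "z \<in> {a..b}" for y z
    using strict_mono_on_less[OF g(2) that] .
  have gx: "g x \<in> {a..b}"
    using strict_mono_on_leD[OF g(2), of a x] strict_mono_on_leD[OF g(2), of x b] x g(3,4) by auto
  have f_less: "f y < f z" if "y \<in> {a..b}" "z \<in> {a..b}" "y < z" for y z
    using strict_mono_onD[OF f that] .
  consider "?t j > g x + ?\<delta>" | "?t j < g x - ?\<delta>" using far by linarith
  then show False
  proof cases
    case 1
    then have "j \<noteq> 1" using t1 gx \<delta> by auto
    then obtain i where i: "j = Suc i" "i \<in> {1..n}" using j1 by (cases j) auto
    then have less: "g x < ?t i" "?t i < ?t j" using 1 tS[of i] \<delta> by auto
    have "x < ?h (?t i)" using g_less[OF x h(1)[OF t_in[OF i(2)]]] h(2)[OF t_in[OF i(2)]] less by simp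
    moreover have "?h (?t i) < ?h (?t j)"
      using g_less[OF h(1)[OF t_in[OF i(2)]] h(1)[OF t_in[OF j1]]] h(2)[OF t_in[OF i(2)]] h(2)[OF t_in[OF j1]] less by simp
    ultimately have "f x < f (?h (?t i))" "f (?h (?t i)) < f (?h (?t j))"
      using f_less x h(1)[OF t_in[OF i(2)]] h(1)[OF t_in[OF j1]] by auto
    then show False using jmin[OF i(2)] by auto
  next
    case 2
    then have "j \<noteq> n" using tn gx \<delta> by auto
    then have i: "Suc j \<in> {1..n}" using j1 by auto
    have less: "?t (Suc j) < g x" "?t j < ?t (Suc j)" using 2 tS[of j] \<delta> by auto
    have "?h (?t (Suc j)) < x" using g_less[OF h(1)[OF t_in[OF i]] x] h(2)[OF t_in[OF i]] less by simp
    moreover have "?h (?t j) < ?h (?t (Suc j))"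
      using g_less[OF h(1)[OF t_in[OF j1]] h(1)[OF t_in[OF i]]] h(2)[OF t_in[OF i]] h(2)[OF t_in[OF j1]] less by simp
    ultimately have "f (?h (?t (Suc j))) < f x" "f (?h (?t j)) < f (?h (?t (Suc j)))"
      using f_less x h(1)[OF t_in[OF i]] h(1)[OF t_in[OF j1]] by auto
    then show False using jmin[OF i] by auto
  qed
qed

lemma evaluation_borel:
  assumes "t \<in> {a..b}"
  shows "(\<lambda>x. x t) \<in> borel_measurable (metric_borel (cont_space a b))"
proof (rule continuous_map_metric_borel)
  let ?D = "cont_space a b"
  interpret D: Metric_space "mspace ?D" "mdist ?D" by (rule Metric_space_mspace_mdist)
  have "\<bar>x t - y t\<bar> \<le> mdist ?D x y" if "x \<in> mspace ?D" "y \<in> mspace ?D" for x y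
    using cfunspace_mdist_le[OF that, of "mdist ?D x y"] assms by (auto simp: dist_real_def)
  then show "continuous_map (mtopology_of ?D) euclideanreal (\<lambda>x. x t)"
    unfolding mtopology_of_def
    using D.metric_continuous_map[OF Met_TC.Metric_space_axioms, of "\<lambda>x. x t :: real"]
    by (simp only: mtopology_is_euclidean subset_UNIV simp_thms dist_real_def)
       (meson le_less_trans)
qed

section \<open>The observation model: warpings, their mean and the estimator\<close>

locale curve_registration =
  fixes M :: "'w measure" and P :: "'v measure" and a b :: real
    and H :: "'w \<Rightarrow> real \<Rightarrow> real" and h :: "nat \<Rightarrow> 'v \<Rightarrow> real \<Rightarrow> real"
    and f :: "real \<Rightarrow> real" and J :: "nat \<Rightarrow> nat \<Rightarrow> real \<Rightarrow> 'v \<Rightarrow> nat"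
  assumes a_less_b: "a < b"
    and M: "prob_space M" and P: "prob_space P"
    and warping: "warping_process M a b H"
    and iid: "iid_realizations P a b h M H"
    and f_cont: "continuous_on {a..b} f" and f_mono: "strict_mono_on {a..b} f"
    and selection: "nearest_selection P a b f h J"
begin

sublocale M: prob_space M by (rule M)
sublocale P: prob_space P by (rule P)

abbreviation "\<C> \<equiv> metric_borel (cont_space a b)"
abbreviation "\<phi> \<equiv> mean_fun M H"
abbreviation "finv \<equiv> inv_into {a..b} f"

lemma H_measurable [measurable]: "H \<in> measurable M \<C>"
  using warping unfolding warping_process_def by simp

lemma h_measurable: "h (Suc i) \<in> measurable P \<C>"
  using iid unfolding iid_realizations_def P.indep_vars_def2 by auto

lemma H_distr: "distr P \<C> (h (Suc i)) = distr M \<C> H"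
  using iid unfolding iid_realizations_def by simp

text \<open>Real functionals of the realizations inherit independence and a common law. The shift
  \<open>Suc\<close> aligns the realizations, numbered from 1, with sums over i < m.\<close>

lemma functional_iid:
  assumes "F \<in> borel_measurable \<C>"
  shows "P.indep_vars (\<lambda>_. borel) (\<lambda>i \<omega>. F (h (Suc i) \<omega>)) UNIV"
    "distr P borel (\<lambda>\<omega>. F (h (Suc i) \<omega>)) = distr M borel (\<lambda>w. F (H w))"
proof -
  have "range Suc = {1..}" by (auto simp: image_iff Suc_le_eq gr0_conv_Suc)
  then have "P.indep_vars (\<lambda>_. \<C>) h (range Suc)" using iid unfolding iid_realizations_def by simp
  then have "P.indep_vars (\<lambda>_. \<C>) (\<lambda>i. h (Suc i)) UNIV"
    by (intro P.indep_vars_reindex_inj[where N = "\<lambda>_. \<C>" and f = Suc]) auto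
  then show "P.indep_vars (\<lambda>_. borel) (\<lambda>i \<omega>. F (h (Suc i) \<omega>)) UNIV"
    by (rule P.indep_vars_compose2) (rule assms)
  have "distr P borel (\<lambda>\<omega>. F (h (Suc i) \<omega>)) = distr (distr P \<C> (h (Suc i))) borel F"
    using distr_distr[OF assms h_measurable[of i]] by (simp add: o_def)
  also have "\<dots> = distr M borel (\<lambda>w. F (H w))"
    unfolding H_distr using distr_distr[OF assms H_measurable] by (simp add: o_def)
  finally show "distr P borel (\<lambda>\<omega>. F (h (Suc i) \<omega>)) = distr M borel (\<lambda>w. F (H w))" .
qed

lemma continuous_paths:
  assumes "x \<in> mspace (cont_space a b)" shows "continuous_on {a..b} x"
  using assms by simp

lemma H_continuous: "w \<in> space M \<Longrightarrow> continuous_on {a..b} (H w)"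
  by (rule continuous_paths) (rule measurable_space[OF H_measurable, unfolded space_metric_borel])

lemma h_continuous: "\<omega> \<in> space P \<Longrightarrow> continuous_on {a..b} (h (Suc i) \<omega>)"
  by (rule continuous_paths) (rule measurable_space[OF h_measurable, unfolded space_metric_borel])

lemma H_eval_measurable: "t \<in> {a..b} \<Longrightarrow> (\<lambda>w. H w t) \<in> borel_measurable M"
  using measurable_comp[OF H_measurable evaluation_borel] by (simp add: o_def)

definition warpings :: "(real \<Rightarrow> real) set" where
  "warpings = {x \<in> mspace (cont_space a b). strict_mono_on {a..b} x \<and> x a = a \<and> x b = b}"

text \<open>Passing to the limit gives only weak inequalities at irrational points; strictness is
  recovered by placing two rationals in between: x s \<le> x q < x r \<le> x t.\<close>

lemma strict_mono_on_rationals: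
  assumes x: "continuous_on {a..b} x"
    and mono: "\<And>q r. q \<in> \<rat> \<inter> {a..b} \<Longrightarrow> r \<in> \<rat> \<inter> {a..b} \<Longrightarrow> q < r \<Longrightarrow> x q < x r"
  shows "strict_mono_on {a..b} (x :: real \<Rightarrow> real)"
proof (rule strict_mono_onI)
  fix s t assume s: "s \<in> {a..b}" and t: "t \<in> {a..b}" and "s < t"
  obtain q where q: "q \<in> \<rat>" "s < q" "q < t" using Rats_dense_in_real[OF \<open>s < t\<close>] by blast
  obtain r where r: "r \<in> \<rat>" "q < r" "r < t" using Rats_dense_in_real[OF \<open>q < t\<close>] by blast
  have qr: "q \<in> \<rat> \<inter> {a..b}" "r \<in> \<rat> \<inter> {a..b}" using q r s t by auto
  have "x s \<le> x q"
  proof (rule ccontr)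
    assume "\<not> x s \<le> x q"
    then obtain d where d: "d > 0" "\<And>y. y \<in> {a..b} \<Longrightarrow> dist y s < d \<Longrightarrow> dist (x y) (x s) < x s - x q"
      using x[unfolded continuous_on_iff, rule_format, of s "x s - x q"] s by auto
    obtain p where p: "p \<in> \<rat>" "s < p" "p < min q (s + d)"
      using Rats_dense_in_real[of s "min q (s + d)"] q d(1) by auto
    then have "x p < x q" using mono[of p q] qr s by auto
    moreover have "dist (x p) (x s) < x s - x q" using p s qr by (intro d(2)) (auto simp: dist_real_def)
    ultimately show False unfolding dist_real_def by linarith
  qed
  moreover have "x r \<le> x t"
  proof (rule ccontr)
    assume "\<not> x r \<le> x t"
    then obtain d where d: "d > 0" "\<And>y. y \<in> {a..b} \<Longrightarrow> dist y t < d \<Longrightarrow> dist (x y) (x t) < x r - x t"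
      using x[unfolded continuous_on_iff, rule_format, of t "x r - x t"] t by auto
    obtain p where p: "p \<in> \<rat>" "max r (t - d) < p" "p < t"
      using Rats_dense_in_real[of "max r (t - d)" t] r d(1) by auto
    then have "x r < x p" using mono[of r p] qr t by auto
    moreover have "dist (x p) (x t) < x r - x t" using p t qr by (intro d(2)) (auto simp: dist_real_def)
    ultimately show False unfolding dist_real_def by linarith
  qed
  moreover have "x q < x r" using mono[OF qr] r by simp
  ultimately show "x s < x t" by linarith
qed

text \<open>Measurability lets the almost sure shape of \<open>H\<close> pass to the realizations,
  since equality of laws speaks about measurable sets. Rational pairs reduce strict monotonicity to
  countably many evaluations.\<close>

lemma warpings_sets: "warpings \<in> sets \<C>"
proof -
  have ev: "(\<lambda>x. x t) \<in> borel_measurable \<C>" if "t \<in> {a..b}" for t by (rule evaluation_borel[OF that])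
  let ?R = "{(q, r). q \<in> \<rat> \<inter> {a..b} \<and> r \<in> \<rat> \<inter> {a..b} \<and> q < r}"
  have eq: "warpings = {x \<in> space \<C>. x a = a} \<inter> {x \<in> space \<C>. x b = b} \<inter>
    {x \<in> space \<C>. \<forall>(q, r)\<in>?R. x q < x r}"
  proof (intro set_eqI iffI)
    fix x assume x: "x \<in> {x \<in> space \<C>. x a = a} \<inter> {x \<in> space \<C>. x b = b} \<inter>
      {x \<in> space \<C>. \<forall>(q, r)\<in>?R. x q < x r}"
    then have x': "x \<in> mspace (cont_space a b)" "x a = a" "x b = b" unfolding space_metric_borel by blast+
    moreover have "strict_mono_on {a..b} x"
      using continuous_paths[OF x'(1)] by (rule strict_mono_on_rationals) (use x in blast)
    ultimately show "x \<in> warpings" unfolding warpings_def by blast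
  next
    fix x assume "x \<in> warpings"
    then have x: "x \<in> mspace (cont_space a b)" "strict_mono_on {a..b} x" "x a = a" "x b = b"
      unfolding warpings_def by blast+
    have "\<forall>(q, r)\<in>?R. x q < x r" using strict_mono_onD[OF x(2)] by blast
    with x show "x \<in> {x \<in> space \<C>. x a = a} \<inter> {x \<in> space \<C>. x b = b} \<inter>
      {x \<in> space \<C>. \<forall>(q, r)\<in>?R. x q < x r}" unfolding space_metric_borel by blast
  qed
  have "countable ?R"
    by (rule countable_subset[of _ "\<rat> \<times> \<rat>"]) (auto intro: countable_rat)
  then have "{x \<in> space \<C>. \<forall>(q, r)\<in>?R. x q < x r} \<in> sets \<C>"
  proof (rule sets.sets_Collect_countable_All'[rotated])
    fix p assume "p \<in> ?R"
    then obtain q r where p: "p = (q, r)" "q \<in> {a..b}" "r \<in> {a..b}" by blast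
    show "{x \<in> space \<C>. case p of (q, r) \<Rightarrow> x q < x r} \<in> sets \<C>"
      unfolding p(1) prod.case by (intro borel_measurable_less ev p)
  qed
  moreover have "{x \<in> space \<C>. x a = a} \<in> sets \<C>" "{x \<in> space \<C>. x b = b} \<in> sets \<C>"
    using a_less_b by (intro borel_measurable_eq ev measurable_const; simp)+
  ultimately show ?thesis unfolding eq by auto
qed

lemma H_warping: "AE w in M. H w \<in> warpings"
proof -
  have "AE w in M. H w \<in> mspace (cont_space a b)"
    by (rule AE_I2) (use measurable_space[OF H_measurable] in \<open>simp only: space_metric_borel\<close>)
  then show ?thesis using warping unfolding warping_process_def warpings_def by auto
qed

lemma h_warping: "AE \<omega> in P. \<forall>i. h (Suc i) \<omega> \<in> warpings"
proof -
  have S: "{x \<in> space \<C>. x \<in> warpings} \<in> sets \<C>"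
    using warpings_sets sets.sets_into_space[OF warpings_sets] by (simp add: Int_absorb1 Collect_conj_eq)
  have "AE \<omega> in P. h (Suc i) \<omega> \<in> warpings" for i
  proof -
    have "AE x in distr M \<C> H. x \<in> warpings" using H_warping AE_distr_iff[OF H_measurable S] by blast
    then have "AE x in distr P \<C> (h (Suc i)). x \<in> warpings" by (subst H_distr)
    then show ?thesis using AE_distr_iff[OF h_measurable S, of i] by blast
  qed
  then show ?thesis by (simp add: AE_all_countable)
qed

lemma warpings_range: "x \<in> warpings \<Longrightarrow> t \<in> {a..b} \<Longrightarrow> x t \<in> {a..b}"
  using strict_mono_on_leD[of "{a..b}" x a t] strict_mono_on_leD[of "{a..b}" x t b]
  unfolding warpings_def by auto

lemma H_range: "t \<in> {a..b} \<Longrightarrow> AE w in M. H w t \<in> {a..b}"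
  using H_warping by eventually_elim (rule warpings_range)

lemma mean_range: "t \<in> {a..b} \<Longrightarrow> \<phi> t \<in> {a..b}"
proof -
  assume t: "t \<in> {a..b}"
  have "integrable M (\<lambda>w. H w t)"
    by (rule M.integrable_const_bound[of _ "\<bar>a\<bar> + \<bar>b\<bar>"]) (use H_range[OF t] H_eval_measurable[OF t] in auto)
  then have "a \<le> \<phi> t" "\<phi> t \<le> b" unfolding mean_fun_def
    using H_range[OF t] by (intro M.integral_ge_const M.integral_le_const; auto)+
  then show "\<phi> t \<in> {a..b}" by simp
qed

lemma mean_continuous: "continuous_on {a..b} \<phi>"
  unfolding continuous_on_sequentially
proof (intro allI ballI impI)
  fix s :: "nat \<Rightarrow> real" and t assume t: "t \<in> {a..b}" and s: "(\<forall>n. s n \<in> {a..b}) \<and> s \<longlonglongrightarrow> t"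
  then have s: "s n \<in> {a..b}" "s \<longlonglongrightarrow> t" for n by auto
  have "(\<lambda>n. \<integral>w. H w (s n) \<partial>M) \<longlonglongrightarrow> (\<integral>w. H w t \<partial>M)"
  proof (rule integral_dominated_convergence[where w = "\<lambda>_. \<bar>a\<bar> + \<bar>b\<bar>"])
    show "AE w in M. (\<lambda>n. H w (s n)) \<longlonglongrightarrow> H w t"
      by (rule AE_I2, rule continuous_on_tendsto_compose[OF H_continuous s(2) t]) (use s in auto)
    show "AE w in M. norm (H w (s n)) \<le> \<bar>a\<bar> + \<bar>b\<bar>" for n
      using H_range[OF s(1)[of n]] by eventually_elim auto
  qed (use H_eval_measurable t s in auto)
  then show "(\<phi> \<circ> s) \<longlonglongrightarrow> \<phi> t" by (simp add: mean_fun_def o_def)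
qed

lemma finv: "y \<in> {f a..f b} \<Longrightarrow> finv y \<in> {a..b}" "y \<in> {f a..f b} \<Longrightarrow> f (finv y) = y"
proof -
  assume "y \<in> {f a..f b}"
  then have "y \<in> f ` {a..b}" using IVT'[of f a y b] a_less_b f_cont by auto
  then show "finv y \<in> {a..b}" "f (finv y) = y" by (rule inv_into_into, rule f_inv_into_f)
qed

lemma f_range_nonempty: "{f a..f b} \<noteq> {}"
  using strict_mono_onD[OF f_mono, of a b] a_less_b by simp

text \<open>An average of observation times stays in the interval, for every outcome, even one whose
  path is no warping. This makes the rescaled estimator a bounded function in cases where
  \<open>estimator_close\<close> does not apply.\<close>

lemma estimator_bounded:
  assumes "1 \<le> n" "y \<in> {f a..f b}" "\<omega> \<in> space P" "1 \<le> m"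
  shows "estimator a b J m n \<omega> y \<in> {a..b}"
proof -
  have t: "obs_time a b n (J n i y \<omega>) \<in> {a..b}" if "1 \<le> i" for i
  proof -
    have j: "J n i y \<omega> \<in> {1..n}"
      using selection assms that unfolding nearest_selection_def is_arg_min_def by blast
    show ?thesis
    \<comment> \<open>For n = 1 the mesh is a division by zero, hence 0, and the only time is
      \<open>a\<close>.\<close>
    proof (cases "n = 1")
      case True
      then show ?thesis using a_less_b by (simp add: obs_time_def)
    next
      case False
      have "(real (J n i y \<omega>) - 1) / (real n - 1) * (b - a) \<le> 1 * (b - a)"
        using j False a_less_b by (intro mult_right_mono) (auto simp: divide_le_eq)
      then have "(real (J n i y \<omega>) - 1) * ((b - a) / (real n - 1)) \<le> b - a" by simp
      moreover have "0 \<le> (real (J n i y \<omega>) - 1) * ((b - a) / (real n - 1))"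
        using j a_less_b False by (intro mult_nonneg_nonneg) auto
      ultimately show ?thesis unfolding obs_time_def by simp
    qed
  qed
  have "(\<Sum>i = 1..m. obs_time a b n (J n i y \<omega>)) \<le> real (card {1..m}) * b"
    by (rule sum_bounded_above) (use t in auto)
  moreover have "real (card {1..m}) * a \<le> (\<Sum>i = 1..m. obs_time a b n (J n i y \<omega>))"
    by (rule sum_bounded_below) (use t in auto)
  ultimately show ?thesis using \<open>1 \<le> m\<close> by (simp add: estimator_def field_simps)
qed

text \<open>The error is that of a single nearest observation: it is uniform in \<open>y\<close>,
  deterministic once the paths are warpings, and not enlarged by averaging.\<close>

lemma estimator_close:
  assumes \<omega>: "\<omega> \<in> space P" "\<And>i. h (Suc i) \<omega> \<in> warpings" and y: "y \<in> {f a..f b}"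
    and n: "1 < n" and m: "1 \<le> m"
  shows "\<bar>estimator a b J m n \<omega> y - (\<Sum>i<m. h (Suc i) \<omega> (finv y)) / real m\<bar> \<le> (b - a) / (real n - 1)"
proof -
  have "\<bar>obs_time a b n (J n (Suc i) y \<omega>) - h (Suc i) \<omega> (finv y)\<bar> \<le> (b - a) / (real n - 1)" for i
  proof (rule nearest_observation[OF a_less_b _ _ _ _ f_mono finv(1)[OF y] n])
    show "is_arg_min (\<lambda>j. \<bar>f (inv_into {a..b} (h (Suc i) \<omega>) (obs_time a b n j)) - f (finv y)\<bar>)
        (\<lambda>j. j \<in> {1..n}) (J n (Suc i) y \<omega>)"
      using selection n y \<omega>(1) unfolding nearest_selection_def observation_def finv(2)[OF y] by simp
  qed (use \<omega>(2)[of i] continuous_paths in \<open>unfold warpings_def, blast\<close>)+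
  then have "(\<Sum>i<m. \<bar>obs_time a b n (J n (Suc i) y \<omega>) - h (Suc i) \<omega> (finv y)\<bar>)
      \<le> real (card {..<m}) * ((b - a) / (real n - 1))"
    by (intro sum_bounded_above) auto
  then have "\<bar>\<Sum>i<m. obs_time a b n (J n (Suc i) y \<omega>) - h (Suc i) \<omega> (finv y)\<bar> \<le> real m * ((b - a) / (real n - 1))"
    unfolding card_lessThan by (rule order_trans[OF sum_abs])
  then have "\<bar>\<Sum>i<m. obs_time a b n (J n (Suc i) y \<omega>) - h (Suc i) \<omega> (finv y)\<bar> / real m \<le> (b - a) / (real n - 1)"
    using m by (simp add: divide_le_eq mult.commute)
  moreover have "estimator a b J m n \<omega> y - (\<Sum>i<m. h (Suc i) \<omega> (finv y)) / real m =
      (\<Sum>i<m. obs_time a b n (J n (Suc i) y \<omega>) - h (Suc i) \<omega> (finv y)) / real m"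
    unfolding estimator_def using sum.atLeast1_atMost_eq[of "\<lambda>i. obs_time a b n (J n i y \<omega>)" m]
    by (simp add: sum_subtractf diff_divide_distrib)
  ultimately show ?thesis by simp
qed

lemma strong_law_paths:
  "AE \<omega> in P. \<forall>\<epsilon>>0. \<exists>m0. \<forall>m\<ge>m0. \<forall>x\<in>{a..b}. \<bar>(\<Sum>i<m. h (Suc i) \<omega> x) / real m - \<phi> x\<bar> < \<epsilon>"
proof -
  let ?p = "\<lambda>K k::nat. a + (b - a) * real k / real K"
  have p_in: "?p K k \<in> {a..b}" if "k \<le> K" for K k
  proof -
    have "(b - a) * (real k / real K) \<le> (b - a) * 1"
      using that a_less_b by (intro mult_left_mono) (auto simp: divide_le_eq)
    then show ?thesis using a_less_b by simp
  qed
  have law: "AE \<omega> in P. (\<lambda>m. (\<Sum>i<m. h (Suc i) \<omega> t) / real m) \<longlonglongrightarrow> \<phi> t" if t: "t \<in> {a..b}" for t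
  proof -
    note iid_t = functional_iid[OF evaluation_borel[OF t]]
    have "AE \<omega> in P. h (Suc 0) \<omega> t \<in> {a..b}" using h_warping by eventually_elim (use warpings_range t in blast)
    then have "AE \<omega> in P. (\<lambda>m. (\<Sum>i<m. h (Suc i) \<omega> t) / real m) \<longlonglongrightarrow> P.expectation (\<lambda>\<omega>. h (Suc 0) \<omega> t)"
      using a_less_b by (intro P.bounded_strong_law iid_t(1)) (simp_all add: iid_t(2))
    moreover have "P.expectation (\<lambda>\<omega>. h (Suc 0) \<omega> t) = \<phi> t"
    proof -
      have m: "(\<lambda>\<omega>. h (Suc 0) \<omega> t) \<in> borel_measurable P"
        using measurable_comp[OF h_measurable evaluation_borel[OF t]] by (simp add: o_def)
      have "P.expectation (\<lambda>\<omega>. h (Suc 0) \<omega> t) = (\<integral>x. x \<partial>distr P borel (\<lambda>\<omega>. h (Suc 0) \<omega> t))"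
        using m by (subst integral_distr) auto
      also have "\<dots> = \<phi> t"
        unfolding iid_t(2) mean_fun_def using H_eval_measurable[OF t] by (subst integral_distr) auto
      finally show ?thesis .
    qed
    ultimately show ?thesis by simp
  qed
  \<comment> \<open>Countably many grid points leave a single null set. For K = 0 the only point is
    \<open>a\<close>.\<close>
  have "AE \<omega> in P. \<forall>K k. k \<le> K \<longrightarrow> (\<lambda>m. (\<Sum>i<m. h (Suc i) \<omega> (?p K k)) / real m) \<longlonglongrightarrow> \<phi> (?p K k)"
    unfolding AE_all_countable using law p_in by (auto intro!: AE_impI)
  with h_warping show ?thesis
  proof eventually_elim
    case (elim \<omega>)
    show ?case
    proof (intro allI impI, rule monotone_uniform_convergence[OF a_less_b _ mean_continuous])
      show "mono_on {a..b} (\<lambda>x. (\<Sum>i<m. h (Suc i) \<omega> x) / real m)" for m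
      proof (rule mono_onI)
        fix r s assume "r \<in> {a..b}" "s \<in> {a..b}" "r \<le> s"
        then have "h (Suc i) \<omega> r \<le> h (Suc i) \<omega> s" for i
          using elim(1) strict_mono_on_leD unfolding warpings_def by blast
        then show "(\<Sum>i<m. h (Suc i) \<omega> r) / real m \<le> (\<Sum>i<m. h (Suc i) \<omega> s) / real m"
          by (intro divide_right_mono sum_mono) auto
      qed
    qed (use elim(2) in auto)
  qed
qed

text \<open>The mesh and the strong law contribute less than \<epsilon>/4 each, one through
  \<open>n\<close> and the other through \<open>m\<close>, so the two indices may grow without any
  relation. The bound \<epsilon>/2 leaves room for the supremum, which preserves only weak
  inequalities.\<close>

lemma uniform_consistency:
  "AE \<omega> in P. \<forall>\<epsilon>>0. \<exists>m0 n0. \<forall>m>m0. \<forall>n>n0.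
     \<bar>(SUP y\<in>{f a..f b}. \<bar>estimator a b J m n \<omega> y - struct_exp_inv M H a b f y\<bar>) - 0\<bar> < \<epsilon>"
  using strong_law_paths h_warping AE_space
proof eventually_elim
  case (elim \<omega>)
  show ?case
  proof (intro allI impI)
    fix \<epsilon> :: real assume "0 < \<epsilon>"
    then have "\<exists>m0. \<forall>m\<ge>m0. \<forall>x\<in>{a..b}. \<bar>(\<Sum>i<m. h (Suc i) \<omega> x) / real m - \<phi> x\<bar> < \<epsilon>/4"
      using elim(1)[THEN spec, of "\<epsilon>/4"] by simp
    then obtain m0 where m0: "\<And>m x. m \<ge> m0 \<Longrightarrow> x \<in> {a..b} \<Longrightarrow>
        \<bar>(\<Sum>i<m. h (Suc i) \<omega> x) / real m - \<phi> x\<bar> < \<epsilon>/4"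
      by blast
    obtain n0 :: nat where n0: "1 + (b - a) / (\<epsilon>/4) < real n0" using reals_Archimedean2 by blast
    show "\<exists>m0 n0. \<forall>m>m0. \<forall>n>n0.
     \<bar>(SUP y\<in>{f a..f b}. \<bar>estimator a b J m n \<omega> y - struct_exp_inv M H a b f y\<bar>) - 0\<bar> < \<epsilon>"
    proof (intro exI allI impI)
      fix m n assume m: "max 1 m0 < m" and n: "n0 < n"
      have pos: "0 < (b - a) / (\<epsilon>/4)" using a_less_b \<open>0 < \<epsilon>\<close> by simp
      have "real n0 < real n" using n by simp
      then have n1: "1 < n" "(b - a) / (\<epsilon>/4) < real n - 1" using n0 pos by linarith+
      have mesh: "(b - a) / (real n - 1) < \<epsilon>/4"
        using n1 \<open>0 < \<epsilon>\<close> by (simp add: field_simps)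
      define e where "e y = \<bar>estimator a b J m n \<omega> y - struct_exp_inv M H a b f y\<bar>" for y
      have bound: "0 \<le> e y" "e y \<le> \<epsilon>/2" if y: "y \<in> {f a..f b}" for y
      proof -
        have "1 \<le> m" "m0 \<le> m" using m by auto
        then show "0 \<le> e y" "e y \<le> \<epsilon>/2"
          using estimator_close[OF elim(3) elim(2)[rule_format] y n1(1), of m]
            m0[of m, OF _ finv(1)[OF y]] mesh unfolding e_def struct_exp_inv_def o_def
          by linarith+
      qed
      have "(SUP y\<in>{f a..f b}. e y) \<le> \<epsilon>/2" using bound f_range_nonempty by (intro cSUP_least) auto
      moreover have "bdd_above (e ` {f a..f b})" using bound by (intro bdd_aboveI2[of _ _ "\<epsilon>/2"])
      then have "0 \<le> (SUP y\<in>{f a..f b}. e y)"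
        using bound f_range_nonempty by (meson cSUP_upper2 ex_in_conv)
      ultimately show "\<bar>(SUP y\<in>{f a..f b}. \<bar>estimator a b J m n \<omega> y - struct_exp_inv M H a b f y\<bar>) - 0\<bar> < \<epsilon>"
        using \<open>0 < \<epsilon>\<close> unfolding e_def [symmetric] by simp
    qed
  qed
qed

end

section \<open>The functional central limit theorem\<close>

lemma bounded_evaluation_borel:
  fixes S :: "'s set"
  assumes "t \<in> S"
  shows "(\<lambda>x. x t) \<in> borel_measurable (metric_borel (funspace S euclidean_metric :: ('s \<Rightarrow> real) metric))"
proof (rule continuous_map_metric_borel)
  let ?D = "funspace S euclidean_metric :: ('s \<Rightarrow> real) metric"
  interpret D: Metric_space "mspace ?D" "mdist ?D" by (rule Metric_space_mspace_mdist)
  have "\<bar>x t - y t\<bar> \<le> mdist ?D x y" if "x \<in> mspace ?D" "y \<in> mspace ?D" for x y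
    using funspace_mdist_le[OF that, of "mdist ?D x y"] assms by (auto simp: dist_real_def)
  then show "continuous_map (mtopology_of ?D) euclideanreal (\<lambda>x. x t)"
    unfolding mtopology_of_def
    using D.metric_continuous_map[OF Met_TC.Metric_space_axioms, of "\<lambda>x. x t :: real"]
    by (simp only: mtopology_is_euclidean subset_UNIV simp_thms dist_real_def)
       (meson le_less_trans)
qed

lemma (in prob_space) indep_sum_second_moment:
  assumes indep: "indep_vars (\<lambda>_. borel) Y (UNIV :: nat set)"
    and sq: "\<And>n. Y n \<in> square_integrable M"
    and mean: "\<And>n. expectation (Y n) = 0" and var: "\<And>n. expectation (\<lambda>x. (Y n x)\<^sup>2) = s"
  shows "expectation (\<lambda>x. (\<Sum>i<m. Y i x)\<^sup>2) = real m * s"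
proof (induction m)
  case (Suc m)
  have Y_int: "integrable M (Y n)" for n
  proof -
    have "(\<lambda>_. 1) \<in> square_integrable M" by (simp add: square_integrable_def)
    from square_integrable_mult[OF sq[of n] this] show ?thesis by simp
  qed
  have cross: "expectation (\<lambda>x. Y i x * Y m x) = 0" if "i < m" for i
  proof -
    have "expectation (\<lambda>x. \<Prod>k\<in>{i, m}. Y k x) = (\<Prod>k\<in>{i, m}. expectation (Y k))"
      by (intro indep_vars_lebesgue_integral indep_vars_subset[OF indep] Y_int) auto
    then show ?thesis using that mean by simp
  qed
  let ?S = "\<lambda>x. \<Sum>i<m. Y i x"
  have S: "?S \<in> square_integrable M" by (intro square_integrable_sum sq)
  have sqi: "integrable M (\<lambda>x. (g x)\<^sup>2)" if "g \<in> square_integrable M" for g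
    using that by (simp add: square_integrable_def)
  have "expectation (\<lambda>x. ?S x * Y m x) = (\<Sum>i<m. expectation (\<lambda>x. Y i x * Y m x))"
    unfolding sum_distrib_right by (intro Bochner_Integration.integral_sum square_integrable_mult sq)
  also have "\<dots> = 0" using cross by simp
  finally have "expectation (\<lambda>x. ?S x * Y m x) = 0" .
  moreover have "expectation (\<lambda>x. (\<Sum>i<Suc m. Y i x)\<^sup>2) =
      expectation (\<lambda>x. (?S x)\<^sup>2 + 2 * (?S x * Y m x) + (Y m x)\<^sup>2)"
    by (simp add: power2_sum algebra_simps)
  moreover have "\<dots> = expectation (\<lambda>x. (?S x)\<^sup>2) + 2 * expectation (\<lambda>x. ?S x * Y m x) + expectation (\<lambda>x. (Y m x)\<^sup>2)"
    using sqi[OF S] sqi[OF sq[of m]] square_integrable_mult[OF S sq[of m]] by simp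
  ultimately show ?case using Suc var by (simp add: algebra_simps)
qed simp

section \<open>Normalized sums of centered warpings on the dyadic grid\<close>

context curve_registration
begin

definition lattice_point :: "nat \<times> nat \<Rightarrow> real" where
  "lattice_point i = a + (b - a) * (real (snd i) / 2 ^ fst i)"

text \<open>An index outside the grid gets the zero functional, in agreement with the convention in
  \<open>lattice_paths\<close>.\<close>

definition centered :: "nat \<times> nat \<Rightarrow> (real \<Rightarrow> real) \<Rightarrow> real" where
  "centered i x = (if snd i \<le> 2 ^ fst i then x (lattice_point i) - \<phi> (lattice_point i) else 0)"

definition fluctuation :: "nat \<Rightarrow> 'v \<Rightarrow> nat \<times> nat \<Rightarrow> real" where
  "fluctuation m \<omega> i = (\<Sum>j<m. centered i (h (Suc j) \<omega>)) / sqrt (real m)"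

lemma scaled_point_in: "u \<in> {0..1} \<Longrightarrow> a + (b - a) * u \<in> {a..b}"
proof -
  assume u: "u \<in> {0..1}"
  then have "(b - a) * u \<le> b - a" using a_less_b mult_left_mono[of u 1 "b - a"] by simp
  moreover have "0 \<le> (b - a) * u" using u a_less_b by simp
  ultimately have "a \<le> a + (b - a) * u" "a + (b - a) * u \<le> b" by linarith+
  then show "a + (b - a) * u \<in> {a..b}" unfolding atLeastAtMost_iff by blast
qed

lemma lattice_point_in: "k \<le> 2 ^ n \<Longrightarrow> lattice_point (n, k) \<in> {a..b}"
proof -
  assume "k \<le> 2 ^ n"
  then have "real k \<le> 2 ^ n" by (metis of_nat_le_iff of_nat_numeral of_nat_power)
  then show ?thesis unfolding lattice_point_def by (intro scaled_point_in) simp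
qed

lemma centered_measurable: "centered i \<in> borel_measurable \<C>"
proof (cases "snd i \<le> 2 ^ fst i")
  case True
  then have "lattice_point i \<in> {a..b}" using lattice_point_in[of "snd i" "fst i"] by simp
  then show ?thesis using evaluation_borel True by (simp add: centered_def [abs_def])
qed (simp add: centered_def [abs_def])

lemma centered_H_bounded: "AE w in M. \<bar>centered i (H w)\<bar> \<le> b - a"
proof (cases "snd i \<le> 2 ^ fst i")
  case True
  then have t: "lattice_point i \<in> {a..b}" using lattice_point_in[of "snd i" "fst i"] by simp
  show ?thesis using H_range[OF t]
    by eventually_elim (use mean_range[OF t] True in \<open>auto simp: centered_def abs_le_iff\<close>)
qed (use a_less_b in \<open>simp add: centered_def\<close>)

lemma centered_H_measurable [measurable]: "(\<lambda>w. centered i (H w)) \<in> borel_measurable M"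
  using measurable_comp[OF H_measurable centered_measurable] by (simp add: o_def)

lemma bounded_square_integrable:
  assumes "g \<in> borel_measurable M" "AE w in M. \<bar>g w\<bar> \<le> B"
  shows "g \<in> square_integrable M"
proof -
  have "integrable M (\<lambda>w. (g w)\<^sup>2)"
  proof (rule M.integrable_const_bound[of _ "B\<^sup>2"])
    show "AE w in M. norm ((g w)\<^sup>2) \<le> B\<^sup>2"
      using assms(2) by eventually_elim (simp add: abs_le_square_iff [symmetric])
  qed (use assms(1) in measurable)
  then show ?thesis using assms(1) by (simp add: square_integrable_def)
qed

lemma centered_square_integrable: "(\<lambda>w. centered i (H w)) \<in> square_integrable M"
  by (rule bounded_square_integrable[OF centered_H_measurable centered_H_bounded])

lemma centered_mean: "(\<integral>w. centered i (H w) \<partial>M) = 0"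
proof (cases "snd i \<le> 2 ^ fst i")
  case True
  then have t: "lattice_point i \<in> {a..b}" using lattice_point_in[of "snd i" "fst i"] by simp
  have "integrable M (\<lambda>w. H w (lattice_point i))"
    by (rule M.integrable_const_bound[of _ "\<bar>a\<bar> + \<bar>b\<bar>"]) (use H_range[OF t] H_eval_measurable[OF t] in auto)
  then show ?thesis using True by (simp add: centered_def mean_fun_def M.prob_space)
qed (simp add: centered_def)

text \<open>The index map \<open>\<iota>\<close> need not be injective on \<open>A\<close>: at
  coarse levels distinct points share a dyadic index.\<close>

lemma combination_H:
  shows "(\<lambda>w. \<Sum>y\<in>A. c y * centered (\<iota> y) (H w)) \<in> square_integrable M"
    and "(\<integral>w. (\<Sum>y\<in>A. c y * centered (\<iota> y) (H w)) \<partial>M) = 0"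
    and "(\<lambda>x. \<Sum>y\<in>A. c y * centered (\<iota> y) x) \<in> borel_measurable \<C>"
proof -
  show sq: "(\<lambda>w. \<Sum>y\<in>A. c y * centered (\<iota> y) (H w)) \<in> square_integrable M"
    by (intro square_integrable_sum square_integrable_cmult centered_square_integrable)
  have "(\<lambda>_. 1) \<in> square_integrable M" by (simp add: square_integrable_def)
  then have "integrable M (\<lambda>w. centered i (H w))" for i
    using square_integrable_mult[OF centered_square_integrable, of "\<lambda>_. 1" i] by simp
  then show "(\<integral>w. (\<Sum>y\<in>A. c y * centered (\<iota> y) (H w)) \<partial>M) = 0"
    by (subst Bochner_Integration.integral_sum) (auto simp: centered_mean)
  show "(\<lambda>x. \<Sum>y\<in>A. c y * centered (\<iota> y) x) \<in> borel_measurable \<C>"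
    using centered_measurable by measurable
qed

lemma fluctuation_combination:
  "(\<Sum>y\<in>A. c y * fluctuation m \<omega> (\<iota> y)) =
     (\<Sum>j<m. \<Sum>y\<in>A. c y * centered (\<iota> y) (h (Suc j) \<omega>)) / sqrt (real m)"
proof -
  have "(\<Sum>y\<in>A. c y * fluctuation m \<omega> (\<iota> y)) =
      (\<Sum>y\<in>A. \<Sum>j<m. c y * centered (\<iota> y) (h (Suc j) \<omega>)) / sqrt (real m)"
    by (simp add: fluctuation_def sum_divide_distrib sum_distrib_left)
  then show ?thesis by (subst sum.swap)
qed

lemma fluctuation_measurable [measurable]: "fluctuation m \<in> borel_measurable P"
proof (rule measurable_coordinatewise_then_product)
  have [measurable]: "(\<lambda>\<omega>. centered i (h (Suc j) \<omega>)) \<in> borel_measurable P" for i j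
    using measurable_comp[OF h_measurable centered_measurable] by (simp add: o_def)
  show "(\<lambda>\<omega>. fluctuation m \<omega> i) \<in> borel_measurable P" for i
    unfolding fluctuation_def by measurable
qed

lemma fluctuation_coordinate_measurable [measurable]: "(\<lambda>\<omega>. fluctuation m \<omega> i) \<in> borel_measurable P"
  using measurable_product_then_coordinatewise[OF fluctuation_measurable] .

lemma fluctuation_char:
  "(\<lambda>m. char (distr P borel (\<lambda>\<omega>. \<Sum>y\<in>A. c y * fluctuation m \<omega> (\<iota> y))) t)
     \<longlonglongrightarrow> exp (- (t\<^sup>2 * (\<integral>w. (\<Sum>y\<in>A. c y * centered (\<iota> y) (H w))\<^sup>2 \<partial>M)) / 2)"
  unfolding fluctuation_combination
  using combination_H(1)[where A = A and c = c and \<iota> = \<iota>]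
  by (intro central_limit_char P functional_iid[OF combination_H(3)] combination_H(2))
     (auto simp: square_integrable_def)

text \<open>Independence and centering make this an identity for every m \<ge> 1, not a limit.
  Second moment bounds for \<open>H\<close>, in particular those on increments, therefore hold for
  the normalized sums uniformly in \<open>m\<close>.\<close>

lemma fluctuation_second_moment:
  assumes "1 \<le> m"
  shows "(\<integral>\<omega>. (\<Sum>y\<in>A. c y * fluctuation m \<omega> (\<iota> y))\<^sup>2 \<partial>P) =
      (\<integral>w. (\<Sum>y\<in>A. c y * centered (\<iota> y) (H w))\<^sup>2 \<partial>M)" (is ?eq)
    and "integrable P (\<lambda>\<omega>. (\<Sum>y\<in>A. c y * fluctuation m \<omega> (\<iota> y))\<^sup>2)" (is ?int)
proof -
  let ?F = "\<lambda>x. \<Sum>y\<in>A. c y * centered (\<iota> y) x"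
  note F = combination_H[where A = A and c = c and \<iota> = \<iota>]
  note iid_F = functional_iid[OF F(3)]
  have meas [measurable]: "(\<lambda>\<omega>. ?F (h (Suc j) \<omega>)) \<in> borel_measurable P" for j
    using measurable_comp[OF h_measurable F(3)] by (simp add: o_def)
  have [measurable]: "(\<lambda>w. ?F (H w)) \<in> borel_measurable M"
    using F(1) by (simp add: square_integrable_def)
  have transfer: "(\<integral>\<omega>. g (?F (h (Suc j) \<omega>)) \<partial>P) = (\<integral>w. g (?F (H w)) \<partial>M)"
    "integrable P (\<lambda>\<omega>. g (?F (h (Suc j) \<omega>))) \<longleftrightarrow> integrable M (\<lambda>w. g (?F (H w)))"
    if [measurable]: "g \<in> borel_measurable borel" for g :: "real \<Rightarrow> real" and j
  proof -
    show "(\<integral>\<omega>. g (?F (h (Suc j) \<omega>)) \<partial>P) = (\<integral>w. g (?F (H w)) \<partial>M)"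
      using arg_cong[OF iid_F(2)[of j], of "\<lambda>N. integral\<^sup>L N g"] by (simp add: integral_distr)
    show "integrable P (\<lambda>\<omega>. g (?F (h (Suc j) \<omega>))) \<longleftrightarrow> integrable M (\<lambda>w. g (?F (H w)))"
      using arg_cong[OF iid_F(2)[of j], of "\<lambda>N. integrable N g"] by (simp add: integrable_distr_eq)
  qed
  have sq: "(\<lambda>\<omega>. ?F (h (Suc j) \<omega>)) \<in> square_integrable P" for j
    using transfer(2)[of "\<lambda>x. x\<^sup>2" j] F(1) meas by (simp add: square_integrable_def)
  have "P.expectation (\<lambda>\<omega>. (\<Sum>j<m. ?F (h (Suc j) \<omega>))\<^sup>2) = real m * (\<integral>w. (?F (H w))\<^sup>2 \<partial>M)"
    by (rule P.indep_sum_second_moment[OF iid_F(1) sq])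
       (use transfer(1)[of "\<lambda>x. x"] transfer(1)[of "\<lambda>x. x\<^sup>2"] F(2) in auto)
  then show ?eq unfolding fluctuation_combination using assms by (simp add: power_divide)
  have "(\<lambda>\<omega>. \<Sum>j<m. ?F (h (Suc j) \<omega>)) \<in> square_integrable P" by (intro square_integrable_sum sq)
  then show ?int unfolding fluctuation_combination by (simp add: power_divide square_integrable_def)
qed

lemma centered_refine: "centered (Suc n, 2 * k) x = centered (n, k) x"
  by (simp add: centered_def lattice_point_def)

text \<open>Almost every path of \<open>H\<close> starts at \<open>a\<close>, so the centered value
  there vanishes; this anchors the dyadic paths at 0.\<close>

lemma centered_origin: "AE w in M. centered (0, 0) (H w) = 0"
proof -
  have Ha: "AE w in M. H w a = a" using H_warping by eventually_elim (simp add: warpings_def)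
  have "\<phi> a = (\<integral>w. a \<partial>M)" unfolding mean_fun_def
    using Ha H_eval_measurable[of a] a_less_b by (intro integral_cong_AE) auto
  then show ?thesis using Ha by (simp add: centered_def lattice_point_def M.prob_space)
qed

definition rescaled :: "real \<Rightarrow> real" where
  "rescaled y = (finv y - a) / (b - a)"

lemma rescaled_in: "y \<in> {f a..f b} \<Longrightarrow> rescaled y \<in> {0..1}"
  using finv(1)[of y] a_less_b by (simp add: rescaled_def divide_le_eq)

lemma rescaled_point: "a + (b - a) * rescaled y = finv y"
  using a_less_b by (simp add: rescaled_def)

text \<open>Passing to dyadic coordinates loses no information: the paths of \<open>h\<close> and
  the mean are continuous, so the normalized sum at any \<open>y\<close> is recovered exactly, for
  every outcome.\<close>

lemma fluctuation_limit:
  assumes \<omega>: "\<omega> \<in> space P" and y: "y \<in> {f a..f b}"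
  shows "lattice_limit (fluctuation m \<omega>) (rescaled y) =
    (\<Sum>j<m. h (Suc j) \<omega> (finv y) - \<phi> (finv y)) / sqrt (real m)"
proof -
  define z where "z u = (\<Sum>j<m. h (Suc j) \<omega> (a + (b - a) * u) - \<phi> (a + (b - a) * u)) / sqrt (real m)" for u
  have comp: "continuous_on {0..1} (\<lambda>u. g (a + (b - a) * u))" if "continuous_on {a..b} g" for g :: "real \<Rightarrow> real"
    by (rule continuous_on_compose2[OF that]) (use scaled_point_in in \<open>auto intro!: continuous_intros\<close>)
  have "continuous_on {0..1} z"
    unfolding z_def divide_inverse
    by (intro continuous_on_mult_right continuous_on_sum continuous_on_diff comp h_continuous \<omega> mean_continuous)
  then have "lattice_limit (fluctuation m \<omega>) (rescaled y) = z (rescaled y)"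
    by (rule lattice_limit_continuous_function[OF _ _ rescaled_in[OF y]])
       (simp add: z_def fluctuation_def centered_def lattice_point_def)
  then show ?thesis unfolding z_def rescaled_point .
qed

end

section \<open>The Gaussian law on dyadic coordinates and tightness\<close>

locale gaussian_limit = curve_registration +
  fixes Q :: "(nat \<times> nat \<Rightarrow> real) measure" and C1 :: real
  assumes Q: "prob_space Q" and sets_Q: "sets Q = sets borel"
    and char_Q: "\<And>F u t. finite F \<Longrightarrow> char (distr Q borel (\<lambda>v. \<Sum>i\<in>F. u i * v i)) t =
       exp (- (t\<^sup>2 * (\<integral>w. (\<Sum>i\<in>F. u i * centered i (H w))\<^sup>2 \<partial>M)) / 2)"
    and C1_pos: "0 < C1"
    and increments: "\<And>s t. s \<in> {a..b} \<Longrightarrow> t \<in> {a..b} \<Longrightarrow>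
       (\<integral>w. (H w s - \<phi> s - (H w t - \<phi> t))\<^sup>2 \<partial>M) \<le> C1 * (s - t)\<^sup>2"
begin

sublocale Q: prob_space Q by (rule Q)

lemma space_Q: "space Q = UNIV"
  using sets_eq_imp_space_eq[OF sets_Q] by simp

lemma measurable_Q [simp]: "measurable Q N = measurable borel N"
  by (rule measurable_cong_sets[OF sets_Q refl])

text \<open>Coefficients of points with the same dyadic index are added up, after which
  \<open>char_Q\<close> applies to the image of \<open>A\<close>.\<close>

lemma char_Q_family:
  assumes A: "finite A"
  shows "char (distr Q borel (\<lambda>v. \<Sum>y\<in>A. c y * v (\<iota> y))) t =
    exp (- (t\<^sup>2 * (\<integral>w. (\<Sum>y\<in>A. c y * centered (\<iota> y) (H w))\<^sup>2 \<partial>M)) / 2)"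
proof -
  have regroup: "(\<Sum>y\<in>A. c y * g (\<iota> y)) = (\<Sum>i\<in>\<iota> ` A. (\<Sum>y\<in>{y \<in> A. \<iota> y = i}. c y) * g i)" for g :: "nat \<times> nat \<Rightarrow> real"
    by (subst sum.image_gen[OF A, of _ \<iota>]) (simp add: sum_distrib_right)
  show ?thesis
    unfolding regroup regroup[of "\<lambda>i. centered i (H _)"] by (rule char_Q[OF finite_imageI[OF A]])
qed

lemma second_moment_Q:
  assumes A: "finite A"
  shows "(\<integral>v. (\<Sum>y\<in>A. c y * v (\<iota> y))\<^sup>2 \<partial>Q) = (\<integral>w. (\<Sum>y\<in>A. c y * centered (\<iota> y) (H w))\<^sup>2 \<partial>M)"
    and "integrable Q (\<lambda>v. (\<Sum>y\<in>A. c y * v (\<iota> y))\<^sup>2)"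
proof -
  define s where "s = sqrt (\<integral>w. (\<Sum>y\<in>A. c y * centered (\<iota> y) (H w))\<^sup>2 \<partial>M)"
  have s: "0 \<le> s" "s\<^sup>2 = (\<integral>w. (\<Sum>y\<in>A. c y * centered (\<iota> y) (H w))\<^sup>2 \<partial>M)" by (simp_all add: s_def)
  have m: "(\<lambda>v. \<Sum>y\<in>A. c y * v (\<iota> y)) \<in> borel_measurable Q" by simp
  have "char (distr Q borel (\<lambda>v. \<Sum>y\<in>A. c y * v (\<iota> y))) t = exp (- (s * t)\<^sup>2 / 2)" for t
    unfolding char_Q_family[OF A] by (simp add: power_mult_distrib s(2) mult.commute)
  from gaussian_variable_char(2,4)[OF Q m s(1) this] s(2)
  show "(\<integral>v. (\<Sum>y\<in>A. c y * v (\<iota> y))\<^sup>2 \<partial>Q) = (\<integral>w. (\<Sum>y\<in>A. c y * centered (\<iota> y) (H w))\<^sup>2 \<partial>M)"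
    "integrable Q (\<lambda>v. (\<Sum>y\<in>A. c y * v (\<iota> y))\<^sup>2)" by auto
qed

text \<open>A linear relation that holds almost surely for \<open>H\<close> has second moment 0, and
  \<open>Q\<close> has the same second moments. In this way refinement, anchoring at 0 and vanishing
  off the grid pass to \<open>Q\<close>, which is given only by its characteristic
  functions.\<close>

lemma AE_Q_null:
  assumes "finite A" "AE w in M. (\<Sum>y\<in>A. c y * centered (\<iota> y) (H w)) = 0"
  shows "AE v in Q. (\<Sum>y\<in>A. c y * v (\<iota> y)) = 0"
proof -
  have "(\<integral>w. (\<Sum>y\<in>A. c y * centered (\<iota> y) (H w))\<^sup>2 \<partial>M) = (\<integral>w. 0 \<partial>M)"
    by (rule integral_cong_AE) (use assms(2) in auto)
  then have "(\<integral>v. (\<Sum>y\<in>A. c y * v (\<iota> y))\<^sup>2 \<partial>Q) = 0" using second_moment_Q(1)[OF assms(1)] by simp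
  then have "AE v in Q. (\<Sum>y\<in>A. c y * v (\<iota> y))\<^sup>2 = 0"
    using integral_nonneg_eq_0_iff_AE[OF second_moment_Q(2)[OF assms(1), of c \<iota>]] by simp
  then show ?thesis by simp
qed

text \<open>The mesh width is (b-a)/2^n, and its square produces the decay 4^(-n) required by
  \<open>lattice_paths_tight\<close>.\<close>

lemma lattice_increment:
  assumes "k < 2 ^ n"
  shows "(\<integral>w. (centered (n, Suc k) (H w) - centered (n, k) (H w))\<^sup>2 \<partial>M) \<le> C1 * (b - a)\<^sup>2 * (1/4) ^ n"
proof -
  have "lattice_point (n, Suc k) - lattice_point (n, k) = (b - a) * (1/2) ^ n"
    by (simp add: lattice_point_def power_one_over field_simps)
  then have "(lattice_point (n, Suc k) - lattice_point (n, k))\<^sup>2 = (b - a)\<^sup>2 * (1/4) ^ n"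
    by (simp add: power_mult_distrib power_mult [symmetric] mult.commute[of n])
       (simp add: power_mult power2_eq_square)
  moreover have "(\<integral>w. (centered (n, Suc k) (H w) - centered (n, k) (H w))\<^sup>2 \<partial>M) \<le>
      C1 * (lattice_point (n, Suc k) - lattice_point (n, k))\<^sup>2"
    using increments[OF lattice_point_in lattice_point_in, of "Suc k" n k n] assms by (simp add: centered_def)
  ultimately show ?thesis by (simp add: mult.assoc)
qed

abbreviation "tail_bound \<equiv> 9 * (C1 * (b - a)\<^sup>2)"

lemma tight_P:
  assumes "1 \<le> m" "0 < c"
  shows "P.prob {\<omega> \<in> space P. fluctuation m \<omega> \<notin> lattice_paths c} \<le> tail_bound / c\<^sup>2"
proof (rule P.lattice_paths_tight)
  \<comment> \<open>An increment is written as a combination over \<open>bool\<close> with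
    coefficients 1 and -1; unlike a sum over the set {i, j} this is correct also for i = j.\<close>
  have diff: "fluctuation m \<omega> i - fluctuation m \<omega> j =
      (\<Sum>y\<in>UNIV. (if y then 1 else - 1) * fluctuation m \<omega> (if y then i else j))" for \<omega> i j
    by (simp add: UNIV_bool)
  have diff': "centered i x - centered j x =
      (\<Sum>y\<in>UNIV. (if y then 1 else - 1) * centered (if y then i else j) x)" for x i j
    by (simp add: UNIV_bool)
  show "(\<integral>\<omega>. (fluctuation m \<omega> (n, Suc k) - fluctuation m \<omega> (n, k))\<^sup>2 \<partial>P) \<le> C1 * (b - a)\<^sup>2 * (1/4) ^ n"
    if "k < 2 ^ n" for n k
    using lattice_increment[OF that] unfolding diff diff' fluctuation_second_moment(1)[OF assms(1)] .
  show "integrable P (\<lambda>\<omega>. (fluctuation m \<omega> (n, Suc k) - fluctuation m \<omega> (n, k))\<^sup>2)" for n k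
    unfolding diff by (rule fluctuation_second_moment(2)[OF assms(1)])
  show "AE \<omega> in P. \<forall>n k. fluctuation m \<omega> (n, k) = fluctuation m \<omega> (Suc n, 2 * k)"
    by (simp add: fluctuation_def centered_refine del: mult_Suc_right)
  show "AE \<omega> in P. \<forall>n k. 2 ^ n < k \<longrightarrow> fluctuation m \<omega> (n, k) = 0"
    by (simp add: fluctuation_def centered_def)
  have "(\<integral>w. (centered (0, 0) (H w))\<^sup>2 \<partial>M) = (\<integral>w. 0 \<partial>M)"
    by (rule integral_cong_AE) (use centered_origin in auto)
  then have z: "(\<integral>\<omega>. (fluctuation m \<omega> (0, 0))\<^sup>2 \<partial>P) = 0"
    using fluctuation_second_moment(1)[OF assms(1), where A = "{()}" and c = "\<lambda>_. 1" and \<iota> = "\<lambda>_. (0, 0)"] by simp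
  have "integrable P (\<lambda>\<omega>. (fluctuation m \<omega> (0, 0))\<^sup>2)"
    using fluctuation_second_moment(2)[OF assms(1), where A = "{()}" and c = "\<lambda>_. 1" and \<iota> = "\<lambda>_. (0, 0)"] by simp
  then have "AE \<omega> in P. (fluctuation m \<omega> (0, 0))\<^sup>2 = 0"
    using integral_nonneg_eq_0_iff_AE[of P "\<lambda>\<omega>. (fluctuation m \<omega> (0, 0))\<^sup>2"] z by simp
  then show "AE \<omega> in P. fluctuation m \<omega> (0, 0) = 0" by simp
qed (use assms C1_pos in auto)

lemma tight_Q:
  assumes "0 < c"
  shows "Q.prob {v \<in> space Q. v \<notin> lattice_paths c} \<le> tail_bound / c\<^sup>2"
proof (rule Q.lattice_paths_tight)
  have diff: "v i - v j = (\<Sum>y\<in>UNIV. (if y then 1 else - 1) * v (if y then i else j))"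
    for v :: "nat \<times> nat \<Rightarrow> real" and i j
    by (simp add: UNIV_bool)
  have diff': "centered i x - centered j x =
      (\<Sum>y\<in>UNIV. (if y then 1 else - 1) * centered (if y then i else j) x)" for x i j
    by (simp add: UNIV_bool)
  show "(\<integral>v. (v (n, Suc k) - v (n, k))\<^sup>2 \<partial>Q) \<le> C1 * (b - a)\<^sup>2 * (1/4) ^ n" if "k < 2 ^ n" for n k
    using lattice_increment[OF that] unfolding diff diff' second_moment_Q(1)[OF finite] .
  show "integrable Q (\<lambda>v. (v (n, Suc k) - v (n, k))\<^sup>2)" for n k
    unfolding diff by (rule second_moment_Q(2)[OF finite])
  have "AE v in Q. v (n, k) - v (Suc n, 2 * k) = 0" for n k
    unfolding diff by (rule AE_Q_null[OF finite]) (simp add: UNIV_bool centered_refine del: mult_Suc_right)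
  then show "AE v in Q. \<forall>n k. v (n, k) = v (Suc n, 2 * k)"
    unfolding AE_all_countable by simp
  have one: "AE v in Q. v i = 0" if "AE w in M. centered i (H w) = 0" for i
    using AE_Q_null[of "{()}" "\<lambda>_. 1" "\<lambda>_. i"] that by simp
  show "AE v in Q. v (0, 0) = 0" by (rule one[OF centered_origin])
  show "AE v in Q. \<forall>n k. 2 ^ n < k \<longrightarrow> v (n, k) = 0"
    unfolding AE_all_countable by (auto intro!: AE_impI one simp: centered_def)
qed (use assms C1_pos in auto)

lemma tight:
  assumes "0 < \<epsilon>"
  shows "\<exists>c. (\<forall>m\<ge>1. measure P {\<omega> \<in> space P. fluctuation m \<omega> \<notin> lattice_paths c} \<le> \<epsilon>) \<and>
    measure Q {v \<in> space Q. v \<notin> lattice_paths c} \<le> \<epsilon>"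
proof -
  define B where "B = tail_bound"
  have pos: "0 < B" using a_less_b C1_pos by (simp add: B_def)
  define c where "c = sqrt (B / \<epsilon>)"
  have c: "0 < c" "B / c\<^sup>2 = \<epsilon>" using pos assms by (simp_all add: c_def)
  show ?thesis
    using tight_P[OF _ c(1)] tight_Q[OF c(1)] unfolding B_def [symmetric] c(2) by blast
qed

lemma AE_Q_lattice_path: "AE v in Q. v \<in> (\<Union>n. lattice_paths (real n))"
proof -
  let ?L = "\<Union>n. lattice_paths (real n)"
  have L: "?L \<in> sets borel" by auto
  have "Q.prob (UNIV - ?L) \<le> \<epsilon>" if pos: "0 < \<epsilon>" for \<epsilon>
  proof -
    obtain c where c: "measure Q {v \<in> space Q. v \<notin> lattice_paths c} \<le> \<epsilon>" using tight[OF pos] by blast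
    have "Q.prob (UNIV - ?L) \<le> Q.prob {v \<in> space Q. v \<notin> lattice_paths c}"
    proof (rule Q.finite_measure_mono)
      have "{v \<in> space Q. v \<notin> lattice_paths c} = UNIV - lattice_paths c" by (auto simp: space_Q)
      then show "{v \<in> space Q. v \<notin> lattice_paths c} \<in> sets Q" by (simp add: sets_Q)
    qed (use lattice_paths_in_union in \<open>auto simp: space_Q\<close>)
    then show ?thesis using c by simp
  qed
  \<comment> \<open>If the mass were positive, half of it would be an admissible \<epsilon> bounding
    the mass itself.\<close>
  from this[of "Q.prob (UNIV - ?L) / 2"] have "Q.prob (UNIV - ?L) = 0"
    using measure_nonneg[of Q "UNIV - ?L"] by linarith
  moreover have "Q.prob (UNIV - ?L) = 1 - Q.prob ?L" using Q.prob_compl[of ?L] L by (simp add: space_Q sets_Q)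
  ultimately have "Q.prob ?L = 1" by simp
  then show ?thesis using Q.AE_in_set_eq_1[of ?L] L by (simp add: sets_Q)
qed

section \<open>The limit process as a random bounded function\<close>

abbreviation "D \<equiv> bounded_space (f a) (f b)"
abbreviation "limit_path \<equiv> lattice_realization {f a..f b} rescaled"
abbreviation "N \<equiv> distr Q (metric_borel D) limit_path"

lemma limit_path_measurable: "limit_path \<in> measurable borel (metric_borel D)"
  by (rule lattice_realization_measurable[OF rescaled_in f_range_nonempty])

sublocale N: prob_space N
  by (rule Q.prob_space_distr) (use limit_path_measurable in simp)

definition deviation :: "real \<Rightarrow> 'a \<Rightarrow> real" where
  "deviation y w = H w (finv y) - \<phi> (finv y)"

lemma deviation_square_integrable: "y \<in> {f a..f b} \<Longrightarrow> deviation y \<in> square_integrable M"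
proof -
  assume y: "y \<in> {f a..f b}"
  show "deviation y \<in> square_integrable M"
  proof (rule bounded_square_integrable)
    show "deviation y \<in> borel_measurable M"
      unfolding deviation_def [abs_def] using H_eval_measurable[OF finv(1)[OF y]] by measurable
    show "AE w in M. \<bar>deviation y w\<bar> \<le> b - a"
      using H_range[OF finv(1)[OF y]]
      by eventually_elim (use mean_range[OF finv(1)[OF y]] in \<open>auto simp: deviation_def abs_le_iff\<close>)
  qed
qed

text \<open>The coordinates of \<open>Q\<close> sit at dyadic times, whereas \<open>finv y\<close>
  is arbitrary, so both sides are limits along left neighbours: the left one because almost every
  path under \<open>Q\<close> converges there, the right one by continuity of \<open>H w\<close> and
  of the mean, with dominated convergence for the second moments.\<close>

lemma char_N:
  assumes A: "finite A" "A \<subseteq> {f a..f b}"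
  shows "char (distr N borel (\<lambda>x. \<Sum>y\<in>A. c y * x y)) t =
    exp (- (t\<^sup>2 * (\<integral>w. (\<Sum>y\<in>A. c y * deviation y w)\<^sup>2 \<partial>M)) / 2)"
proof -
  define \<iota> where "\<iota> n y = (n, lattice_index n (rescaled y))" for n :: nat and y
  define Z where "Z n v = (\<Sum>y\<in>A. c y * v (\<iota> n y))" for n and v :: "nat \<times> nat \<Rightarrow> real"
  define Zlim where "Zlim v = (\<Sum>y\<in>A. c y * limit_path v y)" for v
  have Z_meas: "Z n \<in> borel_measurable borel" for n unfolding Z_def by measurable
  have comb_meas: "(\<lambda>x. \<Sum>y\<in>A. c y * x y) \<in> borel_measurable (metric_borel D)"
    by (intro borel_measurable_sum borel_measurable_times measurable_const bounded_evaluation_borel)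
       (use A in auto)
  have Zlim_meas: "Zlim \<in> borel_measurable borel"
    using measurable_comp[OF limit_path_measurable comb_meas] by (simp add: Zlim_def [abs_def] o_def)
  have law: "distr N borel (\<lambda>x. \<Sum>y\<in>A. c y * x y) = distr Q borel Zlim"
    using distr_distr[OF comb_meas, of limit_path Q] limit_path_measurable
    by (simp add: Zlim_def [abs_def] o_def)
  have lim1: "(\<lambda>n. char (distr Q borel (Z n)) t) \<longlonglongrightarrow> char (distr Q borel Zlim) t"
  proof -
    have "(\<lambda>n. CLINT v|Q. iexp (t * Z n v)) \<longlonglongrightarrow> (CLINT v|Q. iexp (t * Zlim v))"
    proof (rule integral_dominated_convergence[where w = "\<lambda>_. 1"])
      show "AE v in Q. (\<lambda>n. iexp (t * Z n v)) \<longlonglongrightarrow> iexp (t * Zlim v)"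
        using AE_Q_lattice_path
      proof eventually_elim
        case (elim v)
        then obtain m :: nat where v: "v \<in> lattice_paths (real m)" by blast
        have "(\<lambda>n. Z n v) \<longlonglongrightarrow> Zlim v"
          unfolding Z_def Zlim_def \<iota>_def
        proof (intro tendsto_sum tendsto_mult_left)
          fix y assume "y \<in> A"
          then have y: "y \<in> {f a..f b}" using A by blast
          show "(\<lambda>n. v (n, lattice_index n (rescaled y))) \<longlonglongrightarrow> limit_path v y"
            using lattice_limit_tendsto[OF v rescaled_in[OF y]] y by (simp add: lattice_realization_eq[OF v])
        qed
        then show ?case by (intro tendsto_intros)
      qed
    qed (use Z_meas Zlim_meas in auto)
    then show ?thesis
      unfolding char_def using Z_meas Zlim_meas by (simp add: integral_distr)
  qed
  have lim2: "(\<lambda>n. char (distr Q borel (Z n)) t) \<longlonglongrightarrow>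
      exp (- (t\<^sup>2 * (\<integral>w. (\<Sum>y\<in>A. c y * deviation y w)\<^sup>2 \<partial>M)) / 2)"
  proof -
    have "(\<lambda>n. \<integral>w. (\<Sum>y\<in>A. c y * centered (\<iota> n y) (H w))\<^sup>2 \<partial>M) \<longlonglongrightarrow>
        (\<integral>w. (\<Sum>y\<in>A. c y * deviation y w)\<^sup>2 \<partial>M)"
    proof (rule integral_dominated_convergence[where w = "\<lambda>_. (\<Sum>y\<in>A. \<bar>c y\<bar> * (b - a))\<^sup>2"])
      have [measurable]: "deviation y \<in> borel_measurable M" if "y \<in> A" for y
        using deviation_square_integrable[of y] A that by (auto simp: square_integrable_def)
      show "(\<lambda>w. (\<Sum>y\<in>A. c y * deviation y w)\<^sup>2) \<in> borel_measurable M" by measurable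
      show "(\<lambda>w. (\<Sum>y\<in>A. c y * centered (\<iota> n y) (H w))\<^sup>2) \<in> borel_measurable M" for n by measurable
      show "AE w in M. (\<lambda>n. (\<Sum>y\<in>A. c y * centered (\<iota> n y) (H w))\<^sup>2) \<longlonglongrightarrow> (\<Sum>y\<in>A. c y * deviation y w)\<^sup>2"
      proof (rule AE_I2, intro tendsto_power tendsto_sum tendsto_mult_left)
        fix w y assume w: "w \<in> space M" and "y \<in> A"
        then have y: "y \<in> {f a..f b}" using A by blast
        note u = rescaled_in[OF y]
        have "(\<lambda>n. lattice_point (\<iota> n y)) \<longlonglongrightarrow> a + (b - a) * rescaled y"
          unfolding lattice_point_def \<iota>_def fst_conv snd_conv
          by (intro tendsto_intros lattice_index_tendsto(1) u)
        then have lp: "(\<lambda>n. lattice_point (\<iota> n y)) \<longlonglongrightarrow> finv y" by (simp add: rescaled_point)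
        have lp_in: "lattice_point (\<iota> n y) \<in> {a..b}" for n
          unfolding \<iota>_def by (rule lattice_point_in[OF lattice_index_bounds(3)[OF u]])
        have "(\<lambda>n. H w (lattice_point (\<iota> n y)) - \<phi> (lattice_point (\<iota> n y))) \<longlonglongrightarrow> H w (finv y) - \<phi> (finv y)"
          by (intro tendsto_diff continuous_on_tendsto_compose[OF H_continuous[OF w] lp]
              continuous_on_tendsto_compose[OF mean_continuous lp] finv(1)[OF y] always_eventually allI lp_in)
        then show "(\<lambda>n. centered (\<iota> n y) (H w)) \<longlonglongrightarrow> deviation y w"
          using lattice_index_bounds(3)[OF u] by (simp add: centered_def deviation_def \<iota>_def)
      qed
      show "AE w in M. norm ((\<Sum>y\<in>A. c y * centered (\<iota> n y) (H w))\<^sup>2) \<le> (\<Sum>y\<in>A. \<bar>c y\<bar> * (b - a))\<^sup>2" for n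
      proof -
        have "AE w in M. \<forall>y\<in>A. \<bar>centered (\<iota> n y) (H w)\<bar> \<le> b - a"
          using A(1) centered_H_bounded by (simp add: AE_finite_all)
        then show ?thesis
        proof eventually_elim
          case (elim w)
          have "\<bar>\<Sum>y\<in>A. c y * centered (\<iota> n y) (H w)\<bar> \<le> (\<Sum>y\<in>A. \<bar>c y * centered (\<iota> n y) (H w)\<bar>)"
            by (rule sum_abs)
          also have "\<dots> \<le> (\<Sum>y\<in>A. \<bar>c y\<bar> * (b - a))"
            using elim by (intro sum_mono) (auto simp: abs_mult intro!: mult_left_mono)
          finally have "\<bar>\<Sum>y\<in>A. c y * centered (\<iota> n y) (H w)\<bar> \<le> (\<Sum>y\<in>A. \<bar>c y\<bar> * (b - a))" .
          from power_mono[OF this abs_ge_zero, of 2] show ?case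
            unfolding real_norm_def power2_abs abs_power2 .
        qed
      qed
    qed simp
    then show ?thesis unfolding Z_def char_Q_family[OF A(1)] by (intro tendsto_intros) auto
  qed
  show ?thesis unfolding law by (rule LIMSEQ_unique[OF lim1 lim2])
qed

lemma combination_N:
  assumes A: "finite A" "A \<subseteq> {f a..f b}"
  shows "gaussian_variable N (\<lambda>x. \<Sum>y\<in>A. c y * x y)"
    and "integrable N (\<lambda>x. (\<Sum>y\<in>A. c y * x y)\<^sup>2)"
    and "(\<integral>x. (\<Sum>y\<in>A. c y * x y) \<partial>N) = 0"
    and "(\<integral>x. (\<Sum>y\<in>A. c y * x y)\<^sup>2 \<partial>N) = (\<integral>w. (\<Sum>y\<in>A. c y * deviation y w)\<^sup>2 \<partial>M)"
proof -
  define s where "s = sqrt (\<integral>w. (\<Sum>y\<in>A. c y * deviation y w)\<^sup>2 \<partial>M)"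
  have s: "0 \<le> s" "s\<^sup>2 = (\<integral>w. (\<Sum>y\<in>A. c y * deviation y w)\<^sup>2 \<partial>M)" by (simp_all add: s_def)
  have m: "(\<lambda>x. \<Sum>y\<in>A. c y * x y) \<in> borel_measurable N"
    unfolding measurable_distr_eq1
    by (intro borel_measurable_sum borel_measurable_times measurable_const bounded_evaluation_borel)
       (use A in auto)
  have "char (distr N borel (\<lambda>x. \<Sum>y\<in>A. c y * x y)) t = exp (- (s * t)\<^sup>2 / 2)" for t
    unfolding char_N[OF A] by (simp add: power_mult_distrib s(2) mult.commute)
  from gaussian_variable_char[OF N.prob_space_axioms m s(1) this] s(2)
  show "gaussian_variable N (\<lambda>x. \<Sum>y\<in>A. c y * x y)"
    "integrable N (\<lambda>x. (\<Sum>y\<in>A. c y * x y)\<^sup>2)"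
    "(\<integral>x. (\<Sum>y\<in>A. c y * x y) \<partial>N) = 0"
    "(\<integral>x. (\<Sum>y\<in>A. c y * x y)\<^sup>2 \<partial>N) = (\<integral>w. (\<Sum>y\<in>A. c y * deviation y w)\<^sup>2 \<partial>M)" by auto
qed

lemma mean_N: "y \<in> {f a..f b} \<Longrightarrow> (\<integral>x. x y \<partial>N) = 0"
  using combination_N(3)[of "{y}" "\<lambda>_. 1"] by simp

text \<open>Polarization expresses the covariance by second moments of single combinations, which
  \<open>combination_N\<close> provides. Equal points are treated apart, because the set {s, t} then
  collapses and the coefficient must be 2.\<close>

lemma covariance_N:
  assumes s: "s \<in> {f a..f b}" and t: "t \<in> {f a..f b}"
  shows "covariance N (\<lambda>x. x s) (\<lambda>x. x t) = cov_fun M H (finv s) (finv t)"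
proof -
  have polar: "(\<integral>z. g z * k z \<partial>R) = ((\<integral>z. (g z + k z)\<^sup>2 \<partial>R) - (\<integral>z. (g z)\<^sup>2 \<partial>R) - (\<integral>z. (k z)\<^sup>2 \<partial>R)) / 2"
    if g: "g \<in> square_integrable R" and k: "k \<in> square_integrable R" for R :: "'z measure" and g k
  proof -
    have "(\<integral>z. (g z + k z)\<^sup>2 \<partial>R) = (\<integral>z. (g z)\<^sup>2 + (k z)\<^sup>2 + 2 * (g z * k z) \<partial>R)"
      by (simp add: power2_sum mult.assoc)
    also have "\<dots> = (\<integral>z. (g z)\<^sup>2 \<partial>R) + (\<integral>z. (k z)\<^sup>2 \<partial>R) + 2 * (\<integral>z. g z * k z \<partial>R)"
      using g k square_integrable_mult[OF g k] by (simp add: square_integrable_def)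
    finally show ?thesis by simp
  qed
  have sqN: "(\<lambda>x. x y) \<in> square_integrable N" if "y \<in> {f a..f b}" for y
    using combination_N(2)[of "{y}" "\<lambda>_. 1"] bounded_evaluation_borel[OF that] that
    by (simp add: square_integrable_def)
  have one: "(\<integral>x. (x y)\<^sup>2 \<partial>N) = (\<integral>w. (deviation y w)\<^sup>2 \<partial>M)" if "y \<in> {f a..f b}" for y
    using combination_N(4)[of "{y}" "\<lambda>_. 1"] that by simp
  have two: "(\<integral>x. (x s + x t)\<^sup>2 \<partial>N) = (\<integral>w. (deviation s w + deviation t w)\<^sup>2 \<partial>M)"
  proof (cases "s = t")
    case True
    then show ?thesis using combination_N(4)[of "{s}" "\<lambda>_. 2"] s by simp
  next
    case False
    then show ?thesis using combination_N(4)[of "{s, t}" "\<lambda>_. 1"] s t by simp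
  qed
  have "covariance N (\<lambda>x. x s) (\<lambda>x. x t) = (\<integral>x. x s * x t \<partial>N)"
    unfolding covariance_def mean_N[OF s] mean_N[OF t] by simp
  also have "\<dots> = (\<integral>w. deviation s w * deviation t w \<partial>M)"
    unfolding polar[OF sqN[OF s] sqN[OF t]]
      polar[OF deviation_square_integrable[OF s] deviation_square_integrable[OF t]] one[OF s] one[OF t] two ..
  also have "\<dots> = cov_fun M H (finv s) (finv t)"
    by (simp add: cov_fun_def covariance_def deviation_def mean_fun_def)
  finally show ?thesis .
qed

lemma weak_convergence:
  fixes n :: "nat \<Rightarrow> nat" and \<alpha> :: real
  assumes "0 < \<alpha>" and n: "\<And>m. 1 \<le> m \<Longrightarrow> \<bar>real (n m) - real m powr (1 / 2 + \<alpha>)\<bar> < 1"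
  shows "weakly_converges P D
    (\<lambda>m \<omega>. \<lambda>y\<in>{f a..f b}. sqrt (real m) * (estimator a b J m (n m) \<omega> y - struct_exp_inv M H a b f y))
    N (\<lambda>x. x)"
proof -
  \<comment> \<open>The threshold 3 makes the denominator in \<delta> at least 1 and forces n m >
    2.\<close>
  have "eventually (\<lambda>m. 3 \<le> real m powr (1 / 2 + \<alpha>)) sequentially"
    using \<open>0 < \<alpha>\<close> by real_asymp
  then obtain m2 where m2: "\<And>m. m \<ge> m2 \<Longrightarrow> 3 \<le> real m powr (1 / 2 + \<alpha>)"
    unfolding eventually_sequentially by blast
  define m1 where "m1 = max 1 m2"
  \<comment> \<open>Rounding gives n m > m^(1/2+\<alpha>) - 1, so the mesh denominator n m - 1
    exceeds m^(1/2+\<alpha>) - 2, and \<delta> decays like m^(-\<alpha>).\<close>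
  define \<delta> where "\<delta> m = sqrt (real m) * ((b - a) / (real m powr (1 / 2 + \<alpha>) - 2))" for m
  show ?thesis
  proof (rule weak_convergence_from_lattice[where W = fluctuation and \<rho> = rescaled and \<delta> = \<delta>,
        OF P Q sets_Q rescaled_in f_range_nonempty fluctuation_measurable _ tight])
    show "(\<lambda>m. \<integral>\<omega>. p (fluctuation m \<omega>) \<partial>P) \<longlonglongrightarrow> (\<integral>v. p v \<partial>Q)" if "trig_polynomial p" for p
    proof (rule trig_polynomial_convergence[OF P Q sets_Q fluctuation_measurable _ that])
      fix F :: "(nat \<times> nat) set" and u :: "nat \<times> nat \<Rightarrow> real" assume "finite F"
      then show "(\<lambda>m. char (distr P borel (\<lambda>\<omega>. \<Sum>i\<in>F. u i * fluctuation m \<omega> i)) 1)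
          \<longlonglongrightarrow> char (distr Q borel (\<lambda>v. \<Sum>i\<in>F. u i * v i)) 1"
        using fluctuation_char[where A = F and c = u and \<iota> = "\<lambda>i. i" and t = 1] by (simp add: char_Q)
    qed
    show "\<delta> \<longlonglongrightarrow> 0" unfolding \<delta>_def using \<open>0 < \<alpha>\<close> a_less_b by real_asymp
    show "AE \<omega> in P. \<forall>m\<ge>m1. \<forall>y\<in>{f a..f b}.
      \<bar>(\<lambda>y\<in>{f a..f b}. sqrt (real m) * (estimator a b J m (n m) \<omega> y - struct_exp_inv M H a b f y)) y -
        lattice_limit (fluctuation m \<omega>) (rescaled y)\<bar> \<le> \<delta> m"
      using h_warping AE_space
    proof eventually_elim
      case (elim \<omega>)
      show ?case
      proof (intro allI impI ballI)
        fix m y assume "m1 \<le> m" and y: "y \<in> {f a..f b}"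
        then have m: "1 \<le> m" "m2 \<le> m" by (auto simp: m1_def)
        have nm: "real m powr (1 / 2 + \<alpha>) - 2 \<le> real (n m) - 1" "1 < real m powr (1 / 2 + \<alpha>) - 1"
          using n[OF m(1)] m2[OF m(2)] by auto
        then have "1 < real (n m)" using n[OF m(1)] by linarith
        then have n1: "1 < n m" by simp
        let ?mean = "(\<Sum>j<m. h (Suc j) \<omega> (finv y)) / real m"
        have root: "(S - real m * p) / r = r * (S / real m - p)" if "0 < r" "real m = r * r" for S p r
          unfolding that(2) using that(1) by (simp add: field_simps)
        have "lattice_limit (fluctuation m \<omega>) (rescaled y) = sqrt (real m) * (?mean - \<phi> (finv y))"
          unfolding fluctuation_limit[OF elim(2) y] sum_subtractf using m(1)
          by (simp add: root)
        then have "\<bar>sqrt (real m) * (estimator a b J m (n m) \<omega> y - struct_exp_inv M H a b f y) -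
            lattice_limit (fluctuation m \<omega>) (rescaled y)\<bar> =
            sqrt (real m) * \<bar>estimator a b J m (n m) \<omega> y - ?mean\<bar>"
          by (simp add: struct_exp_inv_def right_diff_distrib [symmetric] abs_mult)
        also have "\<dots> \<le> sqrt (real m) * ((b - a) / (real (n m) - 1))"
          by (intro mult_left_mono estimator_close elim(1)[rule_format] elim(2) y n1 m(1)) simp
        also have "\<dots> \<le> \<delta> m"
          unfolding \<delta>_def using nm a_less_b by (intro mult_left_mono divide_left_mono) auto
        finally show "\<bar>(\<lambda>y\<in>{f a..f b}. sqrt (real m) *
            (estimator a b J m (n m) \<omega> y - struct_exp_inv M H a b f y)) y -
          lattice_limit (fluctuation m \<omega>) (rescaled y)\<bar> \<le> \<delta> m" using y by simp
      qed
    qed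
    show "(\<lambda>y\<in>{f a..f b}. sqrt (real m) * (estimator a b J m (n m) \<omega> y - struct_exp_inv M H a b f y))
      \<in> mspace D" if \<omega>: "\<omega> \<in> space P" for m \<omega>
    proof -
      have "\<bar>sqrt (real m) * (estimator a b J m (n m) \<omega> y - struct_exp_inv M H a b f y)\<bar> \<le> sqrt (real m) * (b - a)"
        if y: "y \<in> {f a..f b}" for y
      \<comment> \<open>For m = 0 the factor \<open>sqrt (real m)\<close> is 0, whatever the value
        of \<open>n 0\<close>.\<close>
      proof (cases "m = 0")
        case False
        then have m: "1 \<le> m" by simp
        have "1 \<le> real m powr (1 / 2 + \<alpha>)" using m \<open>0 < \<alpha>\<close> by (simp add: ge_one_powr_ge_zero)
        then have "0 < real (n m)" using n[OF m] by linarith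
        then have "1 \<le> n m" by simp
        then have "estimator a b J m (n m) \<omega> y \<in> {a..b}" by (intro estimator_bounded y \<omega> m)
        moreover have "struct_exp_inv M H a b f y \<in> {a..b}"
          unfolding struct_exp_inv_def o_def by (intro mean_range finv(1) y)
        ultimately have "\<bar>estimator a b J m (n m) \<omega> y - struct_exp_inv M H a b f y\<bar> \<le> b - a" by auto
        then show ?thesis by (simp add: abs_mult mult_left_mono)
      qed simp
      then have "bounded ((\<lambda>y\<in>{f a..f b}. sqrt (real m) *
          (estimator a b J m (n m) \<omega> y - struct_exp_inv M H a b f y)) ` {f a..f b})"
        by (intro boundedI[of _ "sqrt (real m) * (b - a)"]) auto
      then show ?thesis unfolding mspace_bounded_functions by simp
    qed
  qed
qed

end

theorem theorem2p1:
  fixes M :: "'w measure" and P :: "'v measure"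
    and a b :: real
    and H :: "'w \<Rightarrow> real \<Rightarrow> real"
    and h :: "nat \<Rightarrow> 'v \<Rightarrow> real \<Rightarrow> real"
    and f :: "real \<Rightarrow> real"
    and J :: "nat \<Rightarrow> nat \<Rightarrow> real \<Rightarrow> 'v \<Rightarrow> nat"
  assumes "a < b"
    and "prob_space M" and "prob_space P"
    and "warping_process M a b H"
    and "iid_realizations P a b h M H"
    and "continuous_on {a..b} f" and "strict_mono_on {a..b} f"
    and "nearest_selection P a b f h J"
  shows
    "(AE \<omega> in P. \<forall>\<epsilon>>0. \<exists>m0 n0. \<forall>m>m0. \<forall>n>n0.
        \<bar>(SUP y\<in>{f a..f b}. \<bar>estimator a b J m n \<omega> y - struct_exp_inv M H a b f y\<bar>) - 0\<bar> < \<epsilon>)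
     \<and>
     (\<forall>(\<alpha>::real) (n :: nat \<Rightarrow> nat).
        \<alpha> > 0 \<and>
        (\<forall>m\<ge>1. \<bar>real (n m) - real m powr (1 / 2 + \<alpha>)\<bar> < 1) \<and>
        (\<exists>C1>0. \<exists>C2>0.
           (\<forall>s\<in>{a..b}. \<forall>t\<in>{a..b}.
              (\<integral>w. \<bar>H w s - mean_fun M H s - (H w t - mean_fun M H t)\<bar>\<^sup>2 \<partial>M) \<le> C1 * \<bar>s - t\<bar>\<^sup>2) \<and>
           (\<forall>s\<in>{f a..f b}. \<forall>t\<in>{f a..f b}.
              \<bar>inv_into {a..b} f s - inv_into {a..b} f t\<bar>\<^sup>2 \<le> C2 * \<bar>s - t\<bar>\<^sup>2)) \<longrightarrow>
        (\<exists>(N :: (real \<Rightarrow> real) measure) (G :: (real \<Rightarrow> real) \<Rightarrow> real \<Rightarrow> real).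
           prob_space N \<and>
           gaussian_process N {f a..f b} G \<and>
           (\<forall>y\<in>{f a..f b}. (\<integral>x. G x y \<partial>N) = 0) \<and>
           (\<forall>s\<in>{f a..f b}. \<forall>t\<in>{f a..f b}.
              covariance N (\<lambda>x. G x s) (\<lambda>x. G x t)
                = cov_fun M H (inv_into {a..b} f s) (inv_into {a..b} f t)) \<and>
           weakly_converges P (bounded_space (f a) (f b))
             (\<lambda>m \<omega>. \<lambda>y\<in>{f a..f b}.
                sqrt (real m) * (estimator a b J m (n m) \<omega> y - struct_exp_inv M H a b f y))
             N G))"
proof (intro conjI allI impI)
  interpret curve_registration M P a b H h f J
    using assms by (rule curve_registration.intro)
  show "AE \<omega> in P. \<forall>\<epsilon>>0. \<exists>m0 n0. \<forall>m>m0. \<forall>n>n0.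
      \<bar>(SUP y\<in>{f a..f b}. \<bar>estimator a b J m n \<omega> y - struct_exp_inv M H a b f y\<bar>) - 0\<bar> < \<epsilon>"
    by (rule uniform_consistency)
  fix \<alpha> :: real and n :: "nat \<Rightarrow> nat"
  assume *: "\<alpha> > 0 \<and>
        (\<forall>m\<ge>1. \<bar>real (n m) - real m powr (1 / 2 + \<alpha>)\<bar> < 1) \<and>
        (\<exists>C1>0. \<exists>C2>0.
           (\<forall>s\<in>{a..b}. \<forall>t\<in>{a..b}.
              (\<integral>w. \<bar>H w s - mean_fun M H s - (H w t - mean_fun M H t)\<bar>\<^sup>2 \<partial>M) \<le> C1 * \<bar>s - t\<bar>\<^sup>2) \<and>
           (\<forall>s\<in>{f a..f b}. \<forall>t\<in>{f a..f b}.
              \<bar>inv_into {a..b} f s - inv_into {a..b} f t\<bar>\<^sup>2 \<le> C2 * \<bar>s - t\<bar>\<^sup>2))"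
  then obtain C1 where C1: "0 < C1" "\<And>s t. s \<in> {a..b} \<Longrightarrow> t \<in> {a..b} \<Longrightarrow>
      (\<integral>w. \<bar>H w s - mean_fun M H s - (H w t - mean_fun M H t)\<bar>\<^sup>2 \<partial>M) \<le> C1 * \<bar>s - t\<bar>\<^sup>2"
    by blast
  \<comment> \<open>The covariance to be realized is that of the centered dyadic values of
    \<open>H\<close>, which are almost surely bounded and hence square integrable.\<close>
  obtain Q where Q: "prob_space Q" "sets Q = sets borel"
    "\<And>F u t. finite F \<Longrightarrow> char (distr Q borel (\<lambda>v. \<Sum>i\<in>F. u i * v i)) t =
       exp (- (t\<^sup>2 * (\<integral>w. (\<Sum>i\<in>F. u i * centered i (H w))\<^sup>2 \<partial>M)) / 2)"
    using gaussian_family_exists[of "\<lambda>i w. centered i (H w)", OF centered_square_integrable] by blast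
  interpret gaussian_limit M P a b H h f J Q C1
    by (intro gaussian_limit.intro gaussian_limit_axioms.intro curve_registration_axioms)
       (use Q C1 in auto)
  show "\<exists>(N :: (real \<Rightarrow> real) measure) (G :: (real \<Rightarrow> real) \<Rightarrow> real \<Rightarrow> real).
           prob_space N \<and>
           gaussian_process N {f a..f b} G \<and>
           (\<forall>y\<in>{f a..f b}. (\<integral>x. G x y \<partial>N) = 0) \<and>
           (\<forall>s\<in>{f a..f b}. \<forall>t\<in>{f a..f b}.
              covariance N (\<lambda>x. G x s) (\<lambda>x. G x t)
                = cov_fun M H (inv_into {a..b} f s) (inv_into {a..b} f t)) \<and>
           weakly_converges P (bounded_space (f a) (f b))
             (\<lambda>m \<omega>. \<lambda>y\<in>{f a..f b}.
                sqrt (real m) * (estimator a b J m (n m) \<omega> y - struct_exp_inv M H a b f y))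
             N G"
  \<comment> \<open>The limit process is the identity on its own path space, so statements about
    \<open>G\<close> are statements about the law \<open>N\<close>.\<close>
  proof (intro exI[of _ N] exI[of _ "\<lambda>x. x"] conjI ballI)
    show "prob_space N" by (rule N.prob_space_axioms)
    show "gaussian_process N {f a..f b} (\<lambda>x. x)"
      unfolding gaussian_process_def using combination_N(1) by blast
    show "weakly_converges P (bounded_space (f a) (f b))
        (\<lambda>m \<omega>. \<lambda>y\<in>{f a..f b}.
          sqrt (real m) * (estimator a b J m (n m) \<omega> y - struct_exp_inv M H a b f y)) N (\<lambda>x. x)"
      using * by (intro weak_convergence) auto
  qed (fact mean_N covariance_N)+
qed

end
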